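(* Let $1 \leq p < \infty$, let $\phi$ be analytic on the open unit disk $\mathbb{D}$ and let $\varphi$ be an analytic self-map of $\mathbb{D}$. If the weighted composition operator $W_{\phi,\varphi}\colon S^p \to S^p$ is bounded but not compact, then $W_{\phi,\varphi}$ fixes an isomorphic copy of $\ell^p$ in $S^p$. In particular, $W_{\phi,\varphi}$ is not strictly singular; that is, for a bounded operator $W_{\phi,\varphi}$ on $S^p$, strict singularity coincides with compactness.
   Context: $\mathbb{D}$ is the open unit disk, $m$ the normalized Lebesgue measure on $\partial\mathbb{D}$. For $0<p<\infty$, the Hardy space $H^p$ consists of analytic $f$ on $\mathbb{D}$ with $\|f\|_{H^p}=\sup_{0\le r<1}\left(\int_{\partial\mathbb{D}}|f(r\xi)|^p\,dm(\xi)\right)^{1/p}<\infty$; $H^\infty$ is the space of bounded analytic functions with the sup norm. The derivative Hardy space is $S^p=\{f \text{ analytic on } \mathbb{D}: \|f\|_{S^p}:=|f(0)|+\|f'\|_{H^p}<\infty\}$. The weighted composition operator is $W_{\phi,\varphi}f(z)=\phi(z)f(\varphi(z))$. A bounded operator $T\colon X\to Y$ between Banach spaces fixes a copy of a Banach space $E$ if there is a closed subspace $M\subset X$ linearly isomorphic to $E$ such that $T|_M$ is an isomorphism from $M$ onto $T(M)$. $T$ is strictly singular if its restriction to any infinite-dimensional closed subspace is not an isomorphism onto its image. *)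

theory Defs
  imports "HOL-Analysis.Analysis"
begin

type_synonym cfun = "complex \<Rightarrow> complex"

definition hardy_mean :: "real \<Rightarrow> cfun \<Rightarrow> real \<Rightarrow> real" where
  "hardy_mean p f r = integral {0..2*pi} (\<lambda>t. norm (f (complex_of_real r * cis t)) powr p) / (2*pi)"

definition hardy_space :: "real \<Rightarrow> cfun set" where
  "hardy_space p = {f. f holomorphic_on ball 0 1 \<and> bdd_above (hardy_mean p f ` {0..<1})}"

definition hardy_norm :: "real \<Rightarrow> cfun \<Rightarrow> real" where
  "hardy_norm p f = (SUP r\<in>{0..<1}. hardy_mean p f r) powr (1/p)"

text \<open>Derivative Hardy space S^p. Functions are normalised to vanish off the disk,
  so that elements of S^p are determined by their values on D.\<close>
definition sp_space :: "real \<Rightarrow> cfun set" where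
  "sp_space p = {f. f holomorphic_on ball 0 1 \<and> (\<forall>z. z \<notin> ball 0 1 \<longrightarrow> f z = 0)
                    \<and> deriv f \<in> hardy_space p}"

definition sp_norm :: "real \<Rightarrow> cfun \<Rightarrow> real" where
  "sp_norm p f = norm (f 0) + hardy_norm p (deriv f)"

definition wcomp :: "cfun \<Rightarrow> cfun \<Rightarrow> cfun \<Rightarrow> cfun" where
  "wcomp \<phi> \<psi> f = (\<lambda>z. if z \<in> ball 0 1 then \<phi> z * f (\<psi> z) else 0)"

definition lp_space :: "real \<Rightarrow> (nat \<Rightarrow> complex) set" where
  "lp_space p = {x. summable (\<lambda>n. norm (x n) powr p)}"

definition lp_norm :: "real \<Rightarrow> (nat \<Rightarrow> complex) \<Rightarrow> real" where
  "lp_norm p x = (\<Sum>n. norm (x n) powr p) powr (1/p)"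

definition bounded_op :: "real \<Rightarrow> (cfun \<Rightarrow> cfun) \<Rightarrow> bool" where
  "bounded_op p T \<longleftrightarrow> (\<forall>f\<in>sp_space p. T f \<in> sp_space p)
     \<and> (\<exists>C. \<forall>f\<in>sp_space p. sp_norm p (T f) \<le> C * sp_norm p f)"

definition compact_op :: "real \<Rightarrow> (cfun \<Rightarrow> cfun) \<Rightarrow> bool" where
  "compact_op p T \<longleftrightarrow> (\<forall>f :: nat \<Rightarrow> cfun. (\<forall>n. f n \<in> sp_space p) \<longrightarrow>
      (\<exists>B. \<forall>n. sp_norm p (f n) \<le> B) \<longrightarrow>
      (\<exists>g\<in>sp_space p. \<exists>r. strict_mono r \<and>
          (\<lambda>n. sp_norm p (\<lambda>z. T (f (r n)) z - g z)) \<longlonglongrightarrow> 0))"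

definition linear_subspace :: "cfun set \<Rightarrow> bool" where
  "linear_subspace M \<longleftrightarrow> (\<lambda>z. 0) \<in> M \<and> (\<forall>f\<in>M. \<forall>g\<in>M. (\<lambda>z. f z + g z) \<in> M)
     \<and> (\<forall>c. \<forall>f\<in>M. (\<lambda>z. c * f z) \<in> M)"

definition closed_subspace :: "real \<Rightarrow> cfun set \<Rightarrow> bool" where
  "closed_subspace p M \<longleftrightarrow> M \<subseteq> sp_space p \<and> linear_subspace M \<and>
     (\<forall>f g. (\<forall>n. f n \<in> M) \<longrightarrow> g \<in> sp_space p \<longrightarrow>
        (\<lambda>n. sp_norm p (\<lambda>z. f n z - g z)) \<longlonglongrightarrow> 0 \<longrightarrow> g \<in> M)"

definition infinite_dim :: "cfun set \<Rightarrow> bool" where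
  "infinite_dim M \<longleftrightarrow> (\<forall>n. \<exists>g :: nat \<Rightarrow> cfun. (\<forall>i<n. g i \<in> M) \<and>
      (\<forall>c :: nat \<Rightarrow> complex. (\<forall>z. (\<Sum>i<n. c i * g i z) = 0) \<longrightarrow> (\<forall>i<n. c i = 0)))"

definition isomorphic_to_lp :: "real \<Rightarrow> cfun set \<Rightarrow> bool" where
  "isomorphic_to_lp p M \<longleftrightarrow> (\<exists>J :: (nat \<Rightarrow> complex) \<Rightarrow> cfun.
      bij_betw J (lp_space p) M \<and>
      (\<forall>x\<in>lp_space p. \<forall>y\<in>lp_space p. J (\<lambda>n. x n + y n) = (\<lambda>z. J x z + J y z)) \<and>
      (\<forall>c. \<forall>x\<in>lp_space p. J (\<lambda>n. c * x n) = (\<lambda>z. c * J x z)) \<and>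
      (\<exists>a>0. \<exists>b. \<forall>x\<in>lp_space p. a * lp_norm p x \<le> sp_norm p (J x) \<and> sp_norm p (J x) \<le> b * lp_norm p x))"

text \<open>For a bounded linear T, T restricted to M is an isomorphism onto T(M)
  iff T is bounded below on M.\<close>
definition iso_on :: "real \<Rightarrow> (cfun \<Rightarrow> cfun) \<Rightarrow> cfun set \<Rightarrow> bool" where
  "iso_on p T M \<longleftrightarrow> (\<exists>c>0. \<forall>f\<in>M. c * sp_norm p f \<le> sp_norm p (T f))"

definition fixes_copy_lp :: "real \<Rightarrow> (cfun \<Rightarrow> cfun) \<Rightarrow> bool" where
  "fixes_copy_lp p T \<longleftrightarrow> (\<exists>M. closed_subspace p M \<and> isomorphic_to_lp p M \<and> iso_on p T M)"

definition strictly_singular :: "real \<Rightarrow> (cfun \<Rightarrow> cfun) \<Rightarrow> bool" where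
  "strictly_singular p T \<longleftrightarrow> (\<forall>M. closed_subspace p M \<longrightarrow> infinite_dim M \<longrightarrow> \<not> iso_on p T M)"

end

theory Submission
  imports Defs "HOL-Complex_Analysis.Complex_Analysis" "HOL-Real_Asymp.Real_Asymp"
begin

text \<open>
  Everything is done with means of continuous functions over the circles of radius less than 1, so
  no boundary values are needed. Write $(W f)' = \phi' \, f \circ \psi + u \, f' \circ \psi$ with
  $u = \phi \psi'$. A function in $S^p$ is bounded by its norm (Carleson's inequality on a radius),
  and $f \mapsto \phi' \, f \circ \psi$ is always compact, because $|\phi'|^p$ is uniformly
  integrable on circles and bounded sequences of $S^p$ that tend to 0 locally uniformly tend to 0 in
  $H^2$. The operator $f' \mapsto u \, f' \circ \psi$ is controlled by Carleson's inequality for the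
  push-forward of $|u|^p$ under $\psi$. It is reduced from $H^p$ to $H^2$ by a majorant
  $|F|^p \le |h|^2$ with $h \in H^2$ of the same norm. Hence, if $W$ is not compact, then $W K_n$ does not tend to 0 for some
  functions $K_n$ whose derivatives are $p$-th roots of normalised kernels concentrating at a point
  $\xi$ of the circle. Since $\ln |\psi - \xi|$ is harmonic, $\{|\psi - \xi| < \eta\}$ is small
  uniformly in the radius, and a gliding hump gives a subsequence for which the $K_n'$ and
  the $(W K_n)'$ are both almost disjoint, hence equivalent to the basis of $\ell^p$. Conversely, an
  infinite-dimensional subspace contains unit vectors with arbitrarily many vanishing Taylor
  coefficients. They tend to 0 locally uniformly, so a compact $W$ cannot be bounded below on them.
\<close>

subsection \<open>Circle means and Taylor coefficients\<close>

definition cmean :: "(complex \<Rightarrow> 'a::banach) \<Rightarrow> real \<Rightarrow> 'a" where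
  "cmean g r = integral {0..2*pi} (\<lambda>t. g (complex_of_real r * cis t)) /\<^sub>R (2*pi)"

lemma hardy_mean_eq_cmean: "hardy_mean p f r = cmean (\<lambda>z. norm (f z) powr p) r"
  by (simp add: hardy_mean_def cmean_def field_simps)

lemma circle_param_in_sphere: "r \<ge> 0 \<Longrightarrow> complex_of_real r * cis t \<in> sphere 0 r"
  by (simp add: norm_mult)

lemma circle_integrable:
  fixes g :: "complex \<Rightarrow> 'a::banach"
  assumes "continuous_on (sphere 0 r) g" "r \<ge> 0"
  shows "(\<lambda>t. g (complex_of_real r * cis t)) integrable_on {0..2*pi}"
proof (rule integrable_continuous_real)
  show "continuous_on {0..2*pi} (\<lambda>t. g (complex_of_real r * cis t))"
    by (rule continuous_on_compose2[OF assms(1)])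
       (use assms(2) circle_param_in_sphere[OF assms(2)] in \<open>auto intro!: continuous_intros\<close>)
qed

lemma cmean_cong: "(\<And>z. norm z = r \<Longrightarrow> f z = g z) \<Longrightarrow> r \<ge> 0 \<Longrightarrow> cmean f r = cmean g r"
  unfolding cmean_def by (intro arg_cong[where f="\<lambda>x. x /\<^sub>R _"] integral_cong) (auto simp: norm_mult)

lemma cmean_mono:
  fixes f g :: "complex \<Rightarrow> real"
  assumes "continuous_on (sphere 0 r) f" "continuous_on (sphere 0 r) g" "r \<ge> 0"
    "\<And>z. norm z = r \<Longrightarrow> f z \<le> g z"
  shows "cmean f r \<le> cmean g r"
  unfolding cmean_def
  by (auto intro!: mult_left_mono integral_le circle_integrable assms simp: norm_mult assms(3)[THEN abs_of_nonneg])

lemma cmean_const [simp]: "cmean (\<lambda>z. c) r = c"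
  by (simp add: cmean_def)

lemma cmean_nonneg:
  fixes f :: "complex \<Rightarrow> real"
  assumes "continuous_on (sphere 0 r) f" "r \<ge> 0" "\<And>z. norm z = r \<Longrightarrow> 0 \<le> f z"
  shows "0 \<le> cmean f r"
  using cmean_mono[of r "\<lambda>z. 0" f] assms by simp

lemma cmean_le_const:
  fixes f :: "complex \<Rightarrow> real"
  assumes "continuous_on (sphere 0 r) f" "r \<ge> 0" "\<And>z. norm z = r \<Longrightarrow> f z \<le> c"
  shows "cmean f r \<le> c"
  using cmean_mono[of r f "\<lambda>z. c"] assms by simp

lemma cmean_add:
  assumes "continuous_on (sphere 0 r) f" "continuous_on (sphere 0 r) g" "r \<ge> 0"
  shows "cmean (\<lambda>z. f z + g z) r = cmean f r + cmean g r"
  unfolding cmean_def by (simp add: integral_add circle_integrable assms scaleR_add_right)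

lemma cmean_diff:
  assumes "continuous_on (sphere 0 r) f" "continuous_on (sphere 0 r) g" "r \<ge> 0"
  shows "cmean (\<lambda>z. f z - g z) r = cmean f r - cmean g r"
  unfolding cmean_def by (simp add: integral_diff circle_integrable assms scaleR_diff_right)

lemma cmean_cmult:
  fixes f :: "complex \<Rightarrow> 'a::{banach,real_normed_field}"
  assumes "continuous_on (sphere 0 r) f" "r \<ge> 0"
  shows "cmean (\<lambda>z. c * f z) r = c * cmean f r"
  unfolding cmean_def by (simp add: circle_integrable assms)

lemma cmean_sum:
  assumes "finite I" "\<And>i. i \<in> I \<Longrightarrow> continuous_on (sphere 0 r) (f i)" "r \<ge> 0"
  shows "cmean (\<lambda>z. \<Sum>i\<in>I. f i z) r = (\<Sum>i\<in>I. cmean (f i) r)"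
  unfolding cmean_def by (simp add: integral_sum circle_integrable assms scaleR_sum_right)

lemma cmean_bounded_linear:
  assumes "bounded_linear L" "continuous_on (sphere 0 r) f" "r \<ge> 0"
  shows "cmean (\<lambda>z. L (f z)) r = L (cmean f r)"
proof -
  interpret bounded_linear L by fact
  show ?thesis
    unfolding cmean_def
    using integral_linear[OF circle_integrable[OF assms(2,3)] assms(1)]
    by (simp add: o_def scaleR)
qed

lemma norm_cmean_le:
  fixes f :: "complex \<Rightarrow> 'a::banach"
  assumes "continuous_on (sphere 0 r) f" "r \<ge> 0"
  shows "norm (cmean f r) \<le> cmean (\<lambda>z. norm (f z)) r"
proof -
  have "norm (integral {0..2*pi} (\<lambda>t. f (complex_of_real r * cis t)))
    \<le> integral {0..2*pi} (\<lambda>t. norm (f (complex_of_real r * cis t)))"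
    by (rule integral_norm_bound_integral) (auto intro!: circle_integrable assms continuous_intros)
  thus ?thesis unfolding cmean_def by (simp add: divide_simps)
qed

lemma cmean_uniform_limit:
  fixes f :: "nat \<Rightarrow> complex \<Rightarrow> 'a::banach"
  assumes "uniform_limit (sphere 0 r) f g sequentially"
    and "\<And>n. continuous_on (sphere 0 r) (f n)" "r \<ge> 0"
  shows "(\<lambda>n. cmean (f n) r) \<longlonglongrightarrow> cmean g r"
proof -
  have "uniform_limit {0..2*pi} (\<lambda>n t. f n (complex_of_real r * cis t)) (\<lambda>t. g (complex_of_real r * cis t)) sequentially"
    by (rule uniform_limit_compose'[OF assms(1)]) (use assms(3) in \<open>auto simp: norm_mult\<close>)
  moreover have "continuous_on {0..2*pi} (\<lambda>t. f n (complex_of_real r * cis t))" for n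
    by (rule continuous_on_compose2[OF assms(2)])
       (use circle_param_in_sphere[OF assms(3)] in \<open>auto intro!: continuous_intros\<close>)
  ultimately obtain I J where
    I: "\<And>n. ((\<lambda>t. f n (complex_of_real r * cis t)) has_integral I n) {0..2*pi}" and
    J: "((\<lambda>t. g (complex_of_real r * cis t)) has_integral J) {0..2*pi}" "I \<longlonglongrightarrow> J"
    by (rule uniform_limit_integral) auto
  have "((\<lambda>n. integral {0..2*pi} (\<lambda>t. f n (complex_of_real r * cis t)))
      \<longlongrightarrow> integral {0..2*pi} (\<lambda>t. g (complex_of_real r * cis t))) sequentially"
    unfolding integral_unique[OF I] integral_unique[OF J(1)] by (rule J(2))
  thus ?thesis unfolding cmean_def by (intro tendsto_intros)
qed

lemma cmean_holomorphic:
  assumes "f holomorphic_on ball 0 R" "0 \<le> r" "r < R"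
  shows "cmean f r = f 0"
proof (cases "r = 0")
  case True thus ?thesis by (simp add: cmean_def)
next
  case False
  with assms have r: "r > 0" by simp
  have "((\<lambda>u. f u / (u - 0)) has_contour_integral 2 * of_real pi * \<i> * f 0) (circlepath 0 r)"
    by (rule Cauchy_integral_circlepath_simple) (use assms r in \<open>auto intro: holomorphic_on_subset\<close>)
  hence *: "((\<lambda>t. f (r * cis t) / (r * cis t) * (r * \<i> * cis t)) has_integral 2 * of_real pi * \<i> * f 0) {0..2*pi}"
    using r unfolding circlepath_def by (subst (asm) has_contour_integral_part_circlepath_iff) (simp_all add: r mult_ac cong: if_cong del: times_divide_eq_left times_divide_eq_right divide_eq_0_iff)
  have eq: "f (r * cis t) / (r * cis t) * (r * \<i> * cis t) = \<i> * f (r * cis t)" for t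
    using r by (simp add: field_simps)
  have "((\<lambda>t. \<i> * f (r * cis t)) has_integral \<i> * (2 * of_real pi * f 0)) {0..2*pi}"
    using * unfolding eq by (simp add: mult_ac)
  hence "((\<lambda>t. -\<i> * (\<i> * f (r * cis t))) has_integral -\<i> * (\<i> * (2 * of_real pi * f 0))) {0..2*pi}"
    by (rule has_integral_mult_right)
  hence "((\<lambda>t. f (r * cis t)) has_integral (2 * of_real pi * f 0)) {0..2*pi}"
    by simp
  from integral_unique[OF this] show ?thesis
    by (simp add: cmean_def scaleR_conv_of_real)
qed

definition taylor_coeff :: "(complex \<Rightarrow> complex) \<Rightarrow> nat \<Rightarrow> complex" where
  "taylor_coeff f n = (deriv ^^ n) f 0 / fact n"

lemma taylor_coeff_sums: "f holomorphic_on ball 0 1 \<Longrightarrow> norm z < 1 \<Longrightarrow> (\<lambda>n. taylor_coeff f n * z ^ n) sums f z"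
  using holomorphic_power_series[of f 0 1 z] by (simp add: taylor_coeff_def)

lemma power_sums_uniform_limit:
  fixes c :: "nat \<Rightarrow> complex"
  assumes f: "\<And>z. norm z < 1 \<Longrightarrow> (\<lambda>n. c n * z ^ n) sums f z" and r: "0 \<le> r" "r < 1"
  shows "uniform_limit (cball 0 r) (\<lambda>N z. \<Sum>n<N. c n * z ^ n) f sequentially"
proof -
  have "uniform_limit (cball 0 r) (\<lambda>N z. \<Sum>n<N. c n * z ^ n) (\<lambda>z. \<Sum>n. c n * z ^ n) sequentially"
  proof (rule Weierstrass_m_test)
    define w where "w = complex_of_real ((r + 1) / 2)"
    have w: "norm w < 1" "norm (complex_of_real r) < norm w"
      using r by (simp_all add: w_def norm_of_real del: of_real_divide of_real_add)
    show "summable (\<lambda>n. norm (c n * (complex_of_real r) ^ n))"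
      by (rule powser_insidea[OF sums_summable[OF f[OF w(1)]] w(2)])
    show "norm (c n * x ^ n) \<le> norm (c n * complex_of_real r ^ n)" if "x \<in> cball 0 r" for n x
      using that r by (auto simp: norm_mult norm_power intro!: mult_left_mono power_mono)
  qed
  moreover have "(\<Sum>n. c n * z ^ n) = f z" if "z \<in> cball 0 r" for z
    using f[of z] that r by (auto simp: sums_iff)
  ultimately show ?thesis by (subst (asm) uniform_limit_cong') auto
qed

lemma taylor_coeff_uniform_limit:
  assumes f: "f holomorphic_on ball 0 1" and r: "0 \<le> r" "r < 1"
  shows "uniform_limit (cball 0 r) (\<lambda>N z. \<Sum>n<N. taylor_coeff f n * z ^ n) f sequentially"
  by (rule power_sums_uniform_limit[OF taylor_coeff_sums[OF f] r])

lemma cmean_power_cnj_power: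
  assumes "0 \<le> r"
  shows "cmean (\<lambda>z. z ^ n * cnj z ^ m) r = (if n = m then of_real (r ^ (2 * n)) else 0)"
proof -
  have ge: "cmean (\<lambda>z. z ^ (m + k) * cnj z ^ m) r = of_real (r ^ (2 * m)) * 0 ^ k" for k m
  proof -
    have "z ^ (m + k) * cnj z ^ m = of_real (r ^ (2 * m)) * z ^ k" if "norm z = r" for z
    proof -
      have "z ^ (m + k) * cnj z ^ m = (z * cnj z) ^ m * z ^ k"
        by (simp add: power_add power_mult_distrib)
      also have "z * cnj z = of_real (r ^ 2)"
        using complex_norm_square[of z] that by simp
      finally show ?thesis by (simp add: power_mult)
    qed
    hence "cmean (\<lambda>z. z ^ (m + k) * cnj z ^ m) r = cmean (\<lambda>z. of_real (r ^ (2 * m)) * z ^ k) r"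
      by (intro cmean_cong) (use assms in auto)
    also have "\<dots> = of_real (r ^ (2 * m)) * 0 ^ k"
      by (rule cmean_holomorphic[of _ "r + 1"]) (use assms in \<open>auto intro!: holomorphic_intros\<close>)
    finally show ?thesis .
  qed
  show ?thesis
  proof (cases "n \<ge> m")
    case True
    then obtain k where "n = m + k" using le_Suc_ex by blast
    thus ?thesis using ge[of m k] by (cases "k = 0") auto
  next
    case False
    then obtain k where k: "m = n + k" using le_Suc_ex nat_le_linear by blast
    with False have k0: "k > 0" by (cases k) auto
    have "cmean (\<lambda>z. z ^ n * cnj z ^ m) r = cmean (\<lambda>z. cnj (z ^ m * cnj z ^ n)) r"
      by (rule arg_cong[where f="\<lambda>f. cmean f r"]) (simp add: mult.commute)
    also have "\<dots> = cnj (cmean (\<lambda>z. z ^ m * cnj z ^ n) r)"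
      by (rule cmean_bounded_linear[OF bounded_linear_cnj]) (use assms in \<open>auto intro!: continuous_intros\<close>)
    also have "\<dots> = 0"
      using ge[of n k] k0 unfolding k by simp
    finally show ?thesis using False by simp
  qed
qed

lemma coeff_cmean:
  assumes f: "\<And>z. norm z < 1 \<Longrightarrow> (\<lambda>n. c n * z ^ n) sums f z" and r: "0 \<le> r" "r < 1"
  shows "cmean (\<lambda>z. f z * cnj z ^ m) r = c m * of_real (r ^ (2 * m))"
proof -
  have u: "uniform_limit (sphere 0 r) (\<lambda>N z. \<Sum>n<N. c n * z ^ n) f sequentially"
    by (rule uniform_limit_on_subset[OF power_sums_uniform_limit[OF f r]]) auto
  have "continuous_on (sphere 0 r) f"
    by (rule uniform_limit_theorem[OF _ u]) (auto intro!: always_eventually continuous_intros)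
  hence bf: "bounded (f ` sphere 0 r)"
    using compact_continuous_image compact_imp_bounded compact_sphere by blast
  have "bounded ((\<lambda>z. cnj z ^ m) ` sphere 0 r)"
    by (intro compact_imp_bounded compact_continuous_image continuous_intros compact_sphere)
  hence "uniform_limit (sphere 0 r) (\<lambda>N z. (\<Sum>n<N. c n * z ^ n) * cnj z ^ m) (\<lambda>z. f z * cnj z ^ m) sequentially"
    by (intro uniform_lim_mult u uniform_limit_const bf)
  hence "(\<lambda>N. cmean (\<lambda>z. (\<Sum>n<N. c n * z ^ n) * cnj z ^ m) r) \<longlonglongrightarrow> cmean (\<lambda>z. f z * cnj z ^ m) r"
    by (rule cmean_uniform_limit) (use r in \<open>auto intro!: continuous_intros\<close>)
  moreover have "eventually (\<lambda>N. cmean (\<lambda>z. (\<Sum>n<N. c n * z ^ n) * cnj z ^ m) r = c m * of_real (r ^ (2 * m))) sequentially"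
    using eventually_gt_at_top[of m]
  proof eventually_elim
    case (elim N)
    have "cmean (\<lambda>z. (\<Sum>n<N. c n * z ^ n) * cnj z ^ m) r = cmean (\<lambda>z. \<Sum>n<N. c n * (z ^ n * cnj z ^ m)) r"
      by (simp add: sum_distrib_right mult.assoc)
    also have "\<dots> = (\<Sum>n<N. cmean (\<lambda>z. c n * (z ^ n * cnj z ^ m)) r)"
      by (rule cmean_sum) (use r in \<open>auto intro!: continuous_intros\<close>)
    also have "\<dots> = (\<Sum>n<N. c n * cmean (\<lambda>z. z ^ n * cnj z ^ m) r)"
      by (intro sum.cong refl cmean_cmult) (auto intro!: continuous_intros r)
    also have "\<dots> = (\<Sum>n<N. if n = m then c n * of_real (r ^ (2 * n)) else 0)"
      by (intro sum.cong refl) (use r in \<open>simp add: cmean_power_cnj_power\<close>)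
    finally show ?case using elim by simp
  qed
  hence "(\<lambda>N. cmean (\<lambda>z. (\<Sum>n<N. c n * z ^ n) * cnj z ^ m) r) \<longlonglongrightarrow> c m * of_real (r ^ (2 * m))"
    by (rule tendsto_eventually)
  ultimately show ?thesis by (rule LIMSEQ_unique)
qed

lemma taylor_coeff_unique:
  assumes f: "f holomorphic_on ball 0 1" and c: "\<And>z. norm z < 1 \<Longrightarrow> (\<lambda>n. c n * z ^ n) sums f z"
  shows "taylor_coeff f = c"
proof
  fix m
  have "taylor_coeff f m * of_real ((1/2) ^ (2 * m)) = c m * of_real ((1/2) ^ (2 * m))"
    using coeff_cmean[OF taylor_coeff_sums[OF f], of "1/2" m] coeff_cmean[OF c, of "1/2" m] by simp
  thus "taylor_coeff f m = c m" by simp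
qed

lemma parseval_poly:
  assumes "0 \<le> r"
  shows "cmean (\<lambda>z. (norm (\<Sum>n<N. c n * z ^ n))\<^sup>2) r = (\<Sum>n<N. (norm (c n))\<^sup>2 * r ^ (2 * n))"
proof -
  have eq: "complex_of_real ((norm (\<Sum>n<N. c n * z ^ n))\<^sup>2) = (\<Sum>n<N. \<Sum>m<N. c n * cnj (c m) * (z ^ n * cnj z ^ m))" for z
    unfolding complex_norm_square by (simp add: sum_product mult_ac)
  have "complex_of_real (cmean (\<lambda>z. (norm (\<Sum>n<N. c n * z ^ n))\<^sup>2) r)
     = cmean (\<lambda>z. complex_of_real ((norm (\<Sum>n<N. c n * z ^ n))\<^sup>2)) r"
    by (rule cmean_bounded_linear[OF bounded_linear_of_real, symmetric]) (auto intro!: continuous_intros assms)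
  also have "\<dots> = (\<Sum>n<N. \<Sum>m<N. cmean (\<lambda>z. c n * cnj (c m) * (z ^ n * cnj z ^ m)) r)"
    unfolding eq using assms
    by (subst cmean_sum; (intro sum.cong refl, subst cmean_sum)?) (auto intro!: continuous_intros)
  also have "\<dots> = (\<Sum>n<N. \<Sum>m<N. c n * cnj (c m) * cmean (\<lambda>z. (z ^ n * cnj z ^ m)) r)"
    by (intro sum.cong refl cmean_cmult) (auto intro!: continuous_intros assms)
  also have "\<dots> = complex_of_real (\<Sum>n<N. (norm (c n))\<^sup>2 * r ^ (2 * n))"
    using assms by (simp add: cmean_power_cnj_power complex_norm_square[symmetric] if_distrib cong: if_cong)
  finally show ?thesis using of_real_eq_iff by blast
qed

lemma parseval:
  assumes f: "f holomorphic_on ball 0 1" and r: "0 \<le> r" "r < 1"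
  shows "(\<lambda>n. (norm (taylor_coeff f n))\<^sup>2 * r ^ (2 * n)) sums cmean (\<lambda>z. (norm (f z))\<^sup>2) r"
proof -
  have cont: "continuous_on (cball 0 r) f"
    using r by (intro holomorphic_on_imp_continuous_on holomorphic_on_subset[OF f]) auto
  have bdd: "bounded (f ` cball 0 r)"
    using cont compact_continuous_image compact_imp_bounded compact_cball by blast
  have u: "uniform_limit (cball 0 r) (\<lambda>N z. \<Sum>n<N. taylor_coeff f n * z ^ n) f sequentially"
    by (rule taylor_coeff_uniform_limit[OF assms])
  have "uniform_limit (cball 0 r) (\<lambda>N z. Re ((\<Sum>n<N. taylor_coeff f n * z ^ n) * cnj (\<Sum>n<N. taylor_coeff f n * z ^ n))) (\<lambda>z. Re (f z * cnj (f z))) sequentially"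
    by (intro bounded_linear.uniform_limit[OF bounded_linear_Re] uniform_lim_mult u bdd
           bounded_linear.uniform_limit[OF bounded_linear_cnj])
       (use bdd in \<open>auto simp: bounded_iff\<close>)
  moreover have eq: "Re (w * cnj w) = (norm w)\<^sup>2" for w
    by (metis Re_complex_of_real complex_norm_square)
  ultimately have "uniform_limit (cball 0 r) (\<lambda>N z. (norm (\<Sum>n<N. taylor_coeff f n * z ^ n))\<^sup>2) (\<lambda>z. (norm (f z))\<^sup>2) sequentially"
    unfolding eq by simp
  hence "uniform_limit (sphere 0 r) (\<lambda>N z. (norm (\<Sum>n<N. taylor_coeff f n * z ^ n))\<^sup>2) (\<lambda>z. (norm (f z))\<^sup>2) sequentially"
    by (rule uniform_limit_on_subset) auto
  hence "(\<lambda>N. cmean (\<lambda>z. (norm (\<Sum>n<N. taylor_coeff f n * z ^ n))\<^sup>2) r) \<longlonglongrightarrow> cmean (\<lambda>z. (norm (f z))\<^sup>2) r"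
    by (rule cmean_uniform_limit) (use r in \<open>auto intro!: continuous_intros\<close>)
  thus ?thesis unfolding sums_def parseval_poly[OF r(1)] .
qed

lemma h2_coeffs:
  assumes f: "f holomorphic_on ball 0 1" 
    and B: "\<And>r. 0 \<le> r \<Longrightarrow> r < 1 \<Longrightarrow> cmean (\<lambda>z. (norm (f z))\<^sup>2) r \<le> B"
  shows "summable (\<lambda>n. (norm (taylor_coeff f n))\<^sup>2)" "(\<Sum>n. (norm (taylor_coeff f n))\<^sup>2) \<le> B"
proof -
  have part: "(\<Sum>n<N. (norm (taylor_coeff f n))\<^sup>2) \<le> B" for N
  proof -
    have "((\<lambda>r::real. \<Sum>n<N. (norm (taylor_coeff f n))\<^sup>2 * r ^ (2 * n)) \<longlongrightarrow> (\<Sum>n<N. (norm (taylor_coeff f n))\<^sup>2 * 1 ^ (2 * n))) (at_left 1)"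
      by (intro tendsto_intros)
    moreover have "eventually (\<lambda>r. (\<Sum>n<N. (norm (taylor_coeff f n))\<^sup>2 * r ^ (2 * n)) \<le> B) (at_left (1::real))"
    proof -
      have "eventually (\<lambda>r::real. r \<in> {0<..<1}) (at_left 1)"
        by (rule eventually_at_leftI[of 0]) auto
      thus ?thesis
      proof eventually_elim
        case (elim r)
        have "(\<Sum>n<N. (norm (taylor_coeff f n))\<^sup>2 * r ^ (2 * n)) \<le> cmean (\<lambda>z. (norm (f z))\<^sup>2) r"
          using parseval[OF f, of r] elim sum_le_suminf[of "\<lambda>n. (norm (taylor_coeff f n))\<^sup>2 * r ^ (2 * n)" "{..<N}"]
          by (auto simp: sums_iff)
        thus ?case using B[of r] elim by auto
      qed
    qed
    ultimately have "(\<Sum>n<N. (norm (taylor_coeff f n))\<^sup>2 * 1 ^ (2 * n)) \<le> B"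
      by (rule tendsto_upperbound) simp
    thus ?thesis by simp
  qed
  show "summable (\<lambda>n. (norm (taylor_coeff f n))\<^sup>2)"
    by (rule summableI_nonneg_bounded[OF _ part]) auto
  thus "(\<Sum>n. (norm (taylor_coeff f n))\<^sup>2) \<le> B"
    using part by (rule suminf_le_const)
qed

lemma h2_mean_le:
  assumes f: "f holomorphic_on ball 0 1" and r: "0 \<le> r" "r < 1"
    and s: "summable (\<lambda>n. (norm (taylor_coeff f n))\<^sup>2)"
  shows "cmean (\<lambda>z. (norm (f z))\<^sup>2) r \<le> (\<Sum>n. (norm (taylor_coeff f n))\<^sup>2)"
proof -
  have "(norm (taylor_coeff f n))\<^sup>2 * r ^ (2 * n) \<le> (norm (taylor_coeff f n))\<^sup>2" for n
    using r by (simp add: mult_left_le power_le_one)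
  thus ?thesis
    using parseval[OF f r] s suminf_le[of "\<lambda>n. (norm (taylor_coeff f n))\<^sup>2 * r ^ (2 * n)"] by (auto simp: sums_iff)
qed

subsection \<open>Carleson's inequality\<close>

text \<open>The squared modulus of the normalised Szego kernel at $a$; it is the test function of Carleson's condition.\<close>

definition kap :: "complex \<Rightarrow> complex \<Rightarrow> real" where
  "kap a z = (1 - (norm a)\<^sup>2) / (norm (1 - cnj a * z))\<^sup>2"

lemma one_minus_cnj_mult_nonzero:
  assumes "norm a \<le> 1" "norm z < 1"
  shows "1 - cnj a * z \<noteq> 0"
proof -
  have "norm (cnj a * z) < 1"
    using mult_le_less_imp_less[of "norm a" 1 "norm z" 1] assms mult_right_mono[of "norm a" 1 "norm z"]
    by (auto simp: norm_mult)
  thus ?thesis by auto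
qed

lemma kap_nonneg: "norm a \<le> 1 \<Longrightarrow> 0 \<le> kap a z"
  by (auto simp: kap_def power_le_one)

lemma kap_zero [simp]: "kap 0 z = 1"
  by (simp add: kap_def)

lemma norm_one_minus_cnj_commute: "norm (1 - cnj a * b) = norm (1 - cnj b * a)"
proof -
  have "norm (1 - cnj a * b) = norm (cnj (1 - cnj a * b))" by (simp only: complex_mod_cnj)
  thus ?thesis by (simp add: mult.commute)
qed

lemma norm_one_minus_cnj_square:
  "(norm (1 - cnj c * b))\<^sup>2 = (norm (c - b))\<^sup>2 + (1 - (norm c)\<^sup>2) * (1 - (norm b)\<^sup>2)"
  by (simp add: cmod_power2) (simp add: power2_eq_square algebra_simps)

lemma norm_diff_le_one_minus_cnj:
  assumes "norm c < 1" "norm b < 1"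
  shows "norm (c - b) \<le> norm (1 - cnj c * b)"
proof -
  have "0 \<le> (1 - (norm c)\<^sup>2) * (1 - (norm b)\<^sup>2)"
    using assms by (auto simp: power_le_one intro!: mult_nonneg_nonneg)
  thus ?thesis using norm_one_minus_cnj_square[of c b]
    by (intro power2_le_imp_le[of "norm (c - b)"]) auto
qed

lemma norm_one_minus_cnj_triangle:
  assumes "norm a < 1" "norm b < 1" "norm c < 1"
  shows "norm (1 - cnj a * b) \<le> norm (1 - cnj a * c) + norm (1 - cnj b * c)"
proof -
  have "1 - cnj a * b = (1 - cnj a * c) + cnj a * (c - b)" by (simp add: algebra_simps)
  hence "norm (1 - cnj a * b) \<le> norm (1 - cnj a * c) + norm a * norm (c - b)"
    by (metis complex_mod_cnj norm_mult norm_triangle_ineq)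
  also have "norm a * norm (c - b) \<le> 1 * norm (1 - cnj c * b)"
    using assms by (intro mult_mono norm_diff_le_one_minus_cnj) auto
  finally show ?thesis by (simp add: norm_one_minus_cnj_commute[of c b])
qed

lemma kap_mult_le:
  assumes "norm a < 1" "norm b < 1" "norm z < 1"
  shows "kap a z * kap b z \<le> 2 * kap b a * kap a z + 2 * kap a b * kap b z"
proof -
  define x y d where "x = norm (1 - cnj a * z)" and "y = norm (1 - cnj b * z)" and "d = norm (1 - cnj a * b)"
  have pos: "x > 0" "y > 0" "d > 0"
    unfolding x_def y_def d_def zero_less_norm_iff using assms by (intro one_minus_cnj_mult_nonzero; simp)+
  have d': "norm (1 - cnj b * a) = d" unfolding d_def by (rule norm_one_minus_cnj_commute)
  have "d \<le> x + y" unfolding x_def y_def d_def by (rule norm_one_minus_cnj_triangle) fact+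
  hence "d\<^sup>2 \<le> (x + y)\<^sup>2" using pos by (intro power_mono) auto
  also have "\<dots> \<le> 2 * (x\<^sup>2 + y\<^sup>2)" using sum_squares_bound[of x y] by (simp add: power2_sum)
  finally have "d\<^sup>2 / (d\<^sup>2 * x\<^sup>2 * y\<^sup>2) \<le> 2 * (x\<^sup>2 + y\<^sup>2) / (d\<^sup>2 * x\<^sup>2 * y\<^sup>2)"
    by (intro divide_right_mono) auto
  hence ineq: "1 / (x\<^sup>2 * y\<^sup>2) \<le> 2 / d\<^sup>2 * (1 / x\<^sup>2) + 2 / d\<^sup>2 * (1 / y\<^sup>2)"
    using pos by (simp add: field_simps)
  have nn: "0 \<le> (1 - (norm a)\<^sup>2) * (1 - (norm b)\<^sup>2)"
    using assms by (auto simp: power_le_one intro!: mult_nonneg_nonneg)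
  have "kap a z * kap b z = ((1 - (norm a)\<^sup>2) * (1 - (norm b)\<^sup>2)) * (1 / (x\<^sup>2 * y\<^sup>2))"
    by (simp add: kap_def x_def y_def)
  also have "\<dots> \<le> ((1 - (norm a)\<^sup>2) * (1 - (norm b)\<^sup>2)) * (2 / d\<^sup>2 * (1 / x\<^sup>2) + 2 / d\<^sup>2 * (1 / y\<^sup>2))"
    by (rule mult_left_mono[OF ineq nn])
  also have "\<dots> = 2 * kap b a * kap a z + 2 * kap a b * kap b z"
  proof -
    have "(p * q) * (2 / d\<^sup>2 * (1 / x\<^sup>2) + 2 / d\<^sup>2 * (1 / y\<^sup>2))
        = 2 * (q / d\<^sup>2) * (p / x\<^sup>2) + 2 * (p / d\<^sup>2) * (q / y\<^sup>2)" for p q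
      by (simp add: algebra_simps)
    thus ?thesis unfolding kap_def d' d_def[symmetric] x_def[symmetric] y_def[symmetric] .
  qed
  finally show ?thesis .
qed

lemma two_Re_szego_bounds:
  assumes "norm x < 1" "norm y < 1"
  shows "0 \<le> 2 * Re (1 / (1 - x * cnj y))" "2 * Re (1 / (1 - x * cnj y)) \<le> 1 + kap y x + kap x y"
proof -
  define d where "d = norm (1 - x * cnj y)"
  have d: "norm (1 - cnj y * x) = d" "norm (1 - cnj x * y) = d"
    unfolding d_def using norm_one_minus_cnj_commute[of y x] by (simp_all add: mult.commute)
  have d0: "d > 0" unfolding d(1)[symmetric] using one_minus_cnj_mult_nonzero[of y x] assms by auto
  have "Re (1 / (1 - x * cnj y)) = Re (1 - x * cnj y) / d\<^sup>2"
    by (simp add: d_def Re_divide cmod_power2)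
  moreover have "2 * Re (1 - x * cnj y) = d\<^sup>2 + 1 - (norm x)\<^sup>2 * (norm y)\<^sup>2"
    unfolding d_def cmod_power2 by (simp add: power2_eq_square algebra_simps)
  ultimately have eq: "2 * Re (1 / (1 - x * cnj y)) = (d\<^sup>2 + 1 - (norm x)\<^sup>2 * (norm y)\<^sup>2) / d\<^sup>2"
    by (simp add: field_simps)
  have xy: "(norm x)\<^sup>2 \<le> 1" "(norm y)\<^sup>2 \<le> 1" using assms by (auto simp: power_le_one)
  hence "(norm x)\<^sup>2 * (norm y)\<^sup>2 \<le> 1" by (simp add: mult_le_one)
  thus "0 \<le> 2 * Re (1 / (1 - x * cnj y))" unfolding eq by (intro divide_nonneg_nonneg) (use zero_le_power2[of d] in linarith)+
  have "0 \<le> (1 - (norm x)\<^sup>2) * (1 - (norm y)\<^sup>2)" using xy by simp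
  hence "d\<^sup>2 + 1 - (norm x)\<^sup>2 * (norm y)\<^sup>2 \<le> d\<^sup>2 + (1 - (norm y)\<^sup>2) + (1 - (norm x)\<^sup>2)"
    by (simp add: algebra_simps)
  hence "2 * Re (1 / (1 - x * cnj y)) \<le> (d\<^sup>2 + (1 - (norm y)\<^sup>2) + (1 - (norm x)\<^sup>2)) / d\<^sup>2"
    unfolding eq by (intro divide_right_mono) auto
  also have "\<dots> = 1 + kap y x + kap x y"
    using d0 unfolding kap_def d by (simp add: field_simps)
  finally show "2 * Re (1 / (1 - x * cnj y)) \<le> 1 + kap y x + kap x y" .
qed

lemma weighted_cauchy_schwarz:
  fixes w :: "'i \<Rightarrow> real"
  assumes "\<And>i. i \<in> I \<Longrightarrow> w i \<ge> 0"
  shows "(\<Sum>i\<in>I. w i * (a i * b i))\<^sup>2 \<le> (\<Sum>i\<in>I. w i * (a i)\<^sup>2) * (\<Sum>i\<in>I. w i * (b i)\<^sup>2)"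
proof -
  have "(\<Sum>i\<in>I. (sqrt (w i) * a i) * (sqrt (w i) * b i))\<^sup>2
      \<le> (\<Sum>i\<in>I. (sqrt (w i) * a i)\<^sup>2) * (\<Sum>i\<in>I. (sqrt (w i) * b i)\<^sup>2)"
    by (rule Cauchy_Schwarz_ineq_sum)
  moreover have "(\<Sum>i\<in>I. (sqrt (w i) * a i) * (sqrt (w i) * b i)) = (\<Sum>i\<in>I. w i * (a i * b i))"
    by (intro sum.cong refl) (use assms in \<open>simp add: algebra_simps flip: power2_eq_square\<close>)
  moreover have "(\<Sum>i\<in>I. (sqrt (w i) * f i)\<^sup>2) = (\<Sum>i\<in>I. w i * (f i)\<^sup>2)" for f
    by (intro sum.cong refl) (use assms in \<open>simp add: power_mult_distrib\<close>)
  ultimately show ?thesis by simp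
qed

text \<open>The matrix $A$ of the kernel satisfies $A^* A \le 2 C (A + A^*)$ entrywise. Hence
  $\|A v\|^2 \le 4 C \langle A v, v \rangle$, which bounds $A$ without a Schur test function.\<close>

lemma carleson_schur:
  fixes w v :: "'i \<Rightarrow> real" and z :: "'i \<Rightarrow> complex"
  assumes fin: "finite I" and w: "\<And>i. i \<in> I \<Longrightarrow> w i \<ge> 0" and v: "\<And>i. i \<in> I \<Longrightarrow> v i \<ge> 0"
    and z: "\<And>i. i \<in> I \<Longrightarrow> norm (z i) < 1"
    and C: "\<And>a. norm a < 1 \<Longrightarrow> (\<Sum>i\<in>I. w i * kap a (z i)) \<le> C"
  shows "(\<Sum>i\<in>I. \<Sum>j\<in>I. w i * w j * v i * v j * kap (z j) (z i)) \<le> 4 * C * (\<Sum>i\<in>I. w i * (v i)\<^sup>2)"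
proof -
  define Q where "Q = (\<Sum>i\<in>I. \<Sum>j\<in>I. w i * w j * v i * v j * kap (z j) (z i))"
  define V where "V = (\<Sum>i\<in>I. w i * (v i)\<^sup>2)"
  define A where "A i = (\<Sum>j\<in>I. w j * v j * kap (z j) (z i))" for i
  have kap: "kap (z j) (z i) \<ge> 0" if "i \<in> I" "j \<in> I" for i j
    using z that by (intro kap_nonneg) (auto simp: less_imp_le)
  have Q0: "Q \<ge> 0" unfolding Q_def by (intro sum_nonneg mult_nonneg_nonneg w v kap) auto
  have V0: "V \<ge> 0" unfolding V_def by (intro sum_nonneg mult_nonneg_nonneg w) auto
  have "0 \<le> (\<Sum>i\<in>I. w i * kap 0 (z i))" by (intro sum_nonneg mult_nonneg_nonneg w kap_nonneg) auto
  with C[of 0] have C0: "C \<ge> 0" by simp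
  have QA: "Q = (\<Sum>i\<in>I. w i * (v i * A i))"
    unfolding Q_def A_def by (simp add: sum_distrib_left mult_ac)
  have Q2: "Q\<^sup>2 \<le> V * (\<Sum>i\<in>I. w i * (A i)\<^sup>2)"
    unfolding QA V_def by (rule weighted_cauchy_schwarz[OF w])
  have "(\<Sum>i\<in>I. w i * (A i)\<^sup>2) = (\<Sum>i\<in>I. \<Sum>j\<in>I. \<Sum>l\<in>I. w j * v j * (w l * v l) * (w i * (kap (z j) (z i) * kap (z l) (z i))))"
    unfolding A_def power2_eq_square sum_product by (simp add: sum_distrib_left mult_ac)
  also have "\<dots> = (\<Sum>j\<in>I. \<Sum>l\<in>I. \<Sum>i\<in>I. w j * v j * (w l * v l) * (w i * (kap (z j) (z i) * kap (z l) (z i))))"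
    by (subst sum.swap) (intro sum.cong refl sum.swap)
  also have "\<dots> = (\<Sum>j\<in>I. \<Sum>l\<in>I. w j * v j * (w l * v l) * (\<Sum>i\<in>I. w i * (kap (z j) (z i) * kap (z l) (z i))))"
    by (simp add: sum_distrib_left)
  also have "\<dots> \<le> (\<Sum>j\<in>I. \<Sum>l\<in>I. w j * v j * (w l * v l) * (2 * C * (kap (z l) (z j) + kap (z j) (z l))))"
  proof (intro sum_mono mult_left_mono)
    fix j l assume jl: "j \<in> I" "l \<in> I"
    have "(\<Sum>i\<in>I. w i * (kap (z j) (z i) * kap (z l) (z i)))
       \<le> (\<Sum>i\<in>I. w i * (2 * kap (z l) (z j) * kap (z j) (z i) + 2 * kap (z j) (z l) * kap (z l) (z i)))"
      by (intro sum_mono mult_left_mono kap_mult_le w z jl)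
    also have "\<dots> = 2 * kap (z l) (z j) * (\<Sum>i\<in>I. w i * kap (z j) (z i)) + 2 * kap (z j) (z l) * (\<Sum>i\<in>I. w i * kap (z l) (z i))"
      by (simp add: sum_distrib_left sum.distrib algebra_simps)
    also have "\<dots> \<le> 2 * kap (z l) (z j) * C + 2 * kap (z j) (z l) * C"
      using jl kap[OF jl] kap[OF jl(2,1)] by (intro add_mono mult_left_mono C z) auto
    finally show "(\<Sum>i\<in>I. w i * (kap (z j) (z i) * kap (z l) (z i))) \<le> 2 * C * (kap (z l) (z j) + kap (z j) (z l))"
      by (simp add: algebra_simps)
  qed (use w v in auto)
  also have "\<dots> = 2 * C * (\<Sum>j\<in>I. \<Sum>l\<in>I. w j * w l * v j * v l * kap (z l) (z j))
        + 2 * C * (\<Sum>j\<in>I. \<Sum>l\<in>I. w j * w l * v j * v l * kap (z j) (z l))"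
    by (simp add: sum_distrib_left sum.distrib algebra_simps)
  also have "(\<Sum>j\<in>I. \<Sum>l\<in>I. w j * w l * v j * v l * kap (z j) (z l)) = Q"
    unfolding Q_def by (subst sum.swap) (simp add: mult_ac)
  finally have "(\<Sum>i\<in>I. w i * (A i)\<^sup>2) \<le> 4 * C * Q" unfolding Q_def by simp
  hence "Q\<^sup>2 \<le> V * (4 * C * Q)" using Q2 mult_left_mono[OF _ V0] by fastforce
  hence "Q * Q \<le> (4 * C * V) * Q" by (simp add: power2_eq_square mult_ac)
  hence "Q \<le> 4 * C * V"
    using Q0 C0 V0 by (cases "Q = 0") auto
  thus ?thesis by (simp add: Q_def V_def)
qed

lemma geometric_gram_sums:
  fixes w :: "'i \<Rightarrow> real" and u z :: "'i \<Rightarrow> complex"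
  assumes fin: "finite I" and z: "\<And>i. i \<in> I \<Longrightarrow> norm (z i) < 1"
  shows "(\<lambda>n. (norm (\<Sum>i\<in>I. w i * u i * z i ^ n))\<^sup>2) sums
     Re (\<Sum>i\<in>I. \<Sum>j\<in>I. w i * w j * (u i * cnj (u j)) * (1 / (1 - z i * cnj (z j))))"
proof -
  have "(norm (\<Sum>i\<in>I. w i * u i * z i ^ n))\<^sup>2
      = Re (\<Sum>i\<in>I. \<Sum>j\<in>I. w i * w j * (u i * cnj (u j)) * (z i * cnj (z j)) ^ n)" for n
  proof -
    have "complex_of_real ((norm (\<Sum>i\<in>I. w i * u i * z i ^ n))\<^sup>2)
      = (\<Sum>i\<in>I. w i * u i * z i ^ n) * cnj (\<Sum>i\<in>I. w i * u i * z i ^ n)"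
      by (rule complex_norm_square)
    also have "\<dots> = (\<Sum>i\<in>I. \<Sum>j\<in>I. w i * w j * (u i * cnj (u j)) * (z i * cnj (z j)) ^ n)"
      by (simp add: sum_product power_mult_distrib mult_ac)
    finally show ?thesis by (metis Re_complex_of_real)
  qed
  moreover have "(\<lambda>n. \<Sum>i\<in>I. \<Sum>j\<in>I. w i * w j * (u i * cnj (u j)) * (z i * cnj (z j)) ^ n) sums
     (\<Sum>i\<in>I. \<Sum>j\<in>I. w i * w j * (u i * cnj (u j)) * (1 / (1 - z i * cnj (z j))))"
  proof (intro sums_sum sums_mult geometric_sums)
    fix i j assume "i \<in> I" "j \<in> I"
    thus "norm (z i * cnj (z j)) < 1"
      using z[of i] z[of j] mult_strict_mono[of "norm (z i)" 1 "norm (z j)" 1] by (simp add: norm_mult)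
  qed
  ultimately show ?thesis using sums_Re by presburger
qed

lemma carleson_finite:
  fixes w :: "'i \<Rightarrow> real" and z h :: "'i \<Rightarrow> complex"
  assumes fin: "finite I" and w: "\<And>i. i \<in> I \<Longrightarrow> w i \<ge> 0"
    and z: "\<And>i. i \<in> I \<Longrightarrow> norm (z i) < 1"
    and C: "\<And>a. norm a < 1 \<Longrightarrow> (\<Sum>i\<in>I. w i * kap a (z i)) \<le> C"
    and h: "\<And>i. i \<in> I \<Longrightarrow> (\<lambda>n. c n * z i ^ n) sums h i"
    and c: "summable (\<lambda>n. (norm (c n))\<^sup>2)"
  shows "(\<Sum>i\<in>I. w i * (norm (h i))\<^sup>2) \<le> 9 * C * (\<Sum>n. (norm (c n))\<^sup>2)"
proof -
  define V where "V = (\<Sum>i\<in>I. w i * (norm (h i))\<^sup>2)"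
  define S where "S = (\<Sum>n. (norm (c n))\<^sup>2)"
  define b where "b n = (\<Sum>i\<in>I. w i * cnj (h i) * z i ^ n)" for n
  define B where "B = Re (\<Sum>i\<in>I. \<Sum>j\<in>I. w i * w j * (cnj (h i) * h j) * (1 / (1 - z i * cnj (z j))))"
  define B' where "B' = Re (\<Sum>i\<in>I. \<Sum>j\<in>I. w i * w j * (h i * cnj (h j)) * (1 / (1 - z i * cnj (z j))))"
  have V0: "V \<ge> 0" unfolding V_def by (intro sum_nonneg mult_nonneg_nonneg w) auto
  have S0: "S \<ge> 0" unfolding S_def by (intro suminf_nonneg c) auto
  have C1: "(\<Sum>i\<in>I. w i) \<le> C" using C[of 0] by simp
  have C0: "C \<ge> 0" using C1 sum_nonneg[of I w] w by auto
  have bB: "(\<lambda>n. (norm (b n))\<^sup>2) sums B"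
    using geometric_gram_sums[OF fin z, where w=w and u="\<lambda>i. cnj (h i)"] unfolding b_def B_def complex_cnj_cnj .
  have "(\<lambda>n. (norm (\<Sum>i\<in>I. w i * h i * z i ^ n))\<^sup>2) sums B'"
    using geometric_gram_sums[OF fin z, where w=w and u=h] unfolding B'_def .
  hence B'0: "B' \<ge> 0" by (rule sums_le[OF _ sums_zero, rotated]) simp
  have B': "B' = Re (\<Sum>i\<in>I. \<Sum>j\<in>I. w i * w j * (cnj (h i) * h j) * cnj (1 / (1 - z i * cnj (z j))))"
    unfolding B'_def by (subst sum.swap) (simp add: mult_ac)
  have "B + B' = (\<Sum>i\<in>I. \<Sum>j\<in>I. Re (w i * w j * (cnj (h i) * h j) * (1 / (1 - z i * cnj (z j)) + cnj (1 / (1 - z i * cnj (z j))))))"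
    unfolding B_def B' by (simp only: Re_sum sum.distrib[symmetric] plus_complex.sel[symmetric] distrib_left[symmetric])
  also have "\<dots> \<le> (\<Sum>i\<in>I. \<Sum>j\<in>I. w i * w j * norm (h i) * norm (h j) * (1 + kap (z j) (z i) + kap (z i) (z j)))"
  proof (intro sum_mono)
    fix i j assume ij: "i \<in> I" "j \<in> I"
    define q where "q = 2 * Re (1 / (1 - z i * cnj (z j)))"
    have q: "1 / (1 - z i * cnj (z j)) + cnj (1 / (1 - z i * cnj (z j))) = of_real q"
      unfolding q_def by (rule complex_add_cnj)
    have "Re (w i * w j * (cnj (h i) * h j) * of_real q) \<le> norm (w i * w j * (cnj (h i) * h j) * of_real q)"
      by (rule complex_Re_le_cmod)
    also have "\<dots> = w i * w j * norm (h i) * norm (h j) * q"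
      using w[OF ij(1)] w[OF ij(2)] two_Re_szego_bounds(1)[OF z z, OF ij] by (simp add: norm_mult q_def mult_ac)
    also have "\<dots> \<le> w i * w j * norm (h i) * norm (h j) * (1 + kap (z j) (z i) + kap (z i) (z j))"
      unfolding q_def by (intro mult_left_mono two_Re_szego_bounds z ij mult_nonneg_nonneg w) auto
    finally show "Re (w i * w j * (cnj (h i) * h j) * (1 / (1 - z i * cnj (z j)) + cnj (1 / (1 - z i * cnj (z j)))))
      \<le> w i * w j * norm (h i) * norm (h j) * (1 + kap (z j) (z i) + kap (z i) (z j))" unfolding q .
  qed
  also have "\<dots> = (\<Sum>i\<in>I. w i * norm (h i))\<^sup>2
      + (\<Sum>i\<in>I. \<Sum>j\<in>I. w i * w j * norm (h i) * norm (h j) * kap (z j) (z i))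
      + (\<Sum>i\<in>I. \<Sum>j\<in>I. w i * w j * norm (h i) * norm (h j) * kap (z i) (z j))"
    by (simp add: power2_eq_square sum_product sum.distrib algebra_simps)
  also have "(\<Sum>i\<in>I. \<Sum>j\<in>I. w i * w j * norm (h i) * norm (h j) * kap (z i) (z j))
     = (\<Sum>i\<in>I. \<Sum>j\<in>I. w i * w j * norm (h i) * norm (h j) * kap (z j) (z i))"
    by (subst sum.swap) (simp add: mult_ac)
  also have "(\<Sum>i\<in>I. w i * norm (h i))\<^sup>2 \<le> C * V"
  proof -
    have "(\<Sum>i\<in>I. w i * (1 * norm (h i)))\<^sup>2 \<le> (\<Sum>i\<in>I. w i * 1\<^sup>2) * V"
      unfolding V_def by (rule weighted_cauchy_schwarz[OF w])
    also have "\<dots> \<le> C * V" using C1 V0 by (intro mult_right_mono) auto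
    finally show ?thesis by simp
  qed
  also have "(\<Sum>i\<in>I. \<Sum>j\<in>I. w i * w j * norm (h i) * norm (h j) * kap (z j) (z i)) \<le> 4 * C * V"
    unfolding V_def by (rule carleson_schur[OF fin w _ z C]) auto
  finally have B9: "B \<le> 9 * C * V" using B'0 by simp
  have "(\<lambda>n. c n * b n) sums (\<Sum>i\<in>I. w i * cnj (h i) * h i)"
  proof -
    have "(\<lambda>n. \<Sum>i\<in>I. w i * cnj (h i) * (c n * z i ^ n)) sums (\<Sum>i\<in>I. w i * cnj (h i) * h i)"
      by (intro sums_sum sums_mult h)
    thus ?thesis unfolding b_def by (simp add: sum_distrib_left mult_ac)
  qed
  also have "(\<Sum>i\<in>I. w i * cnj (h i) * h i) = of_real V"
    unfolding V_def of_real_sum of_real_mult complex_norm_square by (simp add: mult_ac)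
  finally have lim: "(\<lambda>N. (norm (\<Sum>n<N. c n * b n))\<^sup>2) \<longlonglongrightarrow> (norm (complex_of_real V))\<^sup>2"
    unfolding sums_def by (intro tendsto_intros)
  have le: "(norm (\<Sum>n<N. c n * b n))\<^sup>2 \<le> S * B" for N
  proof -
    have "norm (\<Sum>n<N. c n * b n) \<le> (\<Sum>n<N. norm (c n) * norm (b n))"
      by (rule sum_norm_le) (simp add: norm_mult)
    hence "(norm (\<Sum>n<N. c n * b n))\<^sup>2 \<le> (\<Sum>n<N. norm (c n) * norm (b n))\<^sup>2"
      by (intro power_mono) auto
    also have "\<dots> \<le> (\<Sum>n<N. (norm (c n))\<^sup>2) * (\<Sum>n<N. (norm (b n))\<^sup>2)"
      by (rule Cauchy_Schwarz_ineq_sum)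
    also have "\<dots> \<le> S * B"
      using bB sum_le_suminf[of "\<lambda>n. (norm (b n))\<^sup>2" "{..<N}"] S0
      by (intro mult_mono) (auto simp: S_def sums_iff intro!: sum_le_suminf c sum_nonneg)
    finally show ?thesis .
  qed
  have "V\<^sup>2 \<le> S * B"
    using LIMSEQ_le_const2[OF lim] le by auto
  also have "\<dots> \<le> S * (9 * C * V)" by (intro mult_left_mono B9 S0)
  finally have "V * V \<le> (9 * C * S) * V" by (simp add: power2_eq_square mult_ac)
  hence "V \<le> 9 * C * S" using V0 S0 C0 by (cases "V = 0") auto
  thus ?thesis unfolding V_def S_def .
qed

lemma riemann_sum_error:
  fixes g :: "real \<Rightarrow> real"
  assumes g: "continuous_on {\<alpha>..\<beta>} g" and h: "h \<ge> 0" "\<alpha> + real k * h \<le> \<beta>"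
    and osc: "\<And>s t. s \<in> {\<alpha>..\<beta>} \<Longrightarrow> t \<in> {\<alpha>..\<beta>} \<Longrightarrow> \<bar>s - t\<bar> \<le> h \<Longrightarrow> \<bar>g s - g t\<bar> \<le> e"
  shows "\<bar>(\<Sum>i<k. h * g (\<alpha> + real i * h)) - integral {\<alpha>..\<alpha> + real k * h} g\<bar> \<le> e * (real k * h)"
  using h(2)
proof (induction k)
  case 0
  thus ?case by simp
next
  case (Suc k)
  define x where "x = \<alpha> + real k * h"
  have x: "\<alpha> \<le> x" "x + h \<le> \<beta>" "\<alpha> + real (Suc k) * h = x + h"
    using h(1) Suc.prems by (auto simp: x_def algebra_simps)
  have int: "g integrable_on {u..v}" if "\<alpha> \<le> u" "v \<le> \<beta>" for u v
    by (rule integrable_continuous_real, rule continuous_on_subset[OF g]) (use that in auto)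
  have comb: "integral {\<alpha>..x + h} g = integral {\<alpha>..x} g + integral {x..x + h} g"
    using x h(1) by (intro Henstock_Kurzweil_Integration.integral_combine[symmetric] int) auto
  have "\<bar>integral {x..x + h} (\<lambda>t. g t - g x)\<bar> \<le> integral {x..x + h} (\<lambda>t. e)"
    unfolding real_norm_def[symmetric]
    by (intro integral_norm_bound_integral) (use x h(1) in \<open>auto intro!: integrable_diff int osc\<close>)
  also have "integral {x..x + h} (\<lambda>t. g t - g x) = integral {x..x + h} g - h * g x"
    using x h(1) by (subst integral_diff) (auto intro!: int)
  finally have "\<bar>h * g x - integral {x..x + h} g\<bar> \<le> e * h"
    using h(1) by (simp add: abs_minus_commute mult.commute)
  moreover have "\<bar>(\<Sum>i<k. h * g (\<alpha> + real i * h)) - integral {\<alpha>..x} g\<bar> \<le> e * (real k * h)"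
    using Suc.IH x h(1) unfolding x_def by auto
  ultimately have "\<bar>(\<Sum>i<k. h * g (\<alpha> + real i * h)) + h * g x - (integral {\<alpha>..x} g + integral {x..x + h} g)\<bar> \<le> e * (real k * h) + e * h"
    by linarith
  thus ?case unfolding x(3) comb by (simp add: algebra_simps x_def)
qed

lemma carleson_curve:
  fixes \<omega> :: "real \<Rightarrow> real" and \<sigma> :: "real \<Rightarrow> complex"
  assumes ab: "\<alpha> \<le> \<beta>" and w: "continuous_on {\<alpha>..\<beta>} \<omega>" "\<And>t. t \<in> {\<alpha>..\<beta>} \<Longrightarrow> \<omega> t \<ge> 0"
    and s: "continuous_on {\<alpha>..\<beta>} \<sigma>" "\<And>t. t \<in> {\<alpha>..\<beta>} \<Longrightarrow> norm (\<sigma> t) < 1"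
    and C: "\<And>a. norm a < 1 \<Longrightarrow> integral {\<alpha>..\<beta>} (\<lambda>t. \<omega> t * kap a (\<sigma> t)) \<le> C"
    and f: "f holomorphic_on ball 0 1" and c: "summable (\<lambda>n. (norm (taylor_coeff f n))\<^sup>2)"
  shows "integral {\<alpha>..\<beta>} (\<lambda>t. \<omega> t * (norm (f (\<sigma> t)))\<^sup>2) \<le> 9 * C * (\<Sum>n. (norm (taylor_coeff f n))\<^sup>2)"
proof -
  define S where "S = (\<Sum>n. (norm (taylor_coeff f n))\<^sup>2)"
  have S0: "S \<ge> 0" unfolding S_def by (intro suminf_nonneg c) auto
  have contf: "continuous_on {\<alpha>..\<beta>} (\<lambda>t. \<omega> t * (norm (f (\<sigma> t)))\<^sup>2)"
    by (intro continuous_intros w continuous_on_compose2[OF holomorphic_on_imp_continuous_on[OF f]] s) (use s in auto)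
  define G where "G = (\<lambda>(a, t). \<omega> t * kap a (\<sigma> t))"
  have contG: "continuous_on (cball 0 1 \<times> {\<alpha>..\<beta>}) G"
    unfolding G_def kap_def case_prod_unfold
    by (intro continuous_intros continuous_on_compose2[OF w(1)] continuous_on_compose2[OF s(1)])
       (use s one_minus_cnj_mult_nonzero in auto)
  have ucf: "uniformly_continuous_on {\<alpha>..\<beta>} (\<lambda>t. \<omega> t * (norm (f (\<sigma> t)))\<^sup>2)"
    by (intro compact_uniformly_continuous contf) auto
  have ucG: "uniformly_continuous_on (cball 0 1 \<times> {\<alpha>..\<beta>}) G"
    by (intro compact_uniformly_continuous contG compact_Times) auto
  have main: "integral {\<alpha>..\<beta>} (\<lambda>t. \<omega> t * (norm (f (\<sigma> t)))\<^sup>2) \<le> 9 * C * S + e * ((\<beta> - \<alpha>) * (1 + 9 * S))" if e: "e > 0" for e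
  proof -
    obtain d1 where d1: "d1 > 0" "\<And>s t. s \<in> {\<alpha>..\<beta>} \<Longrightarrow> t \<in> {\<alpha>..\<beta>} \<Longrightarrow> dist s t < d1 \<Longrightarrow>
        dist (\<omega> s * (norm (f (\<sigma> s)))\<^sup>2) (\<omega> t * (norm (f (\<sigma> t)))\<^sup>2) < e"
      using uniformly_continuous_onE[OF ucf e] by metis
    obtain d2 where d2: "d2 > 0" "\<And>x y. x \<in> cball 0 1 \<times> {\<alpha>..\<beta>} \<Longrightarrow> y \<in> cball 0 1 \<times> {\<alpha>..\<beta>} \<Longrightarrow> dist x y < d2 \<Longrightarrow> dist (G x) (G y) < e"
      using uniformly_continuous_onE[OF ucG e] by metis
    define d where "d = min d1 d2"
    have d: "d > 0" using d1 d2 by (auto simp: d_def)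
    obtain N :: nat where N: "(\<beta> - \<alpha>) / d < N" using reals_Archimedean2 by blast
    hence N0: "real N > 0" using ab d by (smt (verit) divide_nonneg_pos)
    define h where "h = (\<beta> - \<alpha>) / N"
    have h: "h \<ge> 0" "h < d" "\<alpha> + real N * h = \<beta>" using N N0 d ab by (auto simp: h_def field_simps)
    define t where "t i = \<alpha> + real i * h" for i
    have t: "t i \<in> {\<alpha>..\<beta>}" if "i < N" for i
    proof -
      have "real i * h \<le> real N * h" using that h by (intro mult_right_mono) auto
      thus ?thesis using h by (auto simp: t_def)
    qed
    have Nh: "real N * h = \<beta> - \<alpha>" using h(3) by simp
    have A: "\<bar>(\<Sum>i<N. h * (\<omega> (t i) * (norm (f (\<sigma> (t i))))\<^sup>2)) - integral {\<alpha>..\<beta>} (\<lambda>t. \<omega> t * (norm (f (\<sigma> t)))\<^sup>2)\<bar> \<le> e * (\<beta> - \<alpha>)"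
    proof -
      have "\<bar>\<omega> s * (norm (f (\<sigma> s)))\<^sup>2 - \<omega> t * (norm (f (\<sigma> t)))\<^sup>2\<bar> \<le> e"
        if "s \<in> {\<alpha>..\<beta>}" "t \<in> {\<alpha>..\<beta>}" "\<bar>s - t\<bar> \<le> h" for s t
      proof -
        have "dist s t < d1" using that h by (simp add: dist_real_def d_def)
        from d1(2)[OF that(1,2) this] show ?thesis by (simp add: dist_real_def)
      qed
      from riemann_sum_error[OF contf h(1) _ this, of N] show ?thesis
        using h(3) by (simp add: t_def Nh)
    qed
    have B: "(\<Sum>i<N. h * \<omega> (t i) * kap a (\<sigma> (t i))) \<le> C + e * (\<beta> - \<alpha>)" if a: "norm a < 1" for a
    proof -
      have "continuous_on {\<alpha>..\<beta>} (\<lambda>t. G (a, t))"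
        by (intro continuous_on_compose2[OF contG] continuous_intros) (use a in auto)
      moreover have "\<bar>G (a, s) - G (a, t)\<bar> \<le> e" if "s \<in> {\<alpha>..\<beta>}" "t \<in> {\<alpha>..\<beta>}" "\<bar>s - t\<bar> \<le> h" for s t
      proof -
        have "dist (a, s) (a, t) < d2" using that h by (simp add: dist_Pair_Pair dist_real_def d_def)
        from d2(2)[OF _ _ this] show ?thesis using that a by (simp add: dist_real_def)
      qed
      ultimately have "\<bar>(\<Sum>i<N. h * G (a, t i)) - integral {\<alpha>..\<beta>} (\<lambda>t. G (a, t))\<bar> \<le> e * (\<beta> - \<alpha>)"
        using riemann_sum_error[of \<alpha> \<beta> "\<lambda>t. G (a, t)" h N e] h(1,3) by (simp add: t_def Nh)
      thus ?thesis using C[OF a] by (simp add: G_def mult_ac)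
    qed
    have "(\<Sum>i\<in>{..<N}. h * \<omega> (t i) * (norm (f (\<sigma> (t i))))\<^sup>2) \<le> 9 * (C + e * (\<beta> - \<alpha>)) * S"
      unfolding S_def
      by (rule carleson_finite[where z = "\<lambda>i. \<sigma> (t i)"]) (use h w s t B in \<open>auto intro!: taylor_coeff_sums f c\<close>)
    thus ?thesis using A by (simp add: algebra_simps)
  qed
  have "integral {\<alpha>..\<beta>} (\<lambda>t. \<omega> t * (norm (f (\<sigma> t)))\<^sup>2) \<le> 9 * C * S"
  proof (rule field_le_epsilon)
    fix e :: real assume e: "e > 0"
    define K where "K = (\<beta> - \<alpha>) * (1 + 9 * S)"
    have K: "K \<ge> 0" using ab S0 by (simp add: K_def)
    have "integral {\<alpha>..\<beta>} (\<lambda>t. \<omega> t * (norm (f (\<sigma> t)))\<^sup>2) \<le> 9 * C * S + e / (K + 1) * K"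
      using main[of "e / (K + 1)"] e K unfolding K_def by simp
    also have "e / (K + 1) * K \<le> e" using e K by (simp add: field_simps)
    finally show "integral {\<alpha>..\<beta>} (\<lambda>t. \<omega> t * (norm (f (\<sigma> t)))\<^sup>2) \<le> 9 * C * S + e" by simp
  qed
  thus ?thesis by (simp add: S_def)
qed

subsection \<open>Square majorants and monotonicity of means\<close>

lemma finite_zeros_cball:
  assumes F: "F holomorphic_on ball 0 1" and w: "w \<in> ball 0 1" "F w \<noteq> 0" and s: "s < 1"
  shows "finite {z \<in> cball 0 s. F z = (0::complex)}"
proof (cases "F constant_on ball 0 1")
  case True
  then obtain c where c: "\<And>x. x \<in> ball 0 1 \<Longrightarrow> F x = c" by (auto simp: constant_on_def)
  have eq: "{z \<in> cball 0 s. F z = 0} = {}" using c w s by fastforce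
  show ?thesis unfolding eq by (rule finite.emptyI)
next
  case False
  thus ?thesis
    by (intro holomorphic_compact_finite_zeros[OF F]) (use s in auto)
qed

lemma divide_out_zero:
  assumes F: "F holomorphic_on ball 0 R'" and a: "a \<in> ball 0 R'" "F a = 0"
    and w: "w \<in> ball 0 R'" "F w \<noteq> (0::complex)"
  obtains g m where "g holomorphic_on ball 0 R'" "g a \<noteq> 0"
    "\<And>z. z \<in> ball 0 R' \<Longrightarrow> F z = (z - a) ^ m * g z"
proof -
  have nc: "\<not> F constant_on ball 0 R'" using a w unfolding constant_on_def by metis
  obtain g0 r n where g0: "0 < n" "0 < r" "ball a r \<subseteq> ball 0 R'" "g0 holomorphic_on ball a r"
      "\<And>x. x \<in> ball a r \<Longrightarrow> F x = (x - a) ^ n * g0 x" "\<And>x. x \<in> ball a r \<Longrightarrow> g0 x \<noteq> 0"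
    using holomorphic_factor_zero_nonconstant[OF F open_ball connected_ball a nc] by metis
  define g where "g z = (if z = a then g0 a else F z / (z - a) ^ n)" for z
  have "g holomorphic_on ball a r"
    by (rule holomorphic_transform[OF g0(4)]) (auto simp: g_def g0(5))
  moreover have "g holomorphic_on ball 0 R' - {a}"
  proof (rule holomorphic_transform)
    show "(\<lambda>z. F z / (z - a) ^ n) holomorphic_on ball 0 R' - {a}"
      by (intro holomorphic_intros holomorphic_on_subset[OF F]) auto
  qed (auto simp: g_def)
  ultimately have "g holomorphic_on ball a r \<union> (ball 0 R' - {a})"
    by (intro holomorphic_on_Un) auto
  hence "g holomorphic_on ball 0 R'"
    by (rule holomorphic_on_subset) (use g0(2) in auto)
  moreover have "a \<in> ball a r" using g0(2) by simp
  hence ga: "g a \<noteq> 0" using g0(6) by (auto simp: g_def)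
  moreover have "F z = (z - a) ^ n * g z" if "z \<in> ball 0 R'" for z
    using a g0(1) by (auto simp: g_def)
  ultimately show ?thesis using ga by (intro that[of g n])
qed

lemma blaschke_factor_norm:
  assumes "R > 0"
  shows "norm a < R \<Longrightarrow> norm z \<le> R \<Longrightarrow> norm (z - a) \<le> norm ((of_real (R\<^sup>2) - cnj a * z) / of_real R)"
    and "norm z = R \<Longrightarrow> norm ((of_real (R\<^sup>2) - cnj a * z) / of_real R) = norm (z - a)"
proof -
  have eq: "(norm (of_real (R\<^sup>2) - cnj a * z))\<^sup>2 - R\<^sup>2 * (norm (z - a))\<^sup>2 = (R\<^sup>2 - (norm a)\<^sup>2) * (R\<^sup>2 - (norm z)\<^sup>2)"
    by (simp add: cmod_power2) (simp add: power2_eq_square algebra_simps)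
  have n: "norm ((of_real (R\<^sup>2) - cnj a * z) / of_real R) = norm (of_real (R\<^sup>2) - cnj a * z) / R"
    using assms by (simp add: norm_divide del: of_real_power)
  {
    assume "norm a < R" "norm z \<le> R"
    hence "0 \<le> (R\<^sup>2 - (norm a)\<^sup>2) * (R\<^sup>2 - (norm z)\<^sup>2)"
      using assms by (intro mult_nonneg_nonneg) (auto simp: power_mono)
    hence "(R * norm (z - a))\<^sup>2 \<le> (norm (of_real (R\<^sup>2) - cnj a * z))\<^sup>2"
      using eq by (simp add: power_mult_distrib)
    hence "R * norm (z - a) \<le> norm (of_real (R\<^sup>2) - cnj a * z)"
      by (rule power2_le_imp_le) simp
    thus "norm (z - a) \<le> norm ((of_real (R\<^sup>2) - cnj a * z) / of_real R)"
      unfolding n using assms by (simp add: field_simps)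
  }
  {
    assume "norm z = R"
    hence "(R * norm (z - a))\<^sup>2 = (norm (of_real (R\<^sup>2) - cnj a * z))\<^sup>2"
      using eq by (simp add: power_mult_distrib)
    hence "R * norm (z - a) = norm (of_real (R\<^sup>2) - cnj a * z)"
      using assms by (subst (asm) power2_eq_iff_nonneg) auto
    thus "norm ((of_real (R\<^sup>2) - cnj a * z) / of_real R) = norm (z - a)"
      unfolding n using assms by (simp add: field_simps)
  }
qed

lemma remove_zeros:
  assumes "finite Z" "F holomorphic_on ball 0 R'" "0 < R" "R < R'"
    "Z = {z \<in> cball 0 R. F z = (0::complex)}" "Z \<subseteq> ball 0 R"
  shows "\<exists>G. G holomorphic_on ball 0 R' \<and> (\<forall>z\<in>cball 0 R. G z \<noteq> 0 \<and> norm (F z) \<le> norm (G z))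
     \<and> (\<forall>z\<in>sphere 0 R. norm (F z) = norm (G z))"
  using assms
proof (induction Z arbitrary: F rule: finite_induct)
  case empty
  thus ?case by (intro exI[of _ F]) auto
next
  case (insert a Z F)
  have a: "norm a < R" "F a = 0" using insert.prems by auto
  have "of_real R \<notin> insert a Z" using insert.prems(5) by auto
  hence "F (of_real R) \<noteq> 0" using insert.prems(2,4) by auto
  then obtain w where w: "w \<in> ball 0 R'" "F w \<noteq> 0"
    using insert.prems by (metis abs_of_pos dist_0_norm mem_ball norm_of_real)
  obtain g m where g: "g holomorphic_on ball 0 R'" "g a \<noteq> 0"
    "\<And>z. z \<in> ball 0 R' \<Longrightarrow> F z = (z - a) ^ m * g z"
    by (rule divide_out_zero[OF insert.prems(1) _ a(2) w]) (use a insert.prems in auto)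
  have m0: "m > 0" using g(2) g(3)[of a] a insert.prems by (cases m) auto
  define b where "b z = (of_real (R\<^sup>2) - cnj a * z) / of_real R" for z
  define F1 where "F1 z = g z * b z ^ m" for z
  have F1: "F1 holomorphic_on ball 0 R'"
    unfolding F1_def b_def using insert.prems by (intro holomorphic_intros g) auto
  have b0: "b z \<noteq> 0" if "z \<in> cball 0 R" for z
  proof -
    have "norm (cnj a * z) \<le> norm a * R" using that by (auto simp: norm_mult intro!: mult_left_mono)
    also have "\<dots> < R * R" using a insert.prems by (intro mult_strict_right_mono) auto
    also have "\<dots> = norm (complex_of_real (R\<^sup>2))" by (simp add: power2_eq_square norm_mult)
    finally have "cnj a * z \<noteq> of_real (R\<^sup>2)" by (metis less_irrefl)
    thus ?thesis using insert.prems by (auto simp: b_def)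
  qed
  have inR: "z \<in> ball 0 R'" if "z \<in> cball 0 R" for z using that insert.prems by auto
  have Z: "Z = {z \<in> cball 0 R. F1 z = 0}"
  proof -
    have "F1 z = 0 \<longleftrightarrow> F z = 0 \<and> z \<noteq> a" if "z \<in> cball 0 R" for z
      using b0[OF that] g(2) m0 by (auto simp: F1_def g(3)[OF inR[OF that]])
    hence "{z \<in> cball 0 R. F1 z = 0} = insert a Z - {a}" unfolding insert.prems(4) by auto
    thus ?thesis using insert.hyps by auto
  qed
  have le: "norm (F z) \<le> norm (F1 z)" if "z \<in> cball 0 R" for z
    unfolding g(3)[OF inR[OF that]] F1_def b_def
    using blaschke_factor_norm(1)[of R a z] that insert.prems a
    by (subst mult.commute) (auto simp only: norm_mult norm_power mem_cball dist_0_norm intro!: mult_left_mono power_mono norm_ge_zero)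
  have eq: "norm (F z) = norm (F1 z)" if "z \<in> sphere 0 R" for z
  proof -
    have "z \<in> cball 0 R" using that by auto
    thus ?thesis
      unfolding g(3)[OF inR[OF \<open>z \<in> cball 0 R\<close>]] F1_def b_def
      using blaschke_factor_norm(2)[of R z a] that insert.prems
      by (simp add: norm_mult norm_power)
  qed
  obtain G where G: "G holomorphic_on ball 0 R'" "\<forall>z\<in>cball 0 R. G z \<noteq> 0 \<and> norm (F1 z) \<le> norm (G z)"
     "\<forall>z\<in>sphere 0 R. norm (F1 z) = norm (G z)"
    using insert.IH[OF F1 insert.prems(2,3) Z] insert.prems(5) by auto
  show ?case
  proof (intro exI[of _ G] conjI ballI)
    show "norm (F z) \<le> norm (G z)" if "z \<in> cball 0 R" for z
      using le[OF that] G(2) that by force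
    show "norm (F z) = norm (G z)" if "z \<in> sphere 0 R" for z
      using eq[OF that] G(3) that by force
  qed (use G in auto)
qed

text \<open>On the disc of radius $R$ write $F = B G$ with a finite Blaschke product $B$ and $G$ without zeros,
  and take $h = G^{p/2}$.\<close>

lemma square_majorant_disc:
  assumes F: "F holomorphic_on ball 0 1" and R: "0 < R" "R < 1" and p: "p > 0"
    and ns: "\<And>z. norm z = R \<Longrightarrow> F z \<noteq> 0"
  obtains h S where "R < S" "h holomorphic_on ball 0 S"
    "\<And>z. norm z \<le> R \<Longrightarrow> norm (F z) powr p \<le> (norm (h z))\<^sup>2"
    "\<And>z. norm z = R \<Longrightarrow> norm (F z) powr p = (norm (h z))\<^sup>2"
proof -
  have fin: "finite {z \<in> cball 0 R. F z = 0}"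
    by (rule finite_zeros_cball[OF F _ _ R(2), of "of_real R"]) (use R ns in auto)
  obtain G where G: "G holomorphic_on ball 0 1" "\<forall>z\<in>cball 0 R. G z \<noteq> 0 \<and> norm (F z) \<le> norm (G z)"
     "\<forall>z\<in>sphere 0 R. norm (F z) = norm (G z)"
    using remove_zeros[OF fin F R refl] ns by force
  have "open {z \<in> ball 0 1. G z \<in> - {0}}"
  proof -
    have "open (ball 0 1 \<inter> G -` (- {0}))"
      by (intro continuous_open_preimage holomorphic_on_imp_continuous_on G) auto
    moreover have "ball 0 1 \<inter> G -` (- {0}) = {z \<in> ball 0 1. G z \<in> - {0}}" by blast
    ultimately show ?thesis by metis
  qed
  moreover have "cball 0 R \<subseteq> {z \<in> ball 0 1. G z \<in> - {0}}" using G(2) R by auto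
  ultimately obtain e where e: "e > 0" "(\<Union>x\<in>cball 0 R. ball x e) \<subseteq> {z \<in> ball 0 1. G z \<in> - {0}}"
    using compact_subset_open_imp_ball_epsilon_subset[OF compact_cball] by metis
  define S where "S = R + e"
  have S: "z \<in> ball 0 1 \<and> G z \<noteq> 0" if "z \<in> ball 0 S" for z
  proof -
    define x where "x = (if norm z \<le> R then z else of_real (R / norm z) * z)"
    have "x \<in> cball 0 R" using R by (auto simp: x_def norm_mult norm_divide)
    moreover have "z \<in> ball x e"
    proof (cases "norm z \<le> R")
      case False
      have z0: "norm z > 0" using False R by linarith
      have "x - z = of_real (R / norm z - 1) * z" using False by (simp add: x_def algebra_simps)
      hence "norm (x - z) = \<bar>R / norm z - 1\<bar> * norm z" by (metis norm_mult norm_of_real)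
      also have "\<dots> = norm z - R" using False R z0 by (simp add: abs_if field_simps)
      finally show ?thesis using that by (simp add: dist_norm S_def)
    qed (use e in \<open>auto simp: x_def\<close>)
    ultimately show ?thesis using e(2) by fastforce
  qed
  have "G holomorphic_on ball 0 S" by (rule holomorphic_on_subset[OF G(1)]) (use S in auto)
  then obtain g where g: "g holomorphic_on ball 0 S" "\<And>x. x \<in> ball 0 S \<Longrightarrow> exp (g x) = G x"
    using holomorphic_logarithm_exists[of "ball 0 S" G 0] S R e by (auto simp: S_def)
  define h where "h z = exp (of_real (p / 2) * g z)" for z
  have h: "(norm (h z))\<^sup>2 = norm (G z) powr p" if "z \<in> ball 0 S" for z
  proof -
    have "norm (G z) = exp (Re (g z))" using g(2)[OF that, symmetric] by simp
    moreover have "norm (h z) = exp (p / 2 * Re (g z))" by (simp add: h_def)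
    ultimately show ?thesis by (simp add: powr_def exp_double[symmetric] flip: exp_of_nat_mult) 
  qed
  have inS: "z \<in> ball 0 S" if "norm z \<le> R" for z using that e by (auto simp: S_def)
  show ?thesis
  proof (rule that)
    show "R < S" using e by (simp add: S_def)
    show "h holomorphic_on ball 0 S" unfolding h_def by (intro holomorphic_intros g)
    show "norm (F z) powr p \<le> (norm (h z))\<^sup>2" if "norm z \<le> R" for z
      unfolding h[OF inS[OF that]] using G(2) that p by (intro powr_mono2) auto
    show "norm (F z) powr p = (norm (h z))\<^sup>2" if "norm z = R" for z
      using h[OF inS, of z] G(3) that by auto
  qed
qed

lemma cmean_scale: "cmean (\<lambda>z. f (of_real s * z)) r = cmean f (s * r)"
  by (simp add: cmean_def mult.assoc)

lemma continuous_on_sphere_norm_powr: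
  fixes F :: "complex \<Rightarrow> complex"
  assumes "continuous_on S F" "p > 0"
  shows "continuous_on S (\<lambda>z. norm (F z) powr p)"
  using assms by (intro continuous_on_powr' continuous_intros) auto

lemma h2_mean_mono_disc:
  assumes h: "h holomorphic_on ball 0 S" and r: "0 \<le> r" "r \<le> R" "R < S"
  shows "cmean (\<lambda>z. (norm (h z))\<^sup>2) r \<le> cmean (\<lambda>z. (norm (h z))\<^sup>2) R"
proof -
  have S: "S > 0" using r by simp
  define g where "g z = h (of_real S * z)" for z
  have g: "g holomorphic_on ball 0 1"
    unfolding g_def using S
    by (intro holomorphic_on_compose_gen[OF _ h, unfolded o_def] holomorphic_intros) (auto simp: norm_mult)
  have eq: "cmean (\<lambda>z. (norm (h z))\<^sup>2) t = cmean (\<lambda>z. (norm (g z))\<^sup>2) (t / S)" for t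
    unfolding g_def using cmean_scale[of "\<lambda>z. (norm (h z))\<^sup>2" S "t / S"] S by simp
  have "(norm (taylor_coeff g n))\<^sup>2 * (r / S) ^ (2 * n) \<le> (norm (taylor_coeff g n))\<^sup>2 * (R / S) ^ (2 * n)" for n
    using r S by (intro mult_left_mono power_mono divide_right_mono) auto
  thus ?thesis unfolding eq
    by (rule sums_le[OF _ parseval[OF g, of "r / S"] parseval[OF g, of "R / S"]]) (use r S in \<open>simp_all add: field_simps\<close>)
qed

lemma continuous_on_cmean:
  fixes f :: "complex \<Rightarrow> 'a::banach"
  assumes f: "continuous_on (ball 0 1) f"
  shows "continuous_on {0..<1} (\<lambda>r. cmean f r)"
proof -
  have "continuous_on ({0..<1} \<times> {0..2*pi}) (\<lambda>(r, t). f (complex_of_real r * cis t))"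
    unfolding case_prod_unfold
    by (rule continuous_on_compose2[OF f]) (auto intro!: continuous_intros simp: norm_mult)
  hence "continuous_on {0..<1} (\<lambda>r. integral (cbox 0 (2*pi)) (\<lambda>t. f (complex_of_real r * cis t)))"
    by (intro integral_continuous_on_param) (simp add: cbox_interval)
  thus ?thesis unfolding cmean_def by (intro continuous_intros) (simp add: cbox_interval)
qed

lemma good_radius:
  assumes F: "F holomorphic_on ball 0 1" and w: "w \<in> ball 0 1" "F w \<noteq> (0::complex)"
    and r: "0 \<le> r" "r < 1"
  shows "eventually (\<lambda>R. 0 < R \<and> R < 1 \<and> (\<forall>z. norm z = R \<longrightarrow> F z \<noteq> 0)) (at_right r)"
proof -
  define s where "s = (1 + r) / 2"
  have s: "r < s" "s < 1" using r by (auto simp: s_def)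
  have "finite (norm ` {z \<in> cball 0 s. F z = 0})"
    by (intro finite_imageI finite_zeros_cball[OF F w s(2)])
  from finite_set_avoid[OF this, of r] obtain d where d: "d > 0"
    "\<And>x. x \<in> norm ` {z \<in> cball 0 s. F z = 0} \<Longrightarrow> x \<noteq> r \<Longrightarrow> d \<le> dist r x" by blast
  show ?thesis
  proof (rule eventually_at_rightI)
    show "r < min s (r + d)" using s d by simp
    fix R assume R: "R \<in> {r<..<min s (r + d)}"
    have "F z \<noteq> 0" if "norm z = R" for z
    proof
      assume "F z = 0"
      with that R have "R \<in> norm ` {z \<in> cball 0 s. F z = 0}" by (auto intro!: imageI)
      from d(2)[OF this] R show False by (auto simp: dist_real_def)
    qed
    thus "0 < R \<and> R < 1 \<and> (\<forall>z. norm z = R \<longrightarrow> F z \<noteq> 0)" using R r s by auto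
  qed
qed

lemma hp_mean_le_good:
  assumes F: "F holomorphic_on ball 0 1" and p: "p > 0" and r: "0 \<le> r" "r \<le> R" "0 < R" "R < 1"
    and ns: "\<And>z. norm z = R \<Longrightarrow> F z \<noteq> 0"
  shows "cmean (\<lambda>z. norm (F z) powr p) r \<le> cmean (\<lambda>z. norm (F z) powr p) R"
proof -
  obtain h S where h: "R < S" "h holomorphic_on ball 0 S"
    "\<And>z. norm z \<le> R \<Longrightarrow> norm (F z) powr p \<le> (norm (h z))\<^sup>2"
    "\<And>z. norm z = R \<Longrightarrow> norm (F z) powr p = (norm (h z))\<^sup>2"
    using square_majorant_disc[OF F r(3,4) p ns] by metis
  have "cmean (\<lambda>z. norm (F z) powr p) r \<le> cmean (\<lambda>z. (norm (h z))\<^sup>2) r"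
    by (intro cmean_mono continuous_on_sphere_norm_powr continuous_intros
          holomorphic_on_imp_continuous_on holomorphic_on_subset[OF F] holomorphic_on_subset[OF h(2)])
       (use r p h in auto)
  also have "\<dots> \<le> cmean (\<lambda>z. (norm (h z))\<^sup>2) R"
    by (rule h2_mean_mono_disc[OF h(2)]) (use r h in auto)
  also have "\<dots> = cmean (\<lambda>z. norm (F z) powr p) R"
    by (rule cmean_cong) (use h r in auto)
  finally show ?thesis .
qed

lemma hp_mean_mono:
  assumes F: "F holomorphic_on ball 0 1" and p: "p > 0" and r: "0 \<le> r" "r \<le> \<rho>" "\<rho> < 1"
  shows "cmean (\<lambda>z. norm (F z) powr p) r \<le> cmean (\<lambda>z. norm (F z) powr p) \<rho>"
proof (cases "\<exists>w\<in>ball 0 1. F w \<noteq> 0")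
  case False
  have "cmean (\<lambda>z. norm (F z) powr p) t = 0" if "0 \<le> t" "t < 1" for t
  proof -
    have "cmean (\<lambda>z. norm (F z) powr p) t = cmean (\<lambda>z. 0) t"
      by (rule cmean_cong) (use False that in auto)
    thus ?thesis by simp
  qed
  thus ?thesis using r by simp
next
  case True
  then obtain w where w: "w \<in> ball 0 1" "F w \<noteq> 0" by blast
  have "eventually (\<lambda>R. R > \<rho>) (at_right \<rho>)" by (rule eventually_at_right_less)
  moreover have "eventually (\<lambda>R. 0 < R \<and> R < 1 \<and> (\<forall>z. norm z = R \<longrightarrow> F z \<noteq> 0)) (at_right \<rho>)"
    by (rule good_radius[OF F w]) (use r in auto)
  ultimately have ev: "eventually (\<lambda>R. cmean (\<lambda>z. norm (F z) powr p) r \<le> cmean (\<lambda>z. norm (F z) powr p) R) (at_right \<rho>)"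
    by eventually_elim (intro hp_mean_le_good[OF F p], use r in auto)
  have "continuous_on {0..<1} (\<lambda>R. cmean (\<lambda>z. norm (F z) powr p) R)"
    by (intro continuous_on_cmean continuous_on_sphere_norm_powr holomorphic_on_imp_continuous_on F p)
  hence "((\<lambda>R. cmean (\<lambda>z. norm (F z) powr p) R) \<longlongrightarrow> cmean (\<lambda>z. norm (F z) powr p) \<rho>) (at \<rho> within {0..<1})"
    using r unfolding continuous_on_def by auto
  hence "((\<lambda>R. cmean (\<lambda>z. norm (F z) powr p) R) \<longlongrightarrow> cmean (\<lambda>z. norm (F z) powr p) \<rho>) (at \<rho> within {\<rho>..(1 + \<rho>) / 2})"
    by (rule tendsto_within_subset) (use r in auto)
  hence "((\<lambda>R. cmean (\<lambda>z. norm (F z) powr p) R) \<longlongrightarrow> cmean (\<lambda>z. norm (F z) powr p) \<rho>) (at_right \<rho>)"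
    using r by (subst (asm) at_within_Icc_at_right) auto
  from tendsto_lowerbound[OF this ev] show ?thesis by simp
qed

lemma h2_pointwise:
  assumes f: "f holomorphic_on ball 0 1" 
    and B: "\<And>r. 0 \<le> r \<Longrightarrow> r < 1 \<Longrightarrow> cmean (\<lambda>z. (norm (f z))\<^sup>2) r \<le> B"
    and z: "norm z < 1"
  shows "norm (f z) \<le> sqrt B / (1 - norm z)"
proof -
  note c = h2_coeffs[OF f B]
  have cn: "norm (taylor_coeff f n) \<le> sqrt B" for n
  proof -
    have "(norm (taylor_coeff f n))\<^sup>2 \<le> (\<Sum>n. (norm (taylor_coeff f n))\<^sup>2)"
      using sum_le_suminf[OF c(1), of "{n}"] by simp
    thus ?thesis using c(2) by (intro real_le_rsqrt) simp
  qed
  have s: "summable (\<lambda>n. sqrt B * norm z ^ n)" by (intro summable_mult summable_geometric) (use z in auto)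
  have "norm (f z) = norm (\<Sum>n. taylor_coeff f n * z ^ n)" using taylor_coeff_sums[OF f z] by (simp add: sums_iff)
  also have "\<dots> \<le> (\<Sum>n. sqrt B * norm z ^ n)"
    by (intro norm_suminf_le s) (auto simp: norm_mult norm_power intro!: mult_right_mono cn)
  also have "\<dots> = sqrt B / (1 - norm z)"
    using suminf_mult[of "\<lambda>n. norm z ^ n" "sqrt B"] suminf_geometric[of "norm z"] z summable_geometric[of "norm z"] by simp
  finally show ?thesis .
qed

lemma square_majorant:
  assumes F: "F holomorphic_on ball 0 1" and p: "p > 0"
    and B: "\<And>r. 0 \<le> r \<Longrightarrow> r < 1 \<Longrightarrow> cmean (\<lambda>z. norm (F z) powr p) r \<le> B"
  obtains h where "h holomorphic_on ball 0 1"
    "\<And>z. norm z < 1 \<Longrightarrow> norm (F z) powr p \<le> (norm (h z))\<^sup>2"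
    "\<And>r. 0 \<le> r \<Longrightarrow> r < 1 \<Longrightarrow> cmean (\<lambda>z. (norm (h z))\<^sup>2) r \<le> B"
proof (cases "\<exists>w\<in>ball 0 1. F w \<noteq> 0")
  case False
  have "0 \<le> B"
    by (rule order_trans[OF _ B[of 0]], rule cmean_nonneg)
       (auto intro!: continuous_on_sphere_norm_powr holomorphic_on_imp_continuous_on holomorphic_on_subset[OF F] p)
  show ?thesis by (rule that[of "\<lambda>z. 0"]) (use False \<open>0 \<le> B\<close> in auto)
next
  case True
  then obtain w where w: "w \<in> ball 0 1" "F w \<noteq> 0" by blast
  have "\<exists>g R. g holomorphic_on ball 0 1 \<and> 1 - 1 / real (k + 2) < R \<and> R < 1 \<and>
      (\<forall>z\<in>ball 0 1. norm (F (of_real R * z)) powr p \<le> (norm (g z))\<^sup>2) \<and>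
      (\<forall>r. 0 \<le> r \<longrightarrow> r < 1 \<longrightarrow> cmean (\<lambda>z. (norm (g z))\<^sup>2) r \<le> B)" for k :: nat
  proof -
    define \<rho> where "\<rho> = 1 - 1 / real (k + 2)"
    have \<rho>: "0 \<le> \<rho>" "\<rho> < 1" by (auto simp: \<rho>_def)
    have "eventually (\<lambda>R. (0 < R \<and> R < 1 \<and> (\<forall>z. norm z = R \<longrightarrow> F z \<noteq> 0)) \<and> \<rho> < R) (at_right \<rho>)"
      by (intro eventually_conj good_radius[OF F w \<rho>] eventually_at_right_less)
    then obtain R where R: "0 < R" "R < 1" "\<And>z. norm z = R \<Longrightarrow> F z \<noteq> 0" "\<rho> < R"
      using eventually_happens[of _ "at_right \<rho>"] by (auto simp: trivial_limit_at_right_real)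
    obtain h S where h: "R < S" "h holomorphic_on ball 0 S"
      "\<And>z. norm z \<le> R \<Longrightarrow> norm (F z) powr p \<le> (norm (h z))\<^sup>2"
      "\<And>z. norm z = R \<Longrightarrow> norm (F z) powr p = (norm (h z))\<^sup>2"
      using square_majorant_disc[OF F R(1,2) p R(3)] by metis
    define g where "g z = h (of_real R * z)" for z
    have Rz: "norm (of_real R * z) < R" if "norm z < 1" for z :: complex
      using that R mult_strict_left_mono[of "norm z" 1 R] by (simp add: norm_mult)
    show ?thesis
    proof (intro exI[of _ g] exI[of _ R] conjI ballI allI impI)
      show "g holomorphic_on ball 0 1" unfolding g_def
        by (intro holomorphic_on_compose_gen[OF _ h(2), unfolded o_def] holomorphic_intros)
           (use h(1) Rz in force)
      show "norm (F (of_real R * z)) powr p \<le> (norm (g z))\<^sup>2" if "z \<in> ball 0 1" for z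
        unfolding g_def using Rz[of z] that by (intro h(3)) auto
      show "cmean (\<lambda>z. (norm (g z))\<^sup>2) r \<le> B" if r: "0 \<le> r" "r < 1" for r
      proof -
        have "cmean (\<lambda>z. (norm (g z))\<^sup>2) r = cmean (\<lambda>z. (norm (h z))\<^sup>2) (R * r)"
          unfolding g_def by (rule cmean_scale[of "\<lambda>z. (norm (h z))\<^sup>2"])
        also have "\<dots> \<le> cmean (\<lambda>z. (norm (h z))\<^sup>2) R"
          by (rule h2_mean_mono_disc[OF h(2)]) (use r R h in \<open>auto simp: mult_left_le\<close>)
        also have "\<dots> = cmean (\<lambda>z. norm (F z) powr p) R"
          by (rule cmean_cong) (use h R in auto)
        also have "\<dots> \<le> B" using R by (intro B) auto
        finally show ?thesis .
      qed
    qed (use R in \<open>auto simp: \<rho>_def\<close>)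
  qed
  then obtain g R where g: "\<And>k. g k holomorphic_on ball 0 1"
      "\<And>k. 1 - 1 / real (k + 2) < R k" "\<And>k. R k < 1"
      "\<And>k z. z \<in> ball 0 1 \<Longrightarrow> norm (F (of_real (R k) * z)) powr p \<le> (norm (g k z))\<^sup>2"
      "\<And>k r. 0 \<le> r \<Longrightarrow> r < 1 \<Longrightarrow> cmean (\<lambda>z. (norm (g k z))\<^sup>2) r \<le> B"
    by metis
  have Rlim: "R \<longlonglongrightarrow> 1"
  proof (rule tendsto_sandwich[of "\<lambda>k. 1 - 1 / real (k + 2)" R _ "\<lambda>_. 1"])
    show "(\<lambda>k. 1 - 1 / real (k + 2)) \<longlonglongrightarrow> 1" by real_asymp
  qed (use g(2,3) in \<open>auto intro!: always_eventually less_imp_le\<close>)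
  have bdd: "\<exists>C. \<forall>h\<in>range g. \<forall>z\<in>K. norm (h z) \<le> C" if K: "compact K" "K \<subseteq> ball 0 1" for K
  proof -
    have "compact ((\<lambda>z. sqrt B / (1 - norm z)) ` K)"
      by (intro compact_continuous_image continuous_intros K) (use K in auto)
    then obtain C where C: "\<And>z. z \<in> K \<Longrightarrow> norm (sqrt B / (1 - norm z)) \<le> C"
      using compact_imp_bounded bounded_iff by (metis image_eqI)
    have "norm (g k z) \<le> C" if "z \<in> K" for k z
    proof -
      have "norm (g k z) \<le> sqrt B / (1 - norm z)"
        using K that by (intro h2_pointwise[OF g(1,5)]) auto
      also have "\<dots> \<le> C" using C[OF that] unfolding real_norm_def by linarith
      finally show ?thesis .
    qed
    thus ?thesis by blast
  qed
  obtain h r where h: "h holomorphic_on ball 0 1" "strict_mono (r :: nat \<Rightarrow> nat)"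
    "\<And>x. x \<in> ball 0 1 \<Longrightarrow> (\<lambda>n. g (r n) x) \<longlonglongrightarrow> h x"
    "\<And>K. compact K \<Longrightarrow> K \<subseteq> ball 0 1 \<Longrightarrow> uniform_limit K (g \<circ> r) h sequentially"
    by (rule Montel[of "ball 0 1" "range g" g]) (use g(1) bdd in auto)
  show ?thesis
  proof (rule that[OF h(1)])
    fix z :: complex assume z: "norm z < 1"
    have Rr: "(\<lambda>n. R (r n)) \<longlonglongrightarrow> 1" using LIMSEQ_subseq_LIMSEQ[OF Rlim h(2)] by (simp add: o_def)
    have "(\<lambda>n. of_real (R (r n)) * z) \<longlonglongrightarrow> of_real 1 * z" by (intro tendsto_intros Rr)
    moreover have "isCont (\<lambda>z. norm (F z) powr p) z"
      using continuous_on_sphere_norm_powr[OF holomorphic_on_imp_continuous_on[OF F] p] z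
      by (subst (asm) continuous_on_eq_continuous_at) auto
    ultimately have "(\<lambda>n. norm (F (of_real (R (r n)) * z)) powr p) \<longlonglongrightarrow> norm (F z) powr p"
      by (intro isCont_tendsto_compose[of z "\<lambda>z. norm (F z) powr p"]) auto
    moreover have "(\<lambda>n. (norm (g (r n) z))\<^sup>2) \<longlonglongrightarrow> (norm (h z))\<^sup>2"
      using z by (intro tendsto_intros h(3)) auto
    ultimately show "norm (F z) powr p \<le> (norm (h z))\<^sup>2"
      by (rule LIMSEQ_le) (use g(4) z in auto)
  next
    fix t :: real assume t: "0 \<le> t" "t < 1"
    have cont: "continuous_on (sphere 0 t) (g k)" "continuous_on (sphere 0 t) h" for k
      by (intro holomorphic_on_imp_continuous_on holomorphic_on_subset[OF g(1)] holomorphic_on_subset[OF h(1)]; use t in auto)+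
    have bh: "bounded (h ` sphere 0 t)"
      using cont compact_continuous_image compact_imp_bounded compact_sphere by blast
    have "uniform_limit (sphere 0 t) (\<lambda>n. g (r n)) h sequentially"
    proof -
      have "sphere 0 t \<subseteq> ball (0::complex) 1" using t by auto
      from h(4)[OF compact_sphere this] show ?thesis by (simp add: o_def)
    qed
    hence "uniform_limit (sphere 0 t) (\<lambda>n z. norm (g (r n) z) * norm (g (r n) z)) (\<lambda>z. norm (h z) * norm (h z)) sequentially"
      by (intro uniform_lim_mult uniform_limit_norm) (use bh in \<open>auto simp: bounded_iff\<close>)
    hence "(\<lambda>n. cmean (\<lambda>z. norm (g (r n) z) * norm (g (r n) z)) t) \<longlonglongrightarrow> cmean (\<lambda>z. norm (h z) * norm (h z)) t"
      by (rule cmean_uniform_limit) (use t cont in \<open>auto intro!: continuous_intros\<close>)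
    thus "cmean (\<lambda>z. (norm (h z))\<^sup>2) t \<le> B"
      unfolding power2_eq_square by (rule LIMSEQ_le_const2) (use g(5) t in \<open>auto simp: power2_eq_square\<close>)
  qed
qed

subsection \<open>Estimates in Hardy spaces\<close>

definition hp_le :: "real \<Rightarrow> (complex \<Rightarrow> complex) \<Rightarrow> real \<Rightarrow> bool" where
  "hp_le p F B \<longleftrightarrow> F holomorphic_on ball 0 1 \<and>
     (\<forall>r. 0 \<le> r \<longrightarrow> r < 1 \<longrightarrow> cmean (\<lambda>z. norm (F z) powr p) r \<le> B)"

lemma hp_leD:
  assumes "hp_le p F B"
  shows "F holomorphic_on ball 0 1"
    and "0 \<le> r \<Longrightarrow> r < 1 \<Longrightarrow> cmean (\<lambda>z. norm (F z) powr p) r \<le> B"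
  using assms by (auto simp: hp_le_def)

lemma continuous_on_sphere_subset:
  "continuous_on (ball 0 1) f \<Longrightarrow> r < 1 \<Longrightarrow> continuous_on (sphere 0 r) f"
  by (erule continuous_on_subset) auto

lemma continuous_on_norm_powr_disc:
  "f holomorphic_on ball 0 1 \<Longrightarrow> p > 0 \<Longrightarrow> continuous_on (ball 0 1) (\<lambda>z. norm (f z) powr p)"
  by (intro continuous_on_sphere_norm_powr holomorphic_on_imp_continuous_on)

lemma hp_le_nonneg:
  assumes "hp_le p F B" "p > 0"
  shows "0 \<le> B"
proof -
  have "0 \<le> cmean (\<lambda>z. norm (F z) powr p) 0"
    by (intro cmean_nonneg continuous_on_sphere_subset continuous_on_norm_powr_disc hp_leD(1)[OF assms(1)] assms(2)) auto
  also have "\<dots> \<le> B" by (rule hp_leD(2)[OF assms(1)]) auto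
  finally show ?thesis .
qed

lemma hp_majorant:
  assumes "hp_le p F B" "p > 0"
  obtains h where "h holomorphic_on ball 0 1"
    "\<And>z. norm z < 1 \<Longrightarrow> norm (F z) powr p \<le> (norm (h z))\<^sup>2"
    "summable (\<lambda>n. (norm (taylor_coeff h n))\<^sup>2)" "(\<Sum>n. (norm (taylor_coeff h n))\<^sup>2) \<le> B"
proof -
  obtain h where h: "h holomorphic_on ball 0 1"
    "\<And>z. norm z < 1 \<Longrightarrow> norm (F z) powr p \<le> (norm (h z))\<^sup>2"
    "\<And>r. 0 \<le> r \<Longrightarrow> r < 1 \<Longrightarrow> cmean (\<lambda>z. (norm (h z))\<^sup>2) r \<le> B"
    using square_majorant[OF hp_leD(1)[OF assms(1)] assms(2) hp_leD(2)[OF assms(1)]] by metis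
  show ?thesis by (rule that[OF h(1,2) h2_coeffs[OF h(1,3)]])
qed

text \<open>Uniform integrability of the circle restrictions: the square majorant is a polynomial plus
  a function that is small in the mean square.\<close>

lemma hp_uniform_integrable:
  assumes F: "hp_le p F B" and p: "p > 0" and e: "e > 0"
  shows "\<exists>M\<ge>0. \<forall>\<kappa> r. continuous_on (sphere 0 r) \<kappa> \<longrightarrow> 0 \<le> r \<longrightarrow> r < 1 \<longrightarrow> (\<forall>z. norm z = r \<longrightarrow> 0 \<le> \<kappa> z \<and> \<kappa> z \<le> 1)
       \<longrightarrow> cmean (\<lambda>z. norm (F z) powr p * \<kappa> z) r \<le> M * cmean \<kappa> r + e"
proof -
  obtain h where h: "h holomorphic_on ball 0 1"
    "\<And>z. norm z < 1 \<Longrightarrow> norm (F z) powr p \<le> (norm (h z))\<^sup>2"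
    "summable (\<lambda>n. (norm (taylor_coeff h n))\<^sup>2)" "(\<Sum>n. (norm (taylor_coeff h n))\<^sup>2) \<le> B"
    using hp_majorant[OF F p] by metis
  obtain N where N: "norm (\<Sum>n. (norm (taylor_coeff h (n + N)))\<^sup>2) < e / 2"
    using suminf_exist_split[of "e / 2" "\<lambda>n. (norm (taylor_coeff h n))\<^sup>2"] e h(3) by auto
  define q where "q z = (\<Sum>n<N. taylor_coeff h n * z ^ n)" for z
  define d where "d z = h z - q z" for z
  define c where "c n = (if n < N then 0 else taylor_coeff h n)" for n
  have qh: "q holomorphic_on ball 0 1" unfolding q_def by (intro holomorphic_intros)
  have dh: "d holomorphic_on ball 0 1" unfolding d_def by (intro holomorphic_intros h qh)
  have "(\<lambda>n. c n * z ^ n) sums d z" if "norm z < 1" for z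
  proof -
    have "(\<lambda>n. taylor_coeff h n * z ^ n - (if n \<in> {..<N} then taylor_coeff h n * z ^ n else 0)) sums (h z - (\<Sum>n<N. taylor_coeff h n * z ^ n))"
      by (intro sums_diff taylor_coeff_sums h that sums_If_finite_set) simp
    thus ?thesis unfolding d_def q_def c_def
      by (rule sums_cong[THEN iffD1, rotated]) auto
  qed
  from taylor_coeff_unique[OF dh this] have tcd: "taylor_coeff d = c" .
  have "(\<lambda>n. (norm (c (n + N)))\<^sup>2) sums (\<Sum>n. (norm (taylor_coeff h (n + N)))\<^sup>2)"
    using summable_sums[OF summable_ignore_initial_segment[OF h(3), of N]] by (simp add: c_def)
  hence "(\<lambda>n. (norm (c n))\<^sup>2) sums ((\<Sum>n. (norm (taylor_coeff h (n + N)))\<^sup>2) + (\<Sum>n<N. (norm (c n))\<^sup>2))"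
    by (subst (asm) sums_iff_shift)
  moreover have "(\<Sum>n<N. (norm (c n))\<^sup>2) = 0" by (simp add: c_def)
  ultimately have csum: "summable (\<lambda>n. (norm (taylor_coeff d n))\<^sup>2)" "(\<Sum>n. (norm (taylor_coeff d n))\<^sup>2) < e / 2"
    using N by (auto simp: tcd sums_iff)
  define m where "m = (\<Sum>n<N. norm (taylor_coeff h n))"
  have m0: "m \<ge> 0" unfolding m_def by (intro sum_nonneg) auto
  have qm: "norm (q z) \<le> m" if "norm z < 1" for z
    unfolding q_def m_def
    by (rule sum_norm_le) (use that in \<open>auto simp: norm_mult norm_power intro!: mult_left_le power_le_one\<close>)
  show ?thesis
  proof (intro exI[of _ "2 * m\<^sup>2"] conjI allI impI)
    fix \<kappa> :: "complex \<Rightarrow> real" and r :: real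
    assume \<kappa>: "continuous_on (sphere 0 r) \<kappa>" and r: "0 \<le> r" "r < 1" and "\<forall>z. norm z = r \<longrightarrow> 0 \<le> \<kappa> z \<and> \<kappa> z \<le> 1"
    hence b: "\<And>z. norm z = r \<Longrightarrow> 0 \<le> \<kappa> z \<and> \<kappa> z \<le> 1" by blast
    have cd: "continuous_on (sphere 0 r) d"
      by (intro continuous_on_sphere_subset holomorphic_on_imp_continuous_on dh r)
    have cF: "continuous_on (sphere 0 r) (\<lambda>z. norm (F z) powr p)"
      by (intro continuous_on_sphere_subset continuous_on_norm_powr_disc hp_leD(1)[OF F] p r)
    have "cmean (\<lambda>z. norm (F z) powr p * \<kappa> z) r \<le> cmean (\<lambda>z. 2 * m\<^sup>2 * \<kappa> z + 2 * (norm (d z))\<^sup>2) r"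
    proof (rule cmean_mono)
      fix z :: complex assume z: "norm z = r"
      have "norm (h z) \<le> norm (q z) + norm (d z)" unfolding d_def by (simp add: norm_triangle_sub)
      hence "(norm (h z))\<^sup>2 \<le> (norm (q z) + norm (d z))\<^sup>2" by (intro power_mono) auto
      also have "\<dots> \<le> 2 * (norm (q z))\<^sup>2 + 2 * (norm (d z))\<^sup>2"
        using sum_squares_bound[of "norm (q z)" "norm (d z)"] by (simp add: power2_sum)
      also have "(norm (q z))\<^sup>2 \<le> m\<^sup>2" using qm[of z] z r by (intro power_mono) auto
      finally have "(norm (h z))\<^sup>2 \<le> 2 * m\<^sup>2 + 2 * (norm (d z))\<^sup>2" by simp
      with h(2)[of z] z r have "norm (F z) powr p \<le> 2 * m\<^sup>2 + 2 * (norm (d z))\<^sup>2" by auto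
      hence "norm (F z) powr p * \<kappa> z \<le> (2 * m\<^sup>2 + 2 * (norm (d z))\<^sup>2) * \<kappa> z"
        using b[OF z] by (intro mult_right_mono) auto
      also have "\<dots> \<le> 2 * m\<^sup>2 * \<kappa> z + 2 * (norm (d z))\<^sup>2"
        using b[OF z] by (simp add: algebra_simps mult_left_le_one_le)
      finally show "norm (F z) powr p * \<kappa> z \<le> 2 * m\<^sup>2 * \<kappa> z + 2 * (norm (d z))\<^sup>2" .
    qed (intro continuous_intros cF cd \<kappa> r)+
    also have "\<dots> = 2 * m\<^sup>2 * cmean \<kappa> r + 2 * cmean (\<lambda>z. (norm (d z))\<^sup>2) r"
    proof -
      have "cmean (\<lambda>z. 2 * m\<^sup>2 * \<kappa> z) r = 2 * m\<^sup>2 * cmean \<kappa> r" by (rule cmean_cmult[OF \<kappa> r(1)])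
      moreover have "cmean (\<lambda>z. 2 * (norm (d z))\<^sup>2) r = 2 * cmean (\<lambda>z. (norm (d z))\<^sup>2) r"
        by (intro cmean_cmult continuous_intros cd r)
      ultimately show ?thesis by (subst cmean_add) (use r in \<open>auto intro!: continuous_intros \<kappa> cd\<close>)
    qed
    also have "cmean (\<lambda>z. (norm (d z))\<^sup>2) r \<le> e / 2"
      using h2_mean_le[OF dh r csum(1)] csum(2) by simp
    finally show "cmean (\<lambda>z. norm (F z) powr p * \<kappa> z) r \<le> 2 * m\<^sup>2 * cmean \<kappa> r + e" by simp
  qed simp
qed

lemma carleson_circle:
  fixes \<omega> :: "complex \<Rightarrow> real"
  assumes r: "0 \<le> r" "r < 1" and w: "continuous_on (sphere 0 r) \<omega>" "\<And>z. norm z = r \<Longrightarrow> \<omega> z \<ge> 0"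
    and \<psi>: "\<psi> holomorphic_on ball 0 1" "\<psi> ` ball 0 1 \<subseteq> ball 0 1"
    and C: "\<And>a. norm a < 1 \<Longrightarrow> cmean (\<lambda>z. \<omega> z * kap a (\<psi> z)) r \<le> C"
    and f: "f holomorphic_on ball 0 1" and c: "summable (\<lambda>n. (norm (taylor_coeff f n))\<^sup>2)"
  shows "cmean (\<lambda>z. \<omega> z * (norm (f (\<psi> z)))\<^sup>2) r \<le> 9 * C * (\<Sum>n. (norm (taylor_coeff f n))\<^sup>2)"
proof -
  define z where "z t = complex_of_real r * cis t" for t
  have z: "norm (z t) = r" for t using r by (simp add: z_def norm_mult)
  have zc: "continuous_on {0..2*pi} z" unfolding z_def by (intro continuous_intros)
  have "integral {0..2*pi} (\<lambda>t. \<omega> (z t) / (2*pi) * (norm (f (\<psi> (z t))))\<^sup>2) \<le> 9 * C * (\<Sum>n. (norm (taylor_coeff f n))\<^sup>2)"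
  proof (rule carleson_curve[where \<sigma> = "\<lambda>t. \<psi> (z t)"])
    show "continuous_on {0..2*pi} (\<lambda>t. \<omega> (z t) / (2*pi))"
      by (intro continuous_intros continuous_on_compose2[OF w(1) zc]) (auto simp: z)
    show "continuous_on {0..2*pi} (\<lambda>t. \<psi> (z t))"
      by (rule continuous_on_compose2[OF holomorphic_on_imp_continuous_on[OF \<psi>(1)] zc]) (use r in \<open>auto simp: z\<close>)
    show "norm (\<psi> (z t)) < 1" for t using \<psi>(2) z[of t] r by (auto simp: image_subset_iff)
    show "integral {0..2*pi} (\<lambda>t. \<omega> (z t) / (2*pi) * kap a (\<psi> (z t))) \<le> C" if "norm a < 1" for a
      using C[OF that] by (simp add: cmean_def z_def field_simps)
  qed (use w z f c in auto)
  thus ?thesis by (simp add: cmean_def z_def field_simps)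
qed

lemma kap_le_Re:
  assumes "norm a < 1" "norm w < 1"
  shows "kap a w \<le> Re ((1 + cnj a * w) / (1 - cnj a * w))"
    and "Re ((1 + cnj a * w) / (1 - cnj a * w)) = (1 - (norm a)\<^sup>2 * (norm w)\<^sup>2) / (norm (1 - cnj a * w))\<^sup>2"
proof -
  have "Re ((1 + cnj a * w) / (1 - cnj a * w)) = Re ((1 + cnj a * w) * cnj (1 - cnj a * w)) / (norm (1 - cnj a * w))\<^sup>2"
    by (subst complex_div_cnj) (simp only: Re_divide_of_real of_real_power[symmetric])
  also have "Re ((1 + cnj a * w) * cnj (1 - cnj a * w)) = 1 - (norm a)\<^sup>2 * (norm w)\<^sup>2"
    unfolding cmod_power2 by (simp add: power2_eq_square algebra_simps)
  finally show eq: "Re ((1 + cnj a * w) / (1 - cnj a * w)) = (1 - (norm a)\<^sup>2 * (norm w)\<^sup>2) / (norm (1 - cnj a * w))\<^sup>2" .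
  have "(norm a)\<^sup>2 * (norm w)\<^sup>2 \<le> (norm a)\<^sup>2"
    using assms by (intro mult_left_le) (auto simp: power_le_one)
  thus "kap a w \<le> Re ((1 + cnj a * w) / (1 - cnj a * w))"
    unfolding eq kap_def by (intro divide_right_mono) auto
qed

lemma norm_one_minus_ge:
  fixes x y :: complex
  assumes "norm x \<le> 1"
  shows "1 - norm y \<le> norm (1 - x * y)"
proof -
  have "norm (x * y) \<le> norm y" using assms by (simp add: norm_mult mult_left_le_one_le)
  moreover have "norm (1::complex) - norm (x * y) \<le> norm (1 - x * y)" by (rule norm_triangle_ineq2)
  ultimately show ?thesis by simp
qed

lemma kap_continuous:
  assumes "continuous_on S \<psi>" "\<And>z. z \<in> S \<Longrightarrow> norm (\<psi> z) < 1" "norm a \<le> 1"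
  shows "continuous_on S (\<lambda>z. kap a (\<psi> z))"
  unfolding kap_def
  by (intro continuous_intros assms(1)) (use one_minus_cnj_mult_nonzero[OF assms(3) assms(2)] in auto)

lemma cmean_kap_selfmap:
  assumes \<psi>: "\<psi> holomorphic_on ball 0 1" "\<psi> ` ball 0 1 \<subseteq> ball 0 1" and a: "norm a < 1" and r: "0 \<le> r" "r < 1"
  shows "cmean (\<lambda>z. kap a (\<psi> z)) r \<le> 2 / (1 - norm (\<psi> 0))"
proof -
  have n: "norm (\<psi> z) < 1" if "norm z < 1" for z using \<psi>(2) that by (auto simp: image_subset_iff)
  have nz: "1 - cnj a * \<psi> z \<noteq> 0" if "z \<in> ball 0 1" for z
    using one_minus_cnj_mult_nonzero[of a "\<psi> z"] a n[of z] that by auto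
  define g where "g z = (1 + cnj a * \<psi> z) / (1 - cnj a * \<psi> z)" for z
  have g: "g holomorphic_on ball 0 1" unfolding g_def by (intro holomorphic_intros \<psi> nz)
  have cg: "continuous_on (sphere 0 r) g"
    by (intro continuous_on_sphere_subset holomorphic_on_imp_continuous_on g r)
  have "cmean (\<lambda>z. kap a (\<psi> z)) r \<le> cmean (\<lambda>z. Re (g z)) r"
    unfolding g_def[symmetric]
    by (intro cmean_mono r kap_continuous continuous_intros cg continuous_on_sphere_subset holomorphic_on_imp_continuous_on \<psi>)
       (use a n r kap_le_Re(1) in \<open>auto simp: g_def\<close>)
  also have "\<dots> = Re (g 0)"
    using cmean_bounded_linear[OF bounded_linear_Re cg r(1)] cmean_holomorphic[OF g r] by simp
  also have "\<dots> \<le> norm (g 0)" by (rule complex_Re_le_cmod)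
  also have "\<dots> = norm (1 + cnj a * \<psi> 0) / norm (1 - cnj a * \<psi> 0)" by (simp add: g_def norm_divide)
  also have "\<dots> \<le> 2 / (1 - norm (\<psi> 0))"
  proof (rule frac_le)
    have "norm (1 + cnj a * \<psi> 0) \<le> 1 + norm a * norm (\<psi> 0)"
      by (rule order_trans[OF norm_triangle_ineq]) (simp add: norm_mult)
    also have "norm a * norm (\<psi> 0) \<le> 1" using a n[of 0] by (intro mult_le_one) auto
    finally show "norm (1 + cnj a * \<psi> 0) \<le> 2" by simp
    show "1 - norm (\<psi> 0) \<le> norm (1 - cnj a * \<psi> 0)" by (rule norm_one_minus_ge) (use a in auto)
  qed (use n[of 0] in auto)
  finally show ?thesis .
qed

lemma littlewood_subordination:
  assumes \<psi>: "\<psi> holomorphic_on ball 0 1" "\<psi> ` ball 0 1 \<subseteq> ball 0 1" and r: "0 \<le> r" "r < 1"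
    and f: "f holomorphic_on ball 0 1" and c: "summable (\<lambda>n. (norm (taylor_coeff f n))\<^sup>2)"
  shows "cmean (\<lambda>z. (norm (f (\<psi> z)))\<^sup>2) r \<le> 18 / (1 - norm (\<psi> 0)) * (\<Sum>n. (norm (taylor_coeff f n))\<^sup>2)"
  using carleson_circle[OF r, of "\<lambda>_. 1" \<psi> "2 / (1 - norm (\<psi> 0))" f] cmean_kap_selfmap[OF \<psi> _ r] \<psi> f c
  by simp

lemma le_one_plus_powr:
  assumes "x \<ge> (0::real)" "p \<ge> 1"
  shows "x \<le> 1 + x powr p"
proof (cases "x \<le> 1")
  case False
  hence "x powr 1 \<le> x powr p" using assms by (intro powr_mono) auto
  thus ?thesis using False by simp
qed (use assms in \<open>auto intro: order_trans\<close>)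

lemma integral_radial_kap:
  fixes s c :: real
  assumes "0 \<le> s" "s < 1" "0 \<le> c" "c < 1"
  shows "((\<lambda>t. s * ((1 - c\<^sup>2) / (1 - c * (s * t))\<^sup>2)) has_integral s * (1 - c\<^sup>2) / (1 - c * s)) {0..1}"
proof -
  have cs: "c * (s * t) < 1" if "0 \<le> t" "t \<le> 1" for t
  proof -
    have "c * (s * t) \<le> c * 1" using that assms by (intro mult_left_mono mult_le_one) auto
    thus ?thesis using assms by simp
  qed
  have "((\<lambda>t. s * ((1 - c\<^sup>2) / (1 - c * (s * t))\<^sup>2)) has_integral
     (s * (1 - c\<^sup>2) * 1 / (1 - c * (s * 1)) - s * (1 - c\<^sup>2) * 0 / (1 - c * (s * 0)))) {0..1}"
  proof (rule fundamental_theorem_of_calculus)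
    fix t :: real assume "t \<in> {0..1}"
    hence nz: "1 - c * (s * t) \<noteq> 0" using cs[of t] by auto
    have "((\<lambda>t. s * (1 - c\<^sup>2) * t / (1 - c * (s * t))) has_real_derivative
        s * ((1 - c\<^sup>2) / (1 - c * (s * t))\<^sup>2)) (at t within {0..1})"
      by (rule derivative_eq_intros refl nz | use nz in \<open>simp add: power2_eq_square field_simps\<close>)+
    thus "((\<lambda>t. s * (1 - c\<^sup>2) * t / (1 - c * (s * t))) has_vector_derivative
        s * ((1 - c\<^sup>2) / (1 - c * (s * t))\<^sup>2)) (at t within {0..1})"
      by (simp add: has_real_derivative_iff_has_vector_derivative)
  qed simp
  thus ?thesis by simp
qed

text \<open>Carleson's inequality for the arc length measure on a radius replaces the Fejer-Riesz inequality.\<close>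

lemma bounded_of_deriv_hp:
  assumes f: "f holomorphic_on ball 0 1" and B: "hp_le p (deriv f) B" and p: "p \<ge> 1" and z: "norm z < 1"
  shows "norm (f z) \<le> norm (f 0) + 1 + 18 * B"
proof -
  have p0: "p > 0" using p by simp
  have df: "deriv f holomorphic_on ball 0 1" by (rule hp_leD(1)[OF B])
  obtain h where h: "h holomorphic_on ball 0 1"
    "\<And>z. norm z < 1 \<Longrightarrow> norm (deriv f z) powr p \<le> (norm (h z))\<^sup>2"
    "summable (\<lambda>n. (norm (taylor_coeff h n))\<^sup>2)" "(\<Sum>n. (norm (taylor_coeff h n))\<^sup>2) \<le> B"
    using hp_majorant[OF B p0] by metis
  have tz: "norm (of_real t * z) < 1" if "t \<in> {0..1}" for t
  proof -
    have "\<bar>t\<bar> * norm z \<le> 1 * norm z" using that by (intro mult_right_mono) auto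
    thus ?thesis using z by (simp add: norm_mult)
  qed
  have curve: "integral {0..1} (\<lambda>t. norm z * (norm (h (of_real t * z)))\<^sup>2) \<le> 9 * 2 * (\<Sum>n. (norm (taylor_coeff h n))\<^sup>2)"
  proof (rule carleson_curve)
    fix a :: complex assume a: "norm a < 1"
    have "integral {0..1} (\<lambda>t. norm z * kap a (of_real t * z))
        \<le> integral {0..1} (\<lambda>t. norm z * ((1 - (norm a)\<^sup>2) / (1 - norm a * (norm z * t))\<^sup>2))"
    proof (rule integral_le)
      show "(\<lambda>t. norm z * kap a (of_real t * z)) integrable_on {0..1}"
        by (intro integrable_continuous_real continuous_intros kap_continuous) (use tz a in auto)
      show "(\<lambda>t. norm z * ((1 - (norm a)\<^sup>2) / (1 - norm a * (norm z * t))\<^sup>2)) integrable_on {0..1}"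
        using integral_radial_kap[of "norm z" "norm a"] a z by (auto simp: integrable_on_def)
      fix t :: real assume t: "t \<in> {0..1}"
      have "norm z * t = norm (of_real t * z)" using t by (simp add: norm_mult)
      moreover have "norm a * norm (of_real t * z) < 1"
        using mult_strict_mono[of "norm a" 1 "norm (of_real t * z)" 1] a tz[OF t] by simp
      moreover have "1 - norm a * norm (of_real t * z) \<le> norm (1 - cnj a * (of_real t * z))"
        using norm_triangle_ineq2[of 1 "cnj a * (of_real t * z)"] by (simp add: norm_mult)
      ultimately show "norm z * kap a (of_real t * z) \<le> norm z * ((1 - (norm a)\<^sup>2) / (1 - norm a * (norm z * t))\<^sup>2)"
        unfolding kap_def using a by (intro mult_left_mono divide_left_mono power_mono mult_pos_pos) (auto simp: power_le_one)
    qed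
    also have "\<dots> = norm z * (1 - (norm a)\<^sup>2) / (1 - norm a * norm z)"
      using integral_radial_kap[of "norm z" "norm a"] a z by (simp add: integral_unique)
    also have "\<dots> \<le> 1 * (1 - (norm a)\<^sup>2) / (1 - norm a)"
      using a z by (intro frac_le mult_right_mono) (auto simp: power_le_one mult_left_le)
    also have "\<dots> = 1 + norm a" using a by (simp add: power2_eq_square field_simps)
    also have "\<dots> \<le> 2" using a by simp
    finally show "integral {0..1} (\<lambda>t. norm z * kap a (of_real t * z)) \<le> 2" .
  qed (use tz h in \<open>auto intro!: continuous_intros\<close>)
  have cont: "continuous_on {0..1} (\<lambda>t. g (of_real t * z))" if "g holomorphic_on ball 0 1" for g :: "complex \<Rightarrow> complex"
    by (rule continuous_on_compose2[OF holomorphic_on_imp_continuous_on[OF that]])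
       (use tz in \<open>auto intro!: continuous_intros\<close>)
  have "((\<lambda>t. z * deriv f (of_real t * z)) has_integral f (of_real 1 * z) - f (of_real 0 * z)) {0..1}"
  proof (rule fundamental_theorem_of_calculus)
    fix t :: real assume t: "t \<in> {0..1}"
    have "(f has_field_derivative deriv f (of_real t * z)) (at (of_real t * z))"
      using holomorphic_derivI[OF f open_ball, of "of_real t * z"] tz[OF t] by simp
    moreover have "((\<lambda>t. of_real t * z) has_vector_derivative z) (at t within {0..1})"
      by (auto intro!: derivative_eq_intros)
    ultimately have "(f \<circ> (\<lambda>t. of_real t * z) has_vector_derivative z * deriv f (of_real t * z)) (at t within {0..1})"
      using field_vector_diff_chain_within has_field_derivative_at_within by blast
    thus "((\<lambda>t. f (of_real t * z)) has_vector_derivative z * deriv f (of_real t * z)) (at t within {0..1})"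
      by (simp add: o_def)
  qed simp
  hence "integral {0..1} (\<lambda>t. z * deriv f (of_real t * z)) = f (of_real 1 * z) - f (of_real 0 * z)"
    by (rule integral_unique)
  also have "\<dots> = f z - f 0" by simp
  finally have I: "integral {0..1} (\<lambda>t. z * deriv f (of_real t * z)) = f z - f 0" .
  have "norm (integral {0..1} (\<lambda>t. z * deriv f (of_real t * z))) \<le> integral {0..1} (\<lambda>t. 1 + norm z * (norm (h (of_real t * z)))\<^sup>2)"
  proof (rule integral_norm_bound_integral)
    fix t :: real assume t: "t \<in> {0..1}"
    have "norm (deriv f (of_real t * z)) \<le> 1 + norm (deriv f (of_real t * z)) powr p"
      by (rule le_one_plus_powr) (use p in auto)
    also have "\<dots> \<le> 1 + (norm (h (of_real t * z)))\<^sup>2" using h(2)[OF tz[OF t]] by simp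
    finally have "norm z * norm (deriv f (of_real t * z)) \<le> norm z * (1 + (norm (h (of_real t * z)))\<^sup>2)"
      by (intro mult_left_mono) auto
    thus "norm (z * deriv f (of_real t * z)) \<le> 1 + norm z * (norm (h (of_real t * z)))\<^sup>2"
      using z by (simp add: norm_mult algebra_simps)
  qed (auto intro!: integrable_continuous_real continuous_intros cont holomorphic_intros df h)
  also have "\<dots> = 1 + integral {0..1} (\<lambda>t. norm z * (norm (h (of_real t * z)))\<^sup>2)"
    by (subst integral_add) (auto intro!: integrable_continuous_real continuous_intros cont h)
  also have "\<dots> \<le> 1 + 18 * B" using curve h(4) by simp
  finally have "norm (f z - f 0) \<le> 1 + 18 * B" unfolding I .
  moreover have "norm (f z) \<le> norm (f 0) + norm (f z - f 0)" by (rule norm_triangle_sub)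
  ultimately show ?thesis by simp
qed

lemma taylor_coeff_deriv: "taylor_coeff (deriv f) k = of_nat (Suc k) * taylor_coeff f (Suc k)"
  by (simp add: taylor_coeff_def funpow_Suc_right del: funpow.simps of_nat_Suc)

lemma taylor_coeff_deriv_bound:
  assumes B: "hp_le p (deriv f) B" and p: "p \<ge> 1"
  shows "norm (taylor_coeff f (Suc k)) \<le> (1 + B) / real (Suc k)"
proof -
  have df: "deriv f holomorphic_on ball 0 1" by (rule hp_leD(1)[OF B])
  have le: "norm (taylor_coeff (deriv f) k) * r ^ (2 * k) \<le> 1 + B" if r: "0 < r" "r < 1" for r
  proof -
    have cf: "continuous_on (sphere 0 r) (deriv f)"
      by (intro continuous_on_sphere_subset holomorphic_on_imp_continuous_on df r)
    have cp: "continuous_on (sphere 0 r) (\<lambda>z. norm (deriv f z) powr p)"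
      using cf p by (intro continuous_on_sphere_norm_powr) auto
    have "norm (taylor_coeff (deriv f) k) * r ^ (2 * k) = norm (cmean (\<lambda>z. deriv f z * cnj z ^ k) r)"
      using coeff_cmean[OF taylor_coeff_sums[OF df], of r k] r by (simp add: norm_mult norm_power)
    also have "\<dots> \<le> cmean (\<lambda>z. norm (deriv f z * cnj z ^ k)) r"
      by (rule norm_cmean_le) (use r in \<open>auto intro!: continuous_intros cf\<close>)
    also have "\<dots> \<le> cmean (\<lambda>z. 1 + norm (deriv f z) powr p) r"
    proof (rule cmean_mono)
      fix z :: complex assume z: "norm z = r"
      have "norm (deriv f z * cnj z ^ k) \<le> norm (deriv f z)"
        using z r by (auto simp: norm_mult norm_power intro!: mult_left_le power_le_one)
      also have "\<dots> \<le> 1 + norm (deriv f z) powr p" by (rule le_one_plus_powr) (use p in auto)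
      finally show "norm (deriv f z * cnj z ^ k) \<le> 1 + norm (deriv f z) powr p" .
    qed (use r in \<open>auto intro!: continuous_intros cf cp\<close>)
    also have "\<dots> = 1 + cmean (\<lambda>z. norm (deriv f z) powr p) r"
      by (subst cmean_add) (use r cp in auto)
    also have "\<dots> \<le> 1 + B" using hp_leD(2)[OF B, of r] r by simp
    finally show ?thesis .
  qed
  have "((\<lambda>r. norm (taylor_coeff (deriv f) k) * r ^ (2 * k)) \<longlongrightarrow> norm (taylor_coeff (deriv f) k) * 1 ^ (2 * k)) (at_left (1::real))"
    by (intro tendsto_intros)
  moreover have "eventually (\<lambda>r. norm (taylor_coeff (deriv f) k) * r ^ (2 * k) \<le> 1 + B) (at_left (1::real))"
    by (rule eventually_at_leftI[of 0]) (use le in auto)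
  ultimately have "norm (taylor_coeff (deriv f) k) * 1 ^ (2 * k) \<le> 1 + B"
    by (rule tendsto_upperbound) simp
  thus ?thesis by (simp add: taylor_coeff_deriv norm_mult field_simps del: of_nat_Suc)
qed

lemma taylor_coeff_tendsto_zero:
  assumes f: "\<And>n. f n holomorphic_on ball 0 1" and u: "uniform_limit (sphere 0 (1/2)) f (\<lambda>_. 0) sequentially"
  shows "(\<lambda>n. taylor_coeff (f n) k) \<longlonglongrightarrow> 0"
proof -
  have "bounded ((\<lambda>z. cnj z ^ k) ` sphere 0 (1/2))"
    by (intro compact_imp_bounded compact_continuous_image continuous_intros compact_sphere)
  hence "uniform_limit (sphere 0 (1/2)) (\<lambda>n z. f n z * cnj z ^ k) (\<lambda>z. 0 * cnj z ^ k) sequentially"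
    by (intro uniform_lim_mult u uniform_limit_const) (auto simp: bounded_iff)
  hence "(\<lambda>n. cmean (\<lambda>z. f n z * cnj z ^ k) (1/2)) \<longlonglongrightarrow> cmean (\<lambda>z. 0 * cnj z ^ k) (1/2)"
  proof (rule cmean_uniform_limit)
    have "continuous_on (sphere 0 (1/2)) (f n)" for n
      by (intro continuous_on_sphere_subset holomorphic_on_imp_continuous_on f) simp
    thus "continuous_on (sphere 0 (1/2)) (\<lambda>z. f n z * cnj z ^ k)" for n
      by (intro continuous_intros)
  qed simp
  hence "(\<lambda>n. taylor_coeff (f n) k * of_real ((1/2) ^ (2 * k))) \<longlonglongrightarrow> 0"
  proof -
    have "cmean (\<lambda>z. f n z * cnj z ^ k) (1/2) = taylor_coeff (f n) k * of_real ((1/2) ^ (2 * k))" for n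
      by (rule coeff_cmean[OF taylor_coeff_sums[OF f]]) auto
    thus ?thesis using \<open>(\<lambda>n. cmean (\<lambda>z. f n z * cnj z ^ k) (1/2)) \<longlonglongrightarrow> _\<close> by simp
  qed
  hence "(\<lambda>n. taylor_coeff (f n) k * of_real ((1/2) ^ (2 * k)) * of_real (2 ^ (2 * k))) \<longlonglongrightarrow> 0 * of_real (2 ^ (2 * k))"
    by (intro tendsto_intros)
  thus ?thesis by (simp add: power_mult_distrib[symmetric] mult.assoc flip: of_real_mult)
qed

lemma h2_norm_tendsto_zero:
  assumes f: "\<And>n. f n holomorphic_on ball 0 1" and u: "uniform_limit (sphere 0 (1/2)) f (\<lambda>_. 0) sequentially"
    and C: "\<And>n k. norm (taylor_coeff (f n) (Suc k)) \<le> C / real (Suc k)"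
  shows "summable (\<lambda>k. (norm (taylor_coeff (f n) k))\<^sup>2)" "(\<lambda>n. \<Sum>k. (norm (taylor_coeff (f n) k))\<^sup>2) \<longlonglongrightarrow> 0"
proof -
  have sM: "summable (\<lambda>k. C\<^sup>2 * (1 / (real k)\<^sup>2))"
    by (intro summable_mult) (use inverse_power_summable[of 2, where 'a=real] in \<open>simp add: inverse_eq_divide\<close>)
  have bound: "(norm (taylor_coeff (f n) k))\<^sup>2 \<le> C\<^sup>2 * (1 / (real k)\<^sup>2)" if "k > 0" for n k
  proof -
    obtain j where j: "k = Suc j" using \<open>k > 0\<close> gr0_conv_Suc by blast
    have "(norm (taylor_coeff (f n) k))\<^sup>2 \<le> (C / real k)\<^sup>2" unfolding j by (intro power_mono C) auto
    thus ?thesis by (simp add: power_divide)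
  qed
  show s: "summable (\<lambda>k. (norm (taylor_coeff (f n) k))\<^sup>2)" for n
    by (rule summable_comparison_test_ev[OF eventually_mono[OF eventually_gt_at_top[of "0::nat"]] sM])
       (use bound in auto)
  have "(\<lambda>n. \<Sum>k. (norm (taylor_coeff (f n) k))\<^sup>2) \<longlonglongrightarrow> (\<Sum>k::nat. 0::real)"
  proof (rule tannerys_theorem[THEN conjunct2, THEN conjunct2])
    show "(\<lambda>n. (norm (taylor_coeff (f n) k))\<^sup>2) \<longlonglongrightarrow> 0" for k
      using tendsto_power[OF tendsto_norm[OF taylor_coeff_tendsto_zero[OF f u, of k]], of 2] by simp
    show "eventually (\<lambda>(k, n). norm ((norm (taylor_coeff (f n) k))\<^sup>2) \<le> C\<^sup>2 * (1 / (real k)\<^sup>2)) (at_top \<times>\<^sub>F sequentially)"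
    proof -
      have "eventually (\<lambda>x. fst x > 0 \<and> True) (sequentially \<times>\<^sub>F (sequentially :: nat filter))"
        using eventually_prodI[OF eventually_gt_at_top[of "0::nat"], of "\<lambda>_. True" sequentially] by simp
      thus ?thesis by eventually_elim (use bound in auto)
    qed
  qed (use sM in auto)
  thus "(\<lambda>n. \<Sum>k. (norm (taylor_coeff (f n) k))\<^sup>2) \<longlonglongrightarrow> 0" by simp
qed

lemma weighted_sp_embedding_compact:
  assumes p: "p \<ge> 1" and F: "hp_le p F B0"
    and \<psi>: "\<psi> holomorphic_on ball 0 1" "\<psi> ` ball 0 1 \<subseteq> ball 0 1"
    and f: "\<And>n. f n holomorphic_on ball 0 1" and u: "uniform_limit (sphere 0 (1/2)) f (\<lambda>_. 0) sequentially"
    and C: "\<And>n z. norm z < 1 \<Longrightarrow> norm (f n z) \<le> C" "C > 0" "\<And>n k. norm (taylor_coeff (f n) (Suc k)) \<le> C' / real (Suc k)"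
    and e: "e > 0"
  shows "eventually (\<lambda>n. \<forall>r. 0 \<le> r \<longrightarrow> r < 1 \<longrightarrow> cmean (\<lambda>z. norm (F z) powr p * norm (f n (\<psi> z)) powr p) r \<le> e) sequentially"
proof -
  have p0: "p > 0" using p by simp
  have n\<psi>: "norm (\<psi> z) < 1" if "norm z < 1" for z using \<psi>(2) that by (auto simp: image_subset_iff)
  define e1 where "e1 = e / (2 * C powr p)"
  have e1: "e1 > 0" using e C(2) by (simp add: e1_def)
  obtain M where M: "M \<ge> 0"
    "\<forall>\<kappa> r. continuous_on (sphere 0 r) \<kappa> \<longrightarrow> 0 \<le> r \<longrightarrow> r < 1 \<longrightarrow> (\<forall>z. norm z = r \<longrightarrow> 0 \<le> \<kappa> z \<and> \<kappa> z \<le> 1)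
       \<longrightarrow> cmean (\<lambda>z. norm (F z) powr p * \<kappa> z) r \<le> M * cmean \<kappa> r + e1"
    using hp_uniform_integrable[OF F p0 e1] by blast
  define \<eta> where "\<eta> = e1 / (2 * (M + 1))"
  have \<eta>: "\<eta> > 0" "M * (2 * \<eta>) \<le> e1" using e1 M(1) by (auto simp: \<eta>_def field_simps)
  define K where "K = 18 / (1 - norm (\<psi> 0)) / (\<eta> * C\<^sup>2)"
  define S where "S n = (\<Sum>k. (norm (taylor_coeff (f n) k))\<^sup>2)" for n
  note S = h2_norm_tendsto_zero[OF f u C(3)]
  have "(\<lambda>n. K * S n) \<longlonglongrightarrow> K * 0" unfolding S_def by (intro tendsto_intros S)
  hence "eventually (\<lambda>n. K * S n < \<eta>) sequentially" using \<eta> by (intro order_tendstoD(2)) auto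
  thus ?thesis
  proof eventually_elim
    case (elim n)
    show ?case
    proof (intro allI impI)
      fix r :: real assume r: "0 \<le> r" "r < 1"
      define \<kappa> where "\<kappa> z = (norm (f n (\<psi> z)) / C) powr p" for z
      have cf: "continuous_on (sphere 0 r) (\<lambda>z. f n (\<psi> z))"
        by (intro continuous_on_sphere_subset r holomorphic_on_imp_continuous_on holomorphic_on_compose_gen[OF \<psi>(1) f, unfolded o_def] \<psi>)
      have c\<kappa>: "continuous_on (sphere 0 r) \<kappa>" unfolding \<kappa>_def
        by (intro continuous_on_powr' continuous_intros cf) (use C p in auto)
      have x1: "norm (f n (\<psi> z)) / C \<le> 1" if "norm z = r" for z
        using C(1)[OF n\<psi>, of z n] C(2) that r by simp
      have "cmean \<kappa> r \<le> cmean (\<lambda>z. \<eta> + 1 / (\<eta> * C\<^sup>2) * (norm (f n (\<psi> z)))\<^sup>2) r"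
      proof (rule cmean_mono[OF c\<kappa> _ r(1)])
        fix z :: complex assume z: "norm z = r"
        define x where "x = norm (f n (\<psi> z)) / C"
        have x: "0 \<le> x" "x \<le> 1" using x1[OF z] C(2) by (auto simp: x_def)
        have "x powr p \<le> x powr 1" by (rule powr_mono') (use x p in auto)
        also have "\<dots> = x" using x by simp
        also have "x \<le> \<eta> + x\<^sup>2 / \<eta>"
        proof (cases "x \<le> \<eta>")
          case True
          moreover have "0 \<le> x\<^sup>2 / \<eta>" using \<eta> by simp
          ultimately show ?thesis by linarith
        next
          case False
          hence "x * \<eta> \<le> x * x" using x by (intro mult_left_mono) auto
          hence "x \<le> x\<^sup>2 / \<eta>" using \<eta> by (simp add: field_simps power2_eq_square)
          thus ?thesis using \<eta> by simp
        qed
        finally show "\<kappa> z \<le> \<eta> + 1 / (\<eta> * C\<^sup>2) * (norm (f n (\<psi> z)))\<^sup>2"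
          using C(2) \<eta> by (simp add: \<kappa>_def x_def power_divide mult.commute)
      qed (intro continuous_intros cf)
      also have "\<dots> = \<eta> + 1 / (\<eta> * C\<^sup>2) * cmean (\<lambda>z. (norm (f n (\<psi> z)))\<^sup>2) r"
      proof -
        have "cmean (\<lambda>z. 1 / (\<eta> * C\<^sup>2) * (norm (f n (\<psi> z)))\<^sup>2) r = 1 / (\<eta> * C\<^sup>2) * cmean (\<lambda>z. (norm (f n (\<psi> z)))\<^sup>2) r"
          by (intro cmean_cmult continuous_intros cf r)
        moreover have "continuous_on (sphere 0 r) (\<lambda>z. 1 / (\<eta> * C\<^sup>2) * (norm (f n (\<psi> z)))\<^sup>2)"
          by (intro continuous_intros cf)
        ultimately show ?thesis by (subst cmean_add) (use r in auto)
      qed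
      also have "cmean (\<lambda>z. (norm (f n (\<psi> z)))\<^sup>2) r \<le> 18 / (1 - norm (\<psi> 0)) * S n"
        unfolding S_def by (rule littlewood_subordination[OF \<psi> r f S(1)])
      hence "1 / (\<eta> * C\<^sup>2) * cmean (\<lambda>z. (norm (f n (\<psi> z)))\<^sup>2) r \<le> 1 / (\<eta> * C\<^sup>2) * (18 / (1 - norm (\<psi> 0)) * S n)"
        using \<eta> by (intro mult_left_mono) auto
      also have "\<dots> = K * S n" by (simp add: K_def)
      finally have le: "cmean \<kappa> r \<le> 2 * \<eta>" using elim by linarith
      have "cmean (\<lambda>z. norm (F z) powr p * \<kappa> z) r \<le> M * cmean \<kappa> r + e1"
        by (rule M(2)[rule_format, OF c\<kappa> r]) (use x1 C(2) p0 in \<open>auto simp: \<kappa>_def powr_le1\<close>)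
      also have "\<dots> \<le> 2 * e1" using mult_left_mono[OF le M(1)] \<eta>(2) by simp
      finally have "C powr p * cmean (\<lambda>z. norm (F z) powr p * \<kappa> z) r \<le> C powr p * (2 * e1)"
        by (intro mult_left_mono) auto
      also have "\<dots> = e" using C(2) by (simp add: e1_def)
      also have "C powr p * cmean (\<lambda>z. norm (F z) powr p * \<kappa> z) r = cmean (\<lambda>z. C powr p * (norm (F z) powr p * \<kappa> z)) r"
        by (intro cmean_cmult[symmetric] continuous_intros c\<kappa> r continuous_on_sphere_subset continuous_on_norm_powr_disc hp_leD(1)[OF F] p0)
      also have "\<dots> = cmean (\<lambda>z. norm (F z) powr p * norm (f n (\<psi> z)) powr p) r"
        using C(2) by (simp add: \<kappa>_def powr_divide mult_ac)
      finally show "cmean (\<lambda>z. norm (F z) powr p * norm (f n (\<psi> z)) powr p) r \<le> e" .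
    qed
  qed
qed

subsection \<open>Vanishing Carleson condition\<close>

lemma continuous_on_cmean_param:
  fixes f :: "'b::topological_space \<Rightarrow> complex \<Rightarrow> 'a::banach"
  assumes f: "continuous_on (S \<times> sphere 0 r) (\<lambda>(a, z). f a z)" and r: "0 \<le> r"
  shows "continuous_on S (\<lambda>a. cmean (f a) r)"
proof -
  have "continuous_on (S \<times> cbox 0 (2*pi)) (\<lambda>(a, t). f a (complex_of_real r * cis t))"
  proof -
    have "continuous_on (S \<times> cbox 0 (2*pi)) (\<lambda>x. case (fst x, complex_of_real r * cis (snd x)) of (a, z) \<Rightarrow> f a z)"
      by (rule continuous_on_compose2[OF f]) (use r in \<open>auto simp: norm_mult intro!: continuous_intros\<close>)
    thus ?thesis by (simp add: case_prod_unfold)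
  qed
  from integral_continuous_on_param[OF this]
  show ?thesis unfolding cmean_def by (intro continuous_intros) (simp add: cbox_interval)
qed

lemma cmean_swap:
  fixes f :: "complex \<Rightarrow> complex \<Rightarrow> 'a::banach"
  assumes f: "continuous_on (sphere 0 \<rho> \<times> sphere 0 r) (\<lambda>(a, z). f a z)" and r: "0 \<le> r" "0 \<le> \<rho>"
  shows "cmean (\<lambda>a. cmean (f a) r) \<rho> = cmean (\<lambda>z. cmean (\<lambda>a. f a z) \<rho>) r"
proof -
  have "continuous_on (cbox (0, 0) (2*pi, 2*pi)) (\<lambda>(s, t). f (complex_of_real \<rho> * cis s) (complex_of_real r * cis t))"
  proof -
    have "continuous_on (cbox (0, 0) (2*pi, 2*pi))
        (\<lambda>x. case (complex_of_real \<rho> * cis (fst x), complex_of_real r * cis (snd x)) of (a, z) \<Rightarrow> f a z)"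
      by (rule continuous_on_compose2[OF f]) (use r in \<open>auto simp: norm_mult intro!: continuous_intros\<close>)
    thus ?thesis by (simp add: case_prod_unfold)
  qed
  from integral_swap_continuous[OF this] show ?thesis
    unfolding cmean_def by (simp add: cbox_interval)
qed

lemma cmean_kap_param:
  assumes w: "norm w < 1" and \<rho>: "0 \<le> \<rho>" "\<rho> < 1"
  shows "cmean (\<lambda>a. kap a w) \<rho> = (1 - \<rho>\<^sup>2) / (1 - \<rho>\<^sup>2 * (norm w)\<^sup>2)"
proof -
  define g where "g a = (1 + cnj w * a) / (1 - cnj w * a)" for a
  have g: "g holomorphic_on ball 0 1"
    unfolding g_def using one_minus_cnj_mult_nonzero[of w] w by (intro holomorphic_intros) auto
  have cg: "continuous_on (sphere 0 \<rho>) g"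
    by (intro continuous_on_sphere_subset holomorphic_on_imp_continuous_on g \<rho>)
  have pos: "1 - \<rho>\<^sup>2 * (norm w)\<^sup>2 > 0"
  proof -
    have "(\<rho> * norm w)\<^sup>2 < 1" using w \<rho> mult_strict_mono[of \<rho> 1 "norm w" 1]
      by (subst power_less_one_iff) auto
    thus ?thesis by (simp add: power_mult_distrib)
  qed
  have "kap a w = (1 - \<rho>\<^sup>2) / (1 - \<rho>\<^sup>2 * (norm w)\<^sup>2) * Re (g a)" if "norm a = \<rho>" for a
  proof -
    have "Re (g a) = (1 - (norm w)\<^sup>2 * (norm a)\<^sup>2) / (norm (1 - cnj w * a))\<^sup>2"
      unfolding g_def by (rule kap_le_Re(2)) (use w \<rho> that in auto)
    thus ?thesis using pos that norm_one_minus_cnj_commute[of w a] by (simp add: kap_def mult.commute)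
  qed
  hence "cmean (\<lambda>a. kap a w) \<rho> = cmean (\<lambda>a. (1 - \<rho>\<^sup>2) / (1 - \<rho>\<^sup>2 * (norm w)\<^sup>2) * Re (g a)) \<rho>"
    by (intro cmean_cong \<rho>)
  also have "\<dots> = (1 - \<rho>\<^sup>2) / (1 - \<rho>\<^sup>2 * (norm w)\<^sup>2) * cmean (\<lambda>a. Re (g a)) \<rho>"
    by (intro cmean_cmult continuous_intros cg \<rho>)
  also have "cmean (\<lambda>a. Re (g a)) \<rho> = Re (g 0)"
    using cmean_bounded_linear[OF bounded_linear_Re cg \<rho>(1)] cmean_holomorphic[OF g \<rho>] by simp
  finally show ?thesis by (simp add: g_def)
qed

lemma ring_mass:
  assumes v: "continuous_on (sphere 0 r) v" and r: "0 \<le> r" and \<rho>: "0 \<le> \<rho>" "\<rho> < 1"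
    and \<psi>: "continuous_on (sphere 0 r) \<psi>" "\<And>z. norm z = r \<Longrightarrow> norm (\<psi> z) < 1"
    and k: "\<And>a. norm a = \<rho> \<Longrightarrow> cmean (\<lambda>z. v z * kap a (\<psi> z)) r \<le> k"
  shows "cmean (\<lambda>z. v z * ((1 - \<rho>\<^sup>2) / (1 - \<rho>\<^sup>2 * (norm (\<psi> z))\<^sup>2))) r \<le> k"
proof -
  have cont: "continuous_on (sphere 0 \<rho> \<times> sphere 0 r) (\<lambda>(a, z). v z * kap a (\<psi> z))"
    unfolding case_prod_unfold kap_def
    by (intro continuous_intros continuous_on_compose2[OF v] continuous_on_compose2[OF \<psi>(1)])
       (use one_minus_cnj_mult_nonzero \<psi>(2) \<rho> in auto)
  have "cmean (\<lambda>z. v z * ((1 - \<rho>\<^sup>2) / (1 - \<rho>\<^sup>2 * (norm (\<psi> z))\<^sup>2))) r = cmean (\<lambda>z. cmean (\<lambda>a. v z * kap a (\<psi> z)) \<rho>) r"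
  proof (rule cmean_cong[OF _ r])
    fix z :: complex assume z: "norm z = r"
    have "continuous_on (sphere 0 \<rho>) (\<lambda>a. kap a (\<psi> z))"
      unfolding kap_def by (intro continuous_intros) (use one_minus_cnj_mult_nonzero \<psi>(2)[OF z] \<rho> in auto)
    thus "v z * ((1 - \<rho>\<^sup>2) / (1 - \<rho>\<^sup>2 * (norm (\<psi> z))\<^sup>2)) = cmean (\<lambda>a. v z * kap a (\<psi> z)) \<rho>"
      using cmean_kap_param[OF \<psi>(2)[OF z] \<rho>] \<rho> by (simp add: cmean_cmult)
  qed
  also have "\<dots> = cmean (\<lambda>a. cmean (\<lambda>z. v z * kap a (\<psi> z)) r) \<rho>"
    by (rule cmean_swap[OF cont r \<rho>(1), symmetric])
  also have "\<dots> \<le> k"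
    by (rule cmean_le_const) (use continuous_on_cmean_param[OF cont r] k \<rho> in auto)
  finally show ?thesis .
qed

definition cutoff :: "real \<Rightarrow> complex \<Rightarrow> real" where
  "cutoff \<rho> w = max 0 (min 1 (2 * (norm w - \<rho>) / (1 - \<rho>)))"

lemma cutoff_bounds: "0 \<le> cutoff \<rho> w" "cutoff \<rho> w \<le> 1"
  by (auto simp: cutoff_def)

lemma cutoff_eq_0: "\<rho> < 1 \<Longrightarrow> norm w \<le> \<rho> \<Longrightarrow> cutoff \<rho> w = 0"
  using divide_nonpos_pos[of "2 * (norm w - \<rho>)" "1 - \<rho>"] by (simp add: cutoff_def)

lemma cutoff_eq_1: "\<rho> < 1 \<Longrightarrow> (1 + \<rho>) / 2 \<le> norm w \<Longrightarrow> cutoff \<rho> w = 1"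
  by (auto simp: cutoff_def field_simps max_def min_def)

lemma continuous_on_cutoff: "\<rho> < 1 \<Longrightarrow> continuous_on S \<psi> \<Longrightarrow> continuous_on S (\<lambda>z. cutoff \<rho> (\<psi> z))"
  unfolding cutoff_def by (intro continuous_intros) auto

lemma carleson_vanishing:
  assumes p: "p > 0" and u: "hp_le p u Bu"
    and \<psi>: "\<psi> holomorphic_on ball 0 1" "\<psi> ` ball 0 1 \<subseteq> ball 0 1"
    and van: "\<And>e. e > 0 \<Longrightarrow> \<exists>R<1. \<forall>a. R \<le> norm a \<longrightarrow> norm a < 1 \<longrightarrow>
         (\<forall>r. 0 \<le> r \<longrightarrow> r < 1 \<longrightarrow> cmean (\<lambda>z. norm (u z) powr p * kap a (\<psi> z)) r \<le> e)"
    and F: "\<And>n. hp_le p (F n) B" and lim: "\<And>s. s < 1 \<Longrightarrow> uniform_limit (cball 0 s) F (\<lambda>_. 0) sequentially"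
    and e: "e > 0"
  shows "eventually (\<lambda>n. \<forall>r. 0 \<le> r \<longrightarrow> r < 1 \<longrightarrow> cmean (\<lambda>z. norm (u z) powr p * norm (F n (\<psi> z)) powr p) r \<le> e) sequentially"
proof -
  have B0: "B \<ge> 0" "Bu \<ge> 0" using hp_le_nonneg F u p by blast+
  have n\<psi>: "norm (\<psi> z) < 1" if "norm z < 1" for z using \<psi>(2) that by (auto simp: image_subset_iff)
  define v where "v z = norm (u z) powr p" for z
  have v0: "v z \<ge> 0" for z by (simp add: v_def)
  have cv: "continuous_on (sphere 0 r) v" if "r < 1" for r
    unfolding v_def by (intro continuous_on_sphere_subset continuous_on_norm_powr_disc hp_leD(1)[OF u] p that)
  have c\<psi>: "continuous_on (sphere 0 r) \<psi>" if "r < 1" for r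
    by (intro continuous_on_sphere_subset holomorphic_on_imp_continuous_on \<psi> that)
  have ck: "continuous_on (sphere 0 r) (\<lambda>z. kap a (\<psi> z))" if "r < 1" "norm a < 1" for r a
    by (intro kap_continuous c\<psi>) (use that n\<psi> in auto)
  define d where "d = e / (9 * B + Bu + 1)"
  have d: "d > 0" "d * (9 * B + Bu) \<le> e" using e B0 by (auto simp: d_def field_simps)
  obtain R0 where R0: "R0 < 1" "\<And>a r. R0 \<le> norm a \<Longrightarrow> norm a < 1 \<Longrightarrow> 0 \<le> r \<Longrightarrow> r < 1 \<Longrightarrow> cmean (\<lambda>z. v z * kap a (\<psi> z)) r \<le> d"
    using van[OF d(1)] unfolding v_def by blast
  define R where "R = max R0 0"
  have R: "0 \<le> R" "R < 1" "\<And>a r. R \<le> norm a \<Longrightarrow> norm a < 1 \<Longrightarrow> 0 \<le> r \<Longrightarrow> r < 1 \<Longrightarrow> cmean (\<lambda>z. v z * kap a (\<psi> z)) r \<le> d"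
    using R0 by (auto simp: R_def)
  define k where "k = d * (1 - R) / 4"
  have k: "k > 0" using d R by (simp add: k_def)
  obtain \<rho>0 where \<rho>0: "\<rho>0 < 1" "\<And>a r. \<rho>0 \<le> norm a \<Longrightarrow> norm a < 1 \<Longrightarrow> 0 \<le> r \<Longrightarrow> r < 1 \<Longrightarrow> cmean (\<lambda>z. v z * kap a (\<psi> z)) r \<le> k"
    using van[OF k] unfolding v_def by blast
  define \<rho> where "\<rho> = max \<rho>0 (1/2)"
  have \<rho>: "0 < \<rho>" "\<rho> < 1" "\<And>a r. norm a = \<rho> \<Longrightarrow> 0 \<le> r \<Longrightarrow> r < 1 \<Longrightarrow> cmean (\<lambda>z. v z * kap a (\<psi> z)) r \<le> k"
    using \<rho>0 by (auto simp: \<rho>_def)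
  define w where "w z = v z * cutoff \<rho> (\<psi> z)" for z
  have w0: "w z \<ge> 0" for z unfolding w_def using v0 cutoff_bounds by simp
  have wv: "w z \<le> v z" for z unfolding w_def using v0 cutoff_bounds by (simp add: mult_left_le)
  have cw: "continuous_on (sphere 0 r) w" if "r < 1" for r
    unfolding w_def by (intro continuous_intros cv continuous_on_cutoff c\<psi> \<rho> that)
  have mass: "cmean w r \<le> 2 * k" if r: "0 \<le> r" "r < 1" for r
  proof -
    have pos: "1 - \<rho>\<^sup>2 * (norm (\<psi> z))\<^sup>2 > 0" if "norm z = r" for z
    proof -
      have "(\<rho> * norm (\<psi> z))\<^sup>2 < 1" using n\<psi>[of z] that r \<rho> mult_strict_mono[of \<rho> 1 "norm (\<psi> z)" 1]
        by (subst power_less_one_iff) auto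
      thus ?thesis by (simp add: power_mult_distrib)
    qed
    have c1: "continuous_on (sphere 0 r) (\<lambda>z. v z * ((1 - \<rho>\<^sup>2) / (1 - \<rho>\<^sup>2 * (norm (\<psi> z))\<^sup>2)))"
      by (intro continuous_intros cv c\<psi> r) (use pos in force)
    have "cmean w r \<le> cmean (\<lambda>z. 2 * (v z * ((1 - \<rho>\<^sup>2) / (1 - \<rho>\<^sup>2 * (norm (\<psi> z))\<^sup>2)))) r"
    proof (rule cmean_mono[OF cw[OF r(2)] _ r(1)])
      fix z :: complex assume z: "norm z = r"
      show "w z \<le> 2 * (v z * ((1 - \<rho>\<^sup>2) / (1 - \<rho>\<^sup>2 * (norm (\<psi> z))\<^sup>2)))"
      proof (cases "norm (\<psi> z) \<le> \<rho>")
        case True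
        have "\<rho>\<^sup>2 \<le> 1" using \<rho> by (simp add: power_le_one)
        hence "0 \<le> 2 * (v z * ((1 - \<rho>\<^sup>2) / (1 - \<rho>\<^sup>2 * (norm (\<psi> z))\<^sup>2)))"
          using v0[of z] pos[OF z] by (intro mult_nonneg_nonneg divide_nonneg_pos) auto
        thus ?thesis using True \<rho> by (simp add: w_def cutoff_eq_0)
      next
        case False
        have "\<rho>\<^sup>2 \<le> (norm (\<psi> z))\<^sup>2" using False \<rho> by (intro power_mono) auto
        hence "\<rho>\<^sup>2 * \<rho>\<^sup>2 \<le> \<rho>\<^sup>2 * (norm (\<psi> z))\<^sup>2" by (intro mult_left_mono) auto
        moreover have "0 \<le> (1 - \<rho>\<^sup>2)\<^sup>2" by simp
        hence "1 + \<rho>\<^sup>2 * \<rho>\<^sup>2 - 2 * \<rho>\<^sup>2 \<ge> 0" by (simp add: power2_eq_square algebra_simps)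
        ultimately have "1 - \<rho>\<^sup>2 * (norm (\<psi> z))\<^sup>2 \<le> 2 * (1 - \<rho>\<^sup>2)"
          using \<rho> power_le_one[of \<rho> 2] mult_nonneg_nonneg[of "1 - \<rho>\<^sup>2" "1 - \<rho>\<^sup>2"] by (simp add: algebra_simps)
        hence "1 \<le> 2 * ((1 - \<rho>\<^sup>2) / (1 - \<rho>\<^sup>2 * (norm (\<psi> z))\<^sup>2))" using pos[OF z] by (simp add: field_simps)
        hence "v z * 1 \<le> v z * (2 * ((1 - \<rho>\<^sup>2) / (1 - \<rho>\<^sup>2 * (norm (\<psi> z))\<^sup>2)))" by (intro mult_left_mono v0)
        hence "v z \<le> 2 * (v z * ((1 - \<rho>\<^sup>2) / (1 - \<rho>\<^sup>2 * (norm (\<psi> z))\<^sup>2)))"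
          by (simp only: mult.left_commute[of _ 2] mult_1_right)
        thus ?thesis using wv[of z] by (rule order_trans[rotated])
      qed
    qed (intro continuous_intros c1)
    also have "\<dots> = 2 * cmean (\<lambda>z. v z * ((1 - \<rho>\<^sup>2) / (1 - \<rho>\<^sup>2 * (norm (\<psi> z))\<^sup>2))) r"
      by (intro cmean_cmult c1 r)
    also have "cmean (\<lambda>z. v z * ((1 - \<rho>\<^sup>2) / (1 - \<rho>\<^sup>2 * (norm (\<psi> z))\<^sup>2))) r \<le> k"
      by (rule ring_mass[OF cv[OF r(2)] r(1) _ _ c\<psi>[OF r(2)]]) (use \<rho> r n\<psi> in auto)
    finally show ?thesis by simp
  qed
  have carl: "cmean (\<lambda>z. w z * kap a (\<psi> z)) r \<le> d" if a: "norm a < 1" and r: "0 \<le> r" "r < 1" for a r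
  proof (cases "R \<le> norm a")
    case True
    have "cmean (\<lambda>z. w z * kap a (\<psi> z)) r \<le> cmean (\<lambda>z. v z * kap a (\<psi> z)) r"
      by (intro cmean_mono continuous_intros cw cv ck r a mult_right_mono wv kap_nonneg) (use a in auto)
    also have "\<dots> \<le> d" by (rule R(3)[OF True a r])
    finally show ?thesis .
  next
    case False
    have le: "kap a x \<le> 2 / (1 - R)" if x: "norm x < 1" for x
    proof -
      have "1 - norm a \<le> norm (1 - cnj a * x)"
        using norm_one_minus_ge[of x "cnj a"] x by (simp add: mult.commute)
      hence "kap a x \<le> (1 - (norm a)\<^sup>2) / (1 - norm a)\<^sup>2"
        unfolding kap_def using a by (intro divide_left_mono power_mono mult_pos_pos) (auto simp: power_le_one)
      also have "1 - (norm a)\<^sup>2 = (1 - norm a) * (1 + norm a)" by (simp add: power2_eq_square algebra_simps)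
      also have "(1 - norm a) * (1 + norm a) / (1 - norm a)\<^sup>2 = (1 + norm a) / (1 - norm a)"
        using a by (simp add: power2_eq_square)
      also have "\<dots> \<le> 2 / (1 - R)" using a False R by (intro frac_le) auto
      finally show ?thesis .
    qed
    have "cmean (\<lambda>z. w z * kap a (\<psi> z)) r \<le> cmean (\<lambda>z. 2 / (1 - R) * w z) r"
    proof (rule cmean_mono)
      fix z :: complex assume "norm z = r"
      hence "w z * kap a (\<psi> z) \<le> w z * (2 / (1 - R))" using r n\<psi> by (intro mult_left_mono le w0) auto
      thus "w z * kap a (\<psi> z) \<le> 2 / (1 - R) * w z" by (simp add: mult.commute)
    qed (intro continuous_intros cw ck r a)+
    also have "\<dots> = 2 / (1 - R) * cmean w r" by (intro cmean_cmult cw r)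
    also have "\<dots> \<le> 2 / (1 - R) * (2 * k)" using R r by (intro mult_left_mono mass) auto
    also have "\<dots> = d" using R by (simp add: k_def field_simps)
    finally show ?thesis .
  qed
  define s where "s = (1 + \<rho>) / 2"
  have s: "s < 1" using \<rho> by (simp add: s_def)
  define t where "t = d powr (1 / p)"
  have t: "t > 0" "t powr p = d" using d p by (auto simp: t_def powr_powr)
  have "eventually (\<lambda>n. \<forall>x\<in>cball 0 s. dist (F n x) 0 < t) sequentially"
    using lim[OF s] t unfolding uniform_limit_iff by blast
  thus ?thesis
  proof eventually_elim
    case (elim n)
    obtain h where h: "h holomorphic_on ball 0 1"
      "\<And>z. norm z < 1 \<Longrightarrow> norm (F n z) powr p \<le> (norm (h z))\<^sup>2"
      "summable (\<lambda>k. (norm (taylor_coeff h k))\<^sup>2)" "(\<Sum>k. (norm (taylor_coeff h k))\<^sup>2) \<le> B"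
      using hp_majorant[OF F p] by metis
    show ?case
    proof (intro allI impI)
      fix r :: real assume r: "0 \<le> r" "r < 1"
      have cF: "continuous_on (sphere 0 r) (\<lambda>z. norm (F n (\<psi> z)) powr p)"
        by (intro continuous_on_sphere_subset continuous_on_norm_powr_disc r p
             holomorphic_on_compose_gen[OF \<psi>(1) hp_leD(1)[OF F], unfolded o_def] \<psi>)
      have ch: "continuous_on (sphere 0 r) (\<lambda>z. h (\<psi> z))"
        by (intro continuous_on_sphere_subset holomorphic_on_imp_continuous_on r
             holomorphic_on_compose_gen[OF \<psi>(1) h(1), unfolded o_def] \<psi>)
      have "cmean (\<lambda>z. v z * norm (F n (\<psi> z)) powr p) r \<le> cmean (\<lambda>z. d * v z + w z * (norm (h (\<psi> z)))\<^sup>2) r"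
      proof (rule cmean_mono)
        fix z :: complex assume z: "norm z = r"
        show "v z * norm (F n (\<psi> z)) powr p \<le> d * v z + w z * (norm (h (\<psi> z)))\<^sup>2"
        proof (cases "norm (\<psi> z) \<le> s")
          case True
          hence "norm (F n (\<psi> z)) powr p \<le> t powr p"
            using elim p t by (intro powr_mono2) (auto simp: less_imp_le)
          hence "v z * norm (F n (\<psi> z)) powr p \<le> v z * d" unfolding t by (intro mult_left_mono v0)
          moreover have "0 \<le> w z * (norm (h (\<psi> z)))\<^sup>2" using w0 by simp
          ultimately show ?thesis by (simp add: mult.commute)
        next
          case False
          hence "w z = v z" using \<rho> by (simp add: w_def s_def cutoff_eq_1)
          moreover have "v z * norm (F n (\<psi> z)) powr p \<le> v z * (norm (h (\<psi> z)))\<^sup>2"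
            using n\<psi>[of z] z r by (intro mult_left_mono v0 h(2)) auto
          moreover have "0 \<le> d * v z" using d v0 by simp
          ultimately show ?thesis by simp
        qed
      qed (intro continuous_intros cv cw cF ch r)+
      also have "\<dots> = d * cmean v r + cmean (\<lambda>z. w z * (norm (h (\<psi> z)))\<^sup>2) r"
      proof -
        have "cmean (\<lambda>z. d * v z) r = d * cmean v r" by (intro cmean_cmult cv r)
        moreover have "continuous_on (sphere 0 r) (\<lambda>z. d * v z)" "continuous_on (sphere 0 r) (\<lambda>z. w z * (norm (h (\<psi> z)))\<^sup>2)"
          by (intro continuous_intros cv cw ch r)+
        ultimately show ?thesis by (subst cmean_add) (use r in auto)
      qed
      also have "cmean (\<lambda>z. w z * (norm (h (\<psi> z)))\<^sup>2) r \<le> 9 * d * (\<Sum>k. (norm (taylor_coeff h k))\<^sup>2)"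
        by (rule carleson_circle[OF r cw[OF r(2)] w0 \<psi> carl h(1,3)]) (use r in auto)
      also have "\<dots> \<le> 9 * d * B" using h(4) d by (intro mult_left_mono) auto
      also have "d * cmean v r \<le> d * Bu"
        unfolding v_def using d hp_leD(2)[OF u r] by (intro mult_left_mono) auto
      also have "d * Bu + 9 * d * B \<le> e" using d(2) by (simp add: algebra_simps)
      finally show "cmean (\<lambda>z. norm (u z) powr p * norm (F n (\<psi> z)) powr p) r \<le> e"
        by (simp add: v_def)
    qed
  qed
qed

subsection \<open>The spaces $S^p$\<close>

lemma hardy_space_iff: "f \<in> hardy_space p \<longleftrightarrow> (\<exists>B. hp_le p f B)"
proof
  assume f: "f \<in> hardy_space p"
  then obtain M where M: "\<And>x. x \<in> hardy_mean p f ` {0..<1} \<Longrightarrow> x \<le> M"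
    unfolding hardy_space_def bdd_above_def by blast
  have "cmean (\<lambda>z. norm (f z) powr p) r \<le> M" if "0 \<le> r" "r < 1" for r
    using M[OF imageI, of r] that by (simp add: hardy_mean_eq_cmean)
  thus "\<exists>B. hp_le p f B" using f by (auto simp: hp_le_def hardy_space_def)
next
  assume "\<exists>B. hp_le p f B"
  then obtain B where B: "hp_le p f B" by blast
  have "bdd_above (hardy_mean p f ` {0..<1})"
    by (rule bdd_aboveI2[of _ _ B]) (use hp_leD(2)[OF B] in \<open>simp add: hardy_mean_eq_cmean\<close>)
  thus "f \<in> hardy_space p" using hp_leD(1)[OF B] by (simp add: hardy_space_def)
qed

lemma hardy_norm_le:
  assumes "hp_le p f B" "p > 0"
  shows "hardy_norm p f \<le> B powr (1 / p)"
proof -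
  have "0 \<le> hardy_mean p f 0" unfolding hardy_mean_eq_cmean
    by (intro cmean_nonneg continuous_on_sphere_subset continuous_on_norm_powr_disc hp_leD(1)[OF assms(1)] assms(2)) auto
  also have "\<dots> \<le> (SUP r\<in>{0..<1}. hardy_mean p f r)"
  proof (intro cSUP_upper)
    have "f \<in> hardy_space p" using assms(1) hardy_space_iff by blast
    thus "bdd_above (hardy_mean p f ` {0..<1})" by (simp add: hardy_space_def)
  qed simp
  finally have "0 \<le> (SUP r\<in>{0..<1}. hardy_mean p f r)" .
  moreover have "(SUP r\<in>{0..<1}. hardy_mean p f r) \<le> B"
    by (intro cSUP_least) (use assms in \<open>auto simp: hp_le_def hardy_mean_eq_cmean\<close>)
  ultimately show ?thesis unfolding hardy_norm_def using assms(2) by (intro powr_mono2) auto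
qed

lemma hp_le_hardy_norm:
  assumes "f \<in> hardy_space p" "p > 0"
  shows "hp_le p f (hardy_norm p f powr p)"
proof -
  obtain B where B: "hp_le p f B" using assms hardy_space_iff by blast
  have bdd: "bdd_above (hardy_mean p f ` {0..<1})" using assms(1) by (simp add: hardy_space_def)
  have nn: "0 \<le> hardy_mean p f r" if "0 \<le> r" "r < 1" for r unfolding hardy_mean_eq_cmean
    by (intro cmean_nonneg continuous_on_sphere_subset continuous_on_norm_powr_disc hp_leD(1)[OF B] assms(2) that) auto
  have up: "hardy_mean p f r \<le> (SUP r\<in>{0..<1}. hardy_mean p f r)" if "0 \<le> r" "r < 1" for r
    by (intro cSUP_upper bdd) (use that in auto)
  have "0 \<le> (SUP r\<in>{0..<1}. hardy_mean p f r)" using nn[of 0] up[of 0] by simp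
  hence "hardy_norm p f powr p = (SUP r\<in>{0..<1}. hardy_mean p f r)"
    using assms(2) by (simp add: hardy_norm_def powr_powr)
  thus ?thesis using up hp_leD(1)[OF B] by (simp add: hp_le_def hardy_mean_eq_cmean)
qed

lemma hardy_norm_nonneg [simp]: "0 \<le> hardy_norm p f"
  by (simp add: hardy_norm_def)

lemma hp_le_mono: "hp_le p f B \<Longrightarrow> B \<le> C \<Longrightarrow> hp_le p f C"
  unfolding hp_le_def by (meson order_trans)

lemma hp_le_cong:
  assumes "hp_le p f B" "\<And>z. norm z < 1 \<Longrightarrow> g z = f z"
  shows "hp_le p g B"
proof -
  have "g holomorphic_on ball 0 1"
    by (rule holomorphic_transform[OF hp_leD(1)[OF assms(1)]]) (use assms(2) in auto)
  moreover have "cmean (\<lambda>z. norm (g z) powr p) r = cmean (\<lambda>z. norm (f z) powr p) r" if "0 \<le> r" "r < 1" for r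
    by (rule cmean_cong) (use that assms(2) in auto)
  ultimately show ?thesis using hp_leD(2)[OF assms(1)] by (auto simp: hp_le_def)
qed

lemma hp_le_const_mean:
  assumes "f holomorphic_on ball 0 1" "p > 0" "\<And>z. norm z < 1 \<Longrightarrow> norm (f z) \<le> C"
  shows "hp_le p f (C powr p)"
  unfolding hp_le_def
  by (intro conjI assms(1) allI impI cmean_le_const continuous_on_sphere_subset continuous_on_norm_powr_disc powr_mono2)
     (use assms in auto)

lemma powr_add_le:
  assumes "a \<ge> (0::real)" "b \<ge> 0" "p > 0"
  shows "(a + b) powr p \<le> 2 powr p * (a powr p + b powr p)"
proof -
  have "(a + b) powr p \<le> (2 * max a b) powr p" using assms by (intro powr_mono2) auto
  also have "\<dots> = 2 powr p * max a b powr p" using assms by (simp add: powr_mult)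
  also have "max a b powr p \<le> a powr p + b powr p" by (auto simp: max_def)
  finally show ?thesis by simp
qed

lemma norm_add_powr_le:
  fixes a b :: "'a::real_normed_vector"
  assumes "p > 0"
  shows "norm (a + b) powr p \<le> 2 powr p * (norm a powr p + norm b powr p)"
proof -
  have "norm (a + b) powr p \<le> (norm a + norm b) powr p"
    using assms by (intro powr_mono2 norm_triangle_ineq) auto
  also have "\<dots> \<le> 2 powr p * (norm a powr p + norm b powr p)" by (rule powr_add_le) (use assms in auto)
  finally show ?thesis .
qed

lemma cmean_add_powr_le:
  fixes f g :: "complex \<Rightarrow> complex"
  assumes "continuous_on (sphere 0 r) f" "continuous_on (sphere 0 r) g" "p > 0" "0 \<le> r"
  shows "cmean (\<lambda>z. norm (f z + g z) powr p) r \<le>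
     2 powr p * (cmean (\<lambda>z. norm (f z) powr p) r + cmean (\<lambda>z. norm (g z) powr p) r)"
proof -
  note c = continuous_on_sphere_norm_powr[OF assms(1,3)] continuous_on_sphere_norm_powr[OF assms(2,3)]
  have "cmean (\<lambda>z. norm (f z + g z) powr p) r \<le> cmean (\<lambda>z. 2 powr p * (norm (f z) powr p + norm (g z) powr p)) r"
    by (intro cmean_mono norm_add_powr_le continuous_on_sphere_norm_powr continuous_intros c assms)
  also have "\<dots> = 2 powr p * cmean (\<lambda>z. norm (f z) powr p + norm (g z) powr p) r"
    by (intro cmean_cmult continuous_intros c assms)
  finally show ?thesis using cmean_add[OF c assms(4)] by simp
qed

lemma hp_le_add:
  assumes "hp_le p f B" "hp_le p g C" "p > 0"
  shows "hp_le p (\<lambda>z. f z + g z) (2 powr p * (B + C))"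
  unfolding hp_le_def
proof (intro conjI allI impI)
  show "(\<lambda>z. f z + g z) holomorphic_on ball 0 1" by (intro holomorphic_intros hp_leD(1)[OF assms(1)] hp_leD(1)[OF assms(2)])
  fix r :: real assume r: "0 \<le> r" "r < 1"
  have "cmean (\<lambda>z. norm (f z + g z) powr p) r \<le> 2 powr p * (cmean (\<lambda>z. norm (f z) powr p) r + cmean (\<lambda>z. norm (g z) powr p) r)"
    by (intro cmean_add_powr_le continuous_on_sphere_subset holomorphic_on_imp_continuous_on
         hp_leD(1)[OF assms(1)] hp_leD(1)[OF assms(2)] assms(3) r)
  also have "\<dots> \<le> 2 powr p * (B + C)" by (intro mult_left_mono add_mono hp_leD(2)[OF assms(1)] hp_leD(2)[OF assms(2)] r) auto
  finally show "cmean (\<lambda>z. norm (f z + g z) powr p) r \<le> 2 powr p * (B + C)" .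
qed

lemma hp_le_mult_bounded:
  assumes "hp_le p f B" "g holomorphic_on ball 0 1" "p > 0" "\<And>z. norm z < 1 \<Longrightarrow> norm (g z) \<le> 1"
  shows "hp_le p (\<lambda>z. f z * g z) B"
  unfolding hp_le_def
proof (intro conjI allI impI)
  show h: "(\<lambda>z. f z * g z) holomorphic_on ball 0 1" by (intro holomorphic_intros hp_leD(1)[OF assms(1)] assms(2))
  fix r :: real assume r: "0 \<le> r" "r < 1"
  have "cmean (\<lambda>z. norm (f z * g z) powr p) r \<le> cmean (\<lambda>z. norm (f z) powr p) r"
    by (intro cmean_mono continuous_on_sphere_subset continuous_on_norm_powr_disc h hp_leD(1)[OF assms(1)] assms(3) r powr_mono2)
       (use assms r in \<open>auto simp: norm_mult mult_left_le\<close>)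
  also have "\<dots> \<le> B" by (rule hp_leD(2)[OF assms(1) r])
  finally show "cmean (\<lambda>z. norm (f z * g z) powr p) r \<le> B" .
qed

lemma hp_le_uminus: "hp_le p f B \<Longrightarrow> hp_le p (\<lambda>z. - f z) B"
  unfolding hp_le_def by (auto intro!: holomorphic_intros)

lemma hp_le_cmult:
  assumes "hp_le p f B" "p > 0" shows "hp_le p (\<lambda>z. c * f z) (norm c powr p * B)"
  unfolding hp_le_def
proof (intro conjI allI impI)
  show "(\<lambda>z. c * f z) holomorphic_on ball 0 1" by (intro holomorphic_intros hp_leD(1)[OF assms(1)])
  fix r :: real assume r: "0 \<le> r" "r < 1"
  have "cmean (\<lambda>z. norm (c * f z) powr p) r = cmean (\<lambda>z. norm c powr p * norm (f z) powr p) r"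
    by (simp add: norm_mult powr_mult)
  also have "\<dots> = norm c powr p * cmean (\<lambda>z. norm (f z) powr p) r"
    by (intro cmean_cmult continuous_on_sphere_subset continuous_on_norm_powr_disc hp_leD(1)[OF assms(1)] assms(2) r)
  also have "\<dots> \<le> norm c powr p * B" by (intro mult_left_mono hp_leD(2)[OF assms(1) r]) auto
  finally show "cmean (\<lambda>z. norm (c * f z) powr p) r \<le> norm c powr p * B" .
qed

lemma cmean_powr_tendsto:
  fixes F :: "nat \<Rightarrow> complex \<Rightarrow> complex"
  assumes u: "uniform_limit (sphere 0 r) F g sequentially" and cF: "\<And>n. continuous_on (sphere 0 r) (F n)"
    and p: "p > 0" and r: "0 \<le> r"
  shows "(\<lambda>n. cmean (\<lambda>z. norm (F n z) powr p) r) \<longlonglongrightarrow> cmean (\<lambda>z. norm (g z) powr p) r"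
proof -
  have cg: "continuous_on (sphere 0 r) g"
    by (rule uniform_limit_theorem[OF _ u]) (auto intro: always_eventually cF)
  have "bounded (g ` sphere 0 r)" using cg compact_continuous_image compact_imp_bounded compact_sphere by blast
  then obtain C where C: "\<And>z. z \<in> sphere 0 r \<Longrightarrow> norm (g z) \<le> C" unfolding bounded_iff by blast
  have "uniformly_continuous_on {0..C+1} (\<lambda>x. x powr p)"
    by (intro compact_uniformly_continuous continuous_on_powr' continuous_intros) (use p in auto)
  moreover have "eventually (\<lambda>n. \<forall>z\<in>sphere 0 r. norm (F n z) \<in> {0..C+1}) sequentially"
    using uniform_limitD[OF u zero_less_one]
  proof eventually_elim
    case *: (elim n)
    show "\<forall>z\<in>sphere 0 r. norm (F n z) \<in> {0..C+1}"
    proof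
      fix z :: complex assume z: "z \<in> sphere 0 r"
      have "norm (F n z) \<le> norm (g z) + norm (F n z - g z)" by (rule norm_triangle_sub)
      thus "norm (F n z) \<in> {0..C+1}" using *[rule_format, OF z] C[OF z] by (simp add: dist_norm)
    qed
  qed
  ultimately have "uniform_limit (sphere 0 r) (\<lambda>n z. norm (F n z) powr p) (\<lambda>z. norm (g z) powr p) sequentially"
    using uniform_limit_compose_uniformly_continuous_on[OF uniform_limit_norm[OF u], of "{0..C+1}" "\<lambda>x. x powr p"] by auto
  thus ?thesis
    by (rule cmean_uniform_limit) (intro continuous_on_sphere_norm_powr cF p r)+
qed

lemma hp_le_limit:
  assumes F: "\<And>n. hp_le p (F n) B" and p: "p > 0" and g: "g holomorphic_on ball 0 1"
    and lim: "\<And>s. s < 1 \<Longrightarrow> uniform_limit (cball 0 s) F g sequentially"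
  shows "hp_le p g B"
  unfolding hp_le_def
proof (intro conjI g allI impI)
  fix r :: real assume r: "0 \<le> r" "r < 1"
  have "(\<lambda>n. cmean (\<lambda>z. norm (F n z) powr p) r) \<longlonglongrightarrow> cmean (\<lambda>z. norm (g z) powr p) r"
    by (intro cmean_powr_tendsto p r uniform_limit_on_subset[OF lim[OF r(2)]]
         continuous_on_sphere_subset holomorphic_on_imp_continuous_on hp_leD(1)[OF F]) auto
  thus "cmean (\<lambda>z. norm (g z) powr p) r \<le> B"
    by (rule LIMSEQ_le_const2) (use hp_leD(2)[OF F r] in auto)
qed

lemma deriv_uniform_limit_zero:
  assumes f: "\<And>n. f n holomorphic_on ball 0 1"
    and lim: "\<And>s. s < 1 \<Longrightarrow> uniform_limit (cball 0 s) f (\<lambda>_. 0) sequentially" and s: "s < 1"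
  shows "uniform_limit (cball 0 s) (\<lambda>n. deriv (f n)) (\<lambda>_. 0) sequentially"
  unfolding uniform_limit_iff
proof (intro allI impI)
  fix e :: real assume e: "e > 0"
  define d where "d = (1 - s) / 2"
  have d: "d > 0" "s + d < 1" using s by (auto simp: d_def field_simps)
  have "eventually (\<lambda>n. \<forall>z\<in>cball 0 (s + d). dist (f n z) 0 < e * d / 2) sequentially"
    using uniform_limitD[OF lim[OF d(2)], of "e * d / 2"] e d by simp
  thus "eventually (\<lambda>n. \<forall>z\<in>cball 0 s. dist (deriv (f n) z) 0 < e) sequentially"
  proof eventually_elim
    case (elim n)
    show ?case
    proof
      fix z :: complex assume z: "z \<in> cball 0 s"
      have sub: "w \<in> cball 0 (s + d)" if "w \<in> cball z d" for w
      proof -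
        have "norm w \<le> norm z + norm (w - z)" by (rule norm_triangle_sub)
        thus ?thesis using that z by (simp add: dist_norm norm_minus_commute)
      qed
      have sub1: "cball z d \<subseteq> ball 0 1" using sub d by fastforce
      have "norm ((deriv ^^ 1) (f n) z) \<le> fact 1 * (e * d / 2) / d ^ 1"
      proof (rule Cauchy_inequality)
        show "f n holomorphic_on ball z d" by (rule holomorphic_on_subset[OF f]) (use sub1 in auto)
        show "continuous_on (cball z d) (f n)"
          by (rule continuous_on_subset[OF holomorphic_on_imp_continuous_on[OF f] sub1])
        fix x assume "norm (z - x) = d"
        hence "x \<in> cball 0 (s + d)" by (intro sub) (simp add: dist_norm)
        thus "norm (f n x) \<le> e * d / 2" using elim by (auto simp: less_imp_le)
      qed (use d in auto)
      also have "\<dots> < e" using e d by simp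
      finally show "dist (deriv (f n) z) 0 < e" by simp
    qed
  qed
qed

lemma deriv_diff_disc:
  assumes "f holomorphic_on ball 0 1" "g holomorphic_on ball 0 1" "norm z < 1"
  shows "deriv (\<lambda>z. f z - g z) z = deriv f z - deriv g z"
  using assms by (intro DERIV_imp_deriv DERIV_diff holomorphic_derivI[OF assms(1) open_ball] holomorphic_derivI[OF assms(2) open_ball]) auto

lemma deriv_uniform_limit:
  assumes f: "\<And>n. f n holomorphic_on ball 0 1" and g: "g holomorphic_on ball 0 1"
    and lim: "\<And>s. s < 1 \<Longrightarrow> uniform_limit (cball 0 s) (\<lambda>n z. f n z - g z) (\<lambda>_. 0) sequentially" and s: "s < 1"
  shows "uniform_limit (cball 0 s) (\<lambda>n. deriv (f n)) (deriv g) sequentially"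
proof (rule uniform_limitI)
  fix e :: real assume e: "e > 0"
  have "uniform_limit (cball 0 s) (\<lambda>n. deriv (\<lambda>z. f n z - g z)) (\<lambda>_. 0) sequentially"
    by (rule deriv_uniform_limit_zero[OF _ lim s]) (intro holomorphic_intros f g)
  from uniform_limitD[OF this e]
  show "eventually (\<lambda>n. \<forall>z\<in>cball 0 s. dist (deriv (f n) z) (deriv g z) < e) sequentially"
  proof eventually_elim
    case (elim n)
    show ?case
    proof
      fix z :: complex assume z: "z \<in> cball 0 s"
      hence "dist (deriv (\<lambda>z. f n z - g z) z) 0 < e" using elim by blast
      thus "dist (deriv (f n) z) (deriv g z) < e"
        using deriv_diff_disc[OF f g, of z n] z s by (simp add: dist_norm)
    qed
  qed
qed

subsection \<open>The weighted composition operator\<close>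

definition restr_disc :: "(complex \<Rightarrow> complex) \<Rightarrow> complex \<Rightarrow> complex" where
  "restr_disc g z = (if z \<in> ball 0 1 then g z else 0)"

lemma deriv_cong_disc:
  assumes "\<And>z. norm z < 1 \<Longrightarrow> f z = g z" "norm z < 1"
  shows "deriv f z = deriv g z"
proof (rule deriv_cong_ev)
  have "eventually (\<lambda>w. w \<in> ball 0 1) (nhds z)"
    using assms(2) by (intro eventually_nhds_in_open) auto
  thus "eventually (\<lambda>w. f w = g w) (nhds z)" by eventually_elim (use assms(1) in auto)
qed simp

lemma restr_disc_in_sp:
  assumes g: "g holomorphic_on ball 0 1" and B: "hp_le p (deriv g) B"
  shows "restr_disc g \<in> sp_space p"
proof -
  have "restr_disc g holomorphic_on ball 0 1"
    by (rule holomorphic_transform[OF g]) (simp add: restr_disc_def)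
  moreover have "hp_le p (deriv (restr_disc g)) B"
    by (rule hp_le_cong[OF B]) (rule deriv_cong_disc, auto simp: restr_disc_def)
  hence "deriv (restr_disc g) \<in> hardy_space p" using hardy_space_iff by blast
  ultimately show ?thesis by (simp add: sp_space_def restr_disc_def)
qed

lemma sp_spaceD:
  assumes "f \<in> sp_space p" "p > 0"
  shows "f holomorphic_on ball 0 1" "\<And>z. \<not> norm z < 1 \<Longrightarrow> f z = 0"
    "hp_le p (deriv f) (hardy_norm p (deriv f) powr p)"
  using assms hp_le_hardy_norm by (auto simp: sp_space_def)

lemma sp_spaceI:
  assumes "f holomorphic_on ball 0 1" "\<And>z. \<not> norm z < 1 \<Longrightarrow> f z = 0" "hp_le p (deriv f) B"
  shows "f \<in> sp_space p"
  using assms hardy_space_iff[of "deriv f" p] by (auto simp: sp_space_def)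

lemma sp_norm_nonneg: "0 \<le> sp_norm p f"
  by (simp add: sp_norm_def)

lemma sp_normD:
  assumes f: "f \<in> sp_space p" and p: "p \<ge> 1" and B: "sp_norm p f \<le> B"
  shows "norm (f 0) \<le> B" "hp_le p (deriv f) (B powr p)"
    "norm z < 1 \<Longrightarrow> norm (f z) \<le> B + 1 + 18 * B powr p"
proof -
  have p0: "p > 0" using p by simp
  have h: "hardy_norm p (deriv f) \<le> B" "norm (f 0) \<le> B" using B hardy_norm_nonneg[of p "deriv f"] norm_ge_zero[of "f 0"] unfolding sp_norm_def by linarith+
  show "norm (f 0) \<le> B" by fact
  show hp: "hp_le p (deriv f) (B powr p)"
    by (rule hp_le_mono[OF sp_spaceD(3)[OF f p0]]) (use h p in \<open>auto intro!: powr_mono2\<close>)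
  show "norm (f z) \<le> B + 1 + 18 * B powr p" if "norm z < 1"
    using bounded_of_deriv_hp[OF sp_spaceD(1)[OF f p0] hp p that] h(2) by linarith
qed

locale weighted_composition =
  fixes p :: real and \<phi> \<psi> :: "complex \<Rightarrow> complex"
  assumes p1: "1 \<le> p"
    and phi: "\<phi> holomorphic_on ball 0 1"
    and psi: "\<psi> holomorphic_on ball 0 1" "\<psi> ` ball 0 1 \<subseteq> ball 0 1"
    and bdd: "bounded_op p (wcomp \<phi> \<psi>)"
begin

abbreviation W :: "(complex \<Rightarrow> complex) \<Rightarrow> complex \<Rightarrow> complex" where "W \<equiv> wcomp \<phi> \<psi>"

definition u :: "complex \<Rightarrow> complex" where "u z = \<phi> z * deriv \<psi> z"

lemma p0: "p > 0" using p1 by simp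

lemma npsi: "norm z < 1 \<Longrightarrow> norm (\<psi> z) < 1"
  using psi(2) by (auto simp: image_subset_iff)

lemma W_holomorphic:
  assumes "f holomorphic_on ball 0 1"
  shows "W f holomorphic_on ball 0 1"
proof (rule holomorphic_transform)
  show "(\<lambda>z. \<phi> z * f (\<psi> z)) holomorphic_on ball 0 1"
    by (intro holomorphic_intros phi holomorphic_on_compose_gen[OF psi(1) assms, unfolded o_def] psi(2))
qed (simp add: wcomp_def)

lemma deriv_W:
  assumes f: "f holomorphic_on ball 0 1" and z: "norm z < 1"
  shows "deriv (W f) z = deriv \<phi> z * f (\<psi> z) + u z * deriv f (\<psi> z)"
proof -
  have z': "z \<in> ball 0 1" "\<psi> z \<in> ball 0 1" using z npsi by auto
  have "deriv (W f) z = deriv (\<lambda>z. \<phi> z * f (\<psi> z)) z"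
    by (rule deriv_cong_disc) (use z in \<open>auto simp: wcomp_def\<close>)
  also have "\<dots> = deriv \<phi> z * f (\<psi> z) + u z * deriv f (\<psi> z)"
  proof (rule DERIV_imp_deriv)
    note d = holomorphic_derivI[OF phi open_ball z'(1)] holomorphic_derivI[OF psi(1) open_ball z'(1)]
    have "((\<lambda>z. f (\<psi> z)) has_field_derivative deriv f (\<psi> z) * deriv \<psi> z) (at z)"
      by (rule DERIV_chain2[OF holomorphic_derivI[OF f open_ball z'(2)] d(2)])
    from DERIV_mult[OF d(1) this]
    show "((\<lambda>z. \<phi> z * f (\<psi> z)) has_field_derivative deriv \<phi> z * f (\<psi> z) + u z * deriv f (\<psi> z)) (at z)"
      by (simp add: u_def algebra_simps)
  qed
  finally show ?thesis .
qed

lemma W_in_sp: "f \<in> sp_space p \<Longrightarrow> W f \<in> sp_space p"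
  using bdd by (simp add: bounded_op_def)

lemma W_bound: "\<exists>C>0. \<forall>f\<in>sp_space p. sp_norm p (W f) \<le> C * sp_norm p f"
proof -
  obtain C where C: "\<forall>f\<in>sp_space p. sp_norm p (W f) \<le> C * sp_norm p f"
    using bdd by (auto simp: bounded_op_def)
  have "sp_norm p (W f) \<le> (\<bar>C\<bar> + 1) * sp_norm p f" if "f \<in> sp_space p" for f
  proof -
    have "C * sp_norm p f \<le> (\<bar>C\<bar> + 1) * sp_norm p f" by (intro mult_right_mono sp_norm_nonneg) auto
    thus ?thesis using C that by force
  qed
  thus ?thesis by (intro exI[of _ "\<bar>C\<bar> + 1"]) auto
qed

lemma hp_le_deriv_W:
  assumes f: "f holomorphic_on ball 0 1" and B: "hp_le p (deriv f) B"
  shows "\<exists>C. hp_le p (deriv (W f)) C"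
proof -
  have "W (restr_disc f) \<in> sp_space p" by (rule W_in_sp[OF restr_disc_in_sp[OF f B]])
  moreover have "W (restr_disc f) = W f"
    using npsi by (auto simp: wcomp_def restr_disc_def)
  ultimately show ?thesis using hardy_space_iff by (auto simp: sp_space_def)
qed

lemma hp_deriv_phi: obtains B where "hp_le p (deriv \<phi>) B"
proof -
  have "hp_le p (deriv (\<lambda>z. 1)) (0 powr p)"
    by (rule hp_le_const_mean) (use p0 in auto)
  from hp_le_deriv_W[OF _ this] obtain B where B: "hp_le p (deriv (W (\<lambda>z. 1))) B" by auto
  have "hp_le p (deriv \<phi>) B"
    by (rule hp_le_cong[OF B]) (simp add: deriv_W)
  thus ?thesis by (rule that)
qed

lemma hp_u: obtains B where "hp_le p u B"
proof -
  have "hp_le p (deriv (\<lambda>z. z)) (1 powr p)"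
    by (rule hp_le_const_mean) (use p0 in auto)
  from hp_le_deriv_W[OF _ this] obtain B where B: "hp_le p (deriv (W (\<lambda>z. z))) B" by auto
  obtain C where C: "hp_le p (deriv \<phi>) C" by (rule hp_deriv_phi)
  have "hp_le p (\<lambda>z. - (deriv \<phi> z * \<psi> z)) C"
    by (intro hp_le_uminus hp_le_mult_bounded C psi p0) (use npsi in \<open>auto simp: less_imp_le\<close>)
  from hp_le_add[OF B this p0]
  have "hp_le p u (2 powr p * (B + C))"
    by (rule hp_le_cong) (simp add: deriv_W)
  thus ?thesis by (rule that)
qed

lemma first_part_tendsto:
  assumes d: "\<And>n. d n holomorphic_on ball 0 1" and B: "\<And>n. hp_le p (deriv (d n)) B"
    and C: "\<And>n z. norm z < 1 \<Longrightarrow> norm (d n z) \<le> C"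
    and lim: "\<And>s. s < 1 \<Longrightarrow> uniform_limit (cball 0 s) d (\<lambda>_. 0) sequentially" and e: "e > 0"
  shows "eventually (\<lambda>n. \<forall>r. 0 \<le> r \<longrightarrow> r < 1 \<longrightarrow> cmean (\<lambda>z. norm (deriv \<phi> z * d n (\<psi> z)) powr p) r \<le> e) sequentially"
proof -
  obtain B0 where B0: "hp_le p (deriv \<phi>) B0" by (rule hp_deriv_phi)
  have "eventually (\<lambda>n. \<forall>r. 0 \<le> r \<longrightarrow> r < 1 \<longrightarrow> cmean (\<lambda>z. norm (deriv \<phi> z) powr p * norm (d n (\<psi> z)) powr p) r \<le> e) sequentially"
  proof (rule weighted_sp_embedding_compact[OF p1 B0 psi d _ _ _ _ e])
    show "uniform_limit (sphere 0 (1/2)) d (\<lambda>_. 0) sequentially"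
      by (rule uniform_limit_on_subset[OF lim[of "1/2"]]) auto
    show "norm (d n z) \<le> \<bar>C\<bar> + 1" if "norm z < 1" for n z using C[OF that, of n] by linarith
    show "norm (taylor_coeff (d n) (Suc k)) \<le> (1 + B) / real (Suc k)" for n k by (rule taylor_coeff_deriv_bound[OF B p1])
  qed simp
  thus ?thesis by (simp add: norm_mult powr_mult)
qed

lemma continuous_deriv_parts:
  assumes d: "d holomorphic_on ball 0 1" and r: "r < 1"
  shows "continuous_on (sphere 0 r) (\<lambda>z. deriv \<phi> z * d (\<psi> z))" "continuous_on (sphere 0 r) (\<lambda>z. u z * deriv d (\<psi> z))"
  unfolding u_def
  by (intro continuous_on_sphere_subset r holomorphic_on_imp_continuous_on holomorphic_intros phi psi open_ball
        holomorphic_on_compose_gen[OF psi(1) d, unfolded o_def]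
        holomorphic_on_compose_gen[OF psi(1) holomorphic_deriv[OF d open_ball], unfolded o_def])+

lemma W_tendsto_zero:
  assumes van: "\<And>e. e > 0 \<Longrightarrow> \<exists>R<1. \<forall>a. R \<le> norm a \<longrightarrow> norm a < 1 \<longrightarrow>
         (\<forall>r. 0 \<le> r \<longrightarrow> r < 1 \<longrightarrow> cmean (\<lambda>z. norm (u z) powr p * kap a (\<psi> z)) r \<le> e)"
    and d: "\<And>n. d n holomorphic_on ball 0 1" and B: "\<And>n. hp_le p (deriv (d n)) B"
    and C: "\<And>n z. norm z < 1 \<Longrightarrow> norm (d n z) \<le> C"
    and lim: "\<And>s. s < 1 \<Longrightarrow> uniform_limit (cball 0 s) d (\<lambda>_. 0) sequentially"
  shows "(\<lambda>n. sp_norm p (W (d n))) \<longlonglongrightarrow> 0"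
proof -
  obtain Bu where Bu: "hp_le p u Bu" by (rule hp_u)
  have "(\<lambda>n. hardy_norm p (deriv (W (d n)))) \<longlonglongrightarrow> 0"
  proof (rule tendstoI)
    fix \<epsilon> :: real assume \<epsilon>: "\<epsilon> > 0"
    define e where "e = (\<epsilon> / 2) powr p / (2 * 2 powr p)"
    have e: "e > 0" using \<epsilon> by (simp add: e_def)
    have "eventually (\<lambda>n. \<forall>r. 0 \<le> r \<longrightarrow> r < 1 \<longrightarrow> cmean (\<lambda>z. norm (u z) powr p * norm (deriv (d n) (\<psi> z)) powr p) r \<le> e) sequentially"
      by (rule carleson_vanishing[OF p0 Bu psi van B deriv_uniform_limit_zero[OF d lim] e])
    moreover have "eventually (\<lambda>n. \<forall>r. 0 \<le> r \<longrightarrow> r < 1 \<longrightarrow> cmean (\<lambda>z. norm (deriv \<phi> z * d n (\<psi> z)) powr p) r \<le> e) sequentially"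
      by (rule first_part_tendsto[OF d B C lim e])
    ultimately show "eventually (\<lambda>n. dist (hardy_norm p (deriv (W (d n)))) 0 < \<epsilon>) sequentially"
    proof eventually_elim
      case (elim n)
      have "hp_le p (deriv (W (d n))) ((\<epsilon> / 2) powr p)"
        unfolding hp_le_def
      proof (intro conjI allI impI)
        show "deriv (W (d n)) holomorphic_on ball 0 1" by (intro holomorphic_deriv W_holomorphic d) auto
        fix r :: real assume r: "0 \<le> r" "r < 1"
        have "cmean (\<lambda>z. norm (deriv (W (d n)) z) powr p) r
            = cmean (\<lambda>z. norm (deriv \<phi> z * d n (\<psi> z) + u z * deriv (d n) (\<psi> z)) powr p) r"
          by (rule cmean_cong) (use r deriv_W[OF d] in auto)
        also have "\<dots> \<le> 2 powr p * (cmean (\<lambda>z. norm (deriv \<phi> z * d n (\<psi> z)) powr p) r + cmean (\<lambda>z. norm (u z * deriv (d n) (\<psi> z)) powr p) r)"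
          by (intro cmean_add_powr_le continuous_deriv_parts d r p0)
        also have "\<dots> \<le> 2 powr p * (e + e)"
          using elim r by (intro mult_left_mono add_mono) (auto simp: norm_mult powr_mult)
        also have "\<dots> = (\<epsilon> / 2) powr p" by (simp add: e_def)
        finally show "cmean (\<lambda>z. norm (deriv (W (d n)) z) powr p) r \<le> (\<epsilon> / 2) powr p" .
      qed
      from hardy_norm_le[OF this p0] have "hardy_norm p (deriv (W (d n))) \<le> \<epsilon> / 2"
        using \<epsilon> p0 by (simp add: powr_powr)
      thus ?case using \<epsilon> by simp
    qed
  qed
  moreover have "(\<lambda>n. norm (W (d n) 0)) \<longlonglongrightarrow> 0"
  proof -
    have "uniform_limit (cball 0 (norm (\<psi> 0))) d (\<lambda>_. 0) sequentially" by (rule lim) (use npsi[of 0] in auto)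
    hence "(\<lambda>n. d n (\<psi> 0)) \<longlonglongrightarrow> 0" by (rule tendsto_uniform_limitI) auto
    hence "(\<lambda>n. norm (\<phi> 0 * d n (\<psi> 0))) \<longlonglongrightarrow> norm (\<phi> 0 * 0)" by (intro tendsto_intros)
    thus ?thesis by (simp add: wcomp_def)
  qed
  ultimately have "(\<lambda>n. norm (W (d n) 0) + hardy_norm p (deriv (W (d n)))) \<longlonglongrightarrow> 0 + 0" by (intro tendsto_add)
  thus ?thesis by (simp add: sp_norm_def)
qed

lemma bounded_subsequence:
  assumes f: "\<And>n. f n \<in> sp_space p" and B: "\<And>n. sp_norm p (f n) \<le> B"
  obtains g r where "g \<in> sp_space p" "strict_mono (r :: nat \<Rightarrow> nat)" "hp_le p (deriv g) (B powr p)"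
    "\<And>s. s < 1 \<Longrightarrow> uniform_limit (cball 0 s) (\<lambda>n z. f (r n) z - g z) (\<lambda>_. 0) sequentially"
proof -
  define C where "C = B + 1 + 18 * B powr p"
  have hf: "f n holomorphic_on ball 0 1" for n by (rule sp_spaceD(1)[OF f p0])
  have C: "norm (f n z) \<le> C" if "norm z < 1" for n z
    unfolding C_def by (rule sp_normD(3)[OF f p1 B that])
  obtain g0 r where g0: "g0 holomorphic_on ball 0 1" "strict_mono (r :: nat \<Rightarrow> nat)"
    "\<And>x. x \<in> ball 0 1 \<Longrightarrow> (\<lambda>n. f (r n) x) \<longlonglongrightarrow> g0 x"
    "\<And>K. compact K \<Longrightarrow> K \<subseteq> ball 0 1 \<Longrightarrow> uniform_limit K (f \<circ> r) g0 sequentially"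
  proof (rule Montel[of "ball 0 1" "range f" f])
    show "\<exists>B. \<forall>h\<in>range f. \<forall>z\<in>K. norm (h z) \<le> B" if "compact K" "K \<subseteq> ball 0 1" for K
      by (intro exI[of _ C]) (use that C in auto)
  qed (use hf in auto)
  define g where "g = restr_disc g0"
  have gg: "g z = g0 z" if "norm z < 1" for z using that by (simp add: g_def restr_disc_def)
  have hg: "g holomorphic_on ball 0 1" by (rule holomorphic_transform[OF g0(1)]) (use gg in auto)
  have lim: "uniform_limit (cball 0 s) (\<lambda>n z. f (r n) z - g z) (\<lambda>_. 0) sequentially" if s: "s < 1" for s
  proof (rule uniform_limitI)
    fix e :: real assume e: "e > 0"
    have "uniform_limit (cball 0 s) (f \<circ> r) g0 sequentially" by (rule g0(4)) (use s in auto)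
    from uniform_limitD[OF this e]
    show "eventually (\<lambda>n. \<forall>z\<in>cball 0 s. dist (f (r n) z - g z) 0 < e) sequentially"
      by eventually_elim (use gg s in \<open>auto simp: dist_norm\<close>)
  qed
  have hpg: "hp_le p (deriv g) (B powr p)"
    by (rule hp_le_limit[OF sp_normD(2)[OF f p1 B] p0 holomorphic_deriv[OF hg open_ball] deriv_uniform_limit[OF hf hg lim]])
  have "g \<in> sp_space p" by (rule sp_spaceI[OF hg _ hpg]) (simp add: g_def restr_disc_def)
  from that[OF this g0(2) hpg lim] show ?thesis .
qed

lemma compact_if_vanishing:
  assumes van: "\<And>e. e > 0 \<Longrightarrow> \<exists>R<1. \<forall>a. R \<le> norm a \<longrightarrow> norm a < 1 \<longrightarrow>
         (\<forall>r. 0 \<le> r \<longrightarrow> r < 1 \<longrightarrow> cmean (\<lambda>z. norm (u z) powr p * kap a (\<psi> z)) r \<le> e)"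
  shows "compact_op p W"
  unfolding compact_op_def
proof (intro allI impI)
  fix f :: "nat \<Rightarrow> complex \<Rightarrow> complex"
  assume f: "\<forall>n. f n \<in> sp_space p" and "\<exists>B. \<forall>n. sp_norm p (f n) \<le> B"
  then obtain B where B: "\<And>n. sp_norm p (f n) \<le> B" by blast
  obtain g r where g: "g \<in> sp_space p" "strict_mono (r :: nat \<Rightarrow> nat)" "hp_le p (deriv g) (B powr p)"
    "\<And>s. s < 1 \<Longrightarrow> uniform_limit (cball 0 s) (\<lambda>n z. f (r n) z - g z) (\<lambda>_. 0) sequentially"
    by (rule bounded_subsequence[of f B]) (use f B in auto)
  define d where "d n z = f (r n) z - g z" for n z
  have hf: "f n holomorphic_on ball 0 1" for n using f sp_spaceD(1)[OF _ p0] by blast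
  have hg: "g holomorphic_on ball 0 1" by (rule sp_spaceD(1)[OF g(1) p0])
  have hd: "d n holomorphic_on ball 0 1" for n unfolding d_def by (intro holomorphic_intros hf hg)
  have "hp_le p (deriv (d n)) (2 powr p * (B powr p + B powr p))" for n
  proof -
    have "hp_le p (\<lambda>z. deriv (f (r n)) z + - deriv g z) (2 powr p * (B powr p + B powr p))"
      by (intro hp_le_add hp_le_uminus sp_normD(2)[OF _ p1 B] f[rule_format] g p0)
    thus ?thesis
    proof (rule hp_le_cong)
      fix z :: complex assume "norm z < 1"
      thus "deriv (d n) z = deriv (f (r n)) z + - deriv g z"
        using deriv_diff_disc[OF hf hg] by (simp add: d_def[abs_def])
    qed
  qed
  moreover have "norm (d n z) \<le> (B + 1 + 18 * B powr p) + (norm (g 0) + 1 + 18 * B powr p)" if "norm z < 1" for n z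
  proof -
    have "norm (d n z) \<le> norm (f (r n) z) + norm (g z)" unfolding d_def by (rule norm_triangle_ineq4)
    thus ?thesis
      using sp_normD(3)[OF f[rule_format] p1 B that, of "r n"] bounded_of_deriv_hp[OF hg g(3) p1 that] by linarith
  qed
  moreover have "uniform_limit (cball 0 s) d (\<lambda>_. 0) sequentially" if "s < 1" for s
    using g(4)[OF that] by (simp add: d_def[abs_def])
  ultimately have "(\<lambda>n. sp_norm p (W (d n))) \<longlonglongrightarrow> 0"
    by (intro W_tendsto_zero[OF van hd])
  moreover have "W (d n) = (\<lambda>z. W (f (r n)) z - W g z)" for n
    by (auto simp: wcomp_def d_def algebra_simps)
  ultimately show "\<exists>g\<in>sp_space p. \<exists>r. strict_mono r \<and> (\<lambda>n. sp_norm p (\<lambda>z. W (f (r n)) z - g z)) \<longlonglongrightarrow> 0"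
    using g W_in_sp by (intro bexI[of _ "W g"] exI[of _ r]) auto
qed

end

subsection \<open>Test functions\<close>

definition test_deriv :: "real \<Rightarrow> complex \<Rightarrow> complex \<Rightarrow> complex" where
  "test_deriv p a z = of_real ((1 - (norm a)\<^sup>2) powr (1 / p)) * exp (- of_real (2 / p) * Ln (1 - cnj a * z))"

lemma one_minus_cnj_not_nonpos:
  assumes "norm a < 1" "norm z < 1"
  shows "1 - cnj a * z \<notin> \<real>\<^sub>\<le>\<^sub>0"
proof -
  have "norm (cnj a * z) < 1" using mult_strict_mono[of "norm a" 1 "norm z" 1] assms by (simp add: norm_mult)
  hence "Re (cnj a * z) < 1" using complex_Re_le_cmod[of "cnj a * z"] by linarith
  thus ?thesis by (auto simp: complex_nonpos_Reals_iff)
qed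

lemma test_deriv_holomorphic: "norm a < 1 \<Longrightarrow> test_deriv p a holomorphic_on ball 0 1"
  unfolding test_deriv_def[abs_def]
  by (intro holomorphic_intros) (use one_minus_cnj_not_nonpos in auto)

lemma norm_test_deriv:
  assumes a: "norm a < 1" and z: "norm z < 1" and p: "p > 0"
  shows "norm (test_deriv p a z) powr p = kap a z"
proof -
  have nz: "1 - cnj a * z \<noteq> 0" using one_minus_cnj_mult_nonzero[of a z] a z by simp
  have pos: "1 - (norm a)\<^sup>2 > 0" using a by (simp add: power_less_one_iff)
  have "norm (test_deriv p a z) = (1 - (norm a)\<^sup>2) powr (1 / p) * exp (- (2 / p) * ln (norm (1 - cnj a * z)))"
    using nz by (simp add: test_deriv_def norm_mult)
  also have "exp (- (2 / p) * ln (norm (1 - cnj a * z))) = norm (1 - cnj a * z) powr (- (2 / p))"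
    using nz by (simp add: powr_def)
  finally have "norm (test_deriv p a z) powr p = (1 - (norm a)\<^sup>2) * norm (1 - cnj a * z) powr (- 2)"
    using pos p by (simp add: powr_mult powr_powr)
  also have "norm (1 - cnj a * z) powr (- 2) = 1 / (norm (1 - cnj a * z))\<^sup>2"
    using nz by (simp add: powr_minus_divide)
  finally show ?thesis by (simp add: kap_def)
qed

lemma hp_le_test_deriv:
  assumes a: "norm a < 1" and p: "p > 0"
  shows "hp_le p (test_deriv p a) 2"
  unfolding hp_le_def
proof (intro conjI allI impI test_deriv_holomorphic a)
  fix r :: real assume r: "0 \<le> r" "r < 1"
  have "cmean (\<lambda>z. norm (test_deriv p a z) powr p) r = cmean (\<lambda>z. kap a z) r"
    by (rule cmean_cong) (use norm_test_deriv a p r in auto)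
  also have "\<dots> \<le> 2" using cmean_kap_selfmap[of "\<lambda>z. z" a r] a r by (simp add: holomorphic_on_ident)
  finally show "cmean (\<lambda>z. norm (test_deriv p a z) powr p) r \<le> 2" .
qed

lemma test_fun_exists:
  assumes "norm a < 1"
  shows "\<exists>k. (\<forall>z. norm z < 1 \<longrightarrow> (k has_field_derivative test_deriv p a z) (at z)) \<and> k 0 = 0 \<and> (\<forall>z. \<not> norm z < 1 \<longrightarrow> k z = 0)"
proof -
  obtain k where k: "\<And>z. z \<in> ball 0 1 \<Longrightarrow> (k has_field_derivative test_deriv p a z) (at z)"
    using holomorphic_convex_primitive'[OF convex_ball open_ball test_deriv_holomorphic[OF assms, of p]]
    by (metis at_within_open open_ball)
  define k' where "k' = restr_disc (\<lambda>z. k z - k 0)"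
  have "(k' has_field_derivative test_deriv p a z) (at z)" if "norm z < 1" for z
  proof -
    have "((\<lambda>z. k z - k 0) has_field_derivative test_deriv p a z) (at z)"
      using k[of z] that by (auto intro!: derivative_eq_intros)
    thus ?thesis
      by (rule DERIV_cong_ev[THEN iffD1, rotated -1])
         (use that in \<open>auto simp: k'_def restr_disc_def intro!: eventually_mono[OF eventually_nhds_in_open[of "ball 0 1" z]]\<close>)
  qed
  thus ?thesis by (intro exI[of _ k']) (auto simp: k'_def restr_disc_def)
qed

definition test_fun :: "real \<Rightarrow> complex \<Rightarrow> complex \<Rightarrow> complex" where
  "test_fun p a = (SOME k. (\<forall>z. norm z < 1 \<longrightarrow> (k has_field_derivative test_deriv p a z) (at z)) \<and> k 0 = 0 \<and> (\<forall>z. \<not> norm z < 1 \<longrightarrow> k z = 0))"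

lemma test_fun:
  assumes "norm a < 1"
  shows "norm z < 1 \<Longrightarrow> (test_fun p a has_field_derivative test_deriv p a z) (at z)"
    "test_fun p a 0 = 0" "\<not> norm z < 1 \<Longrightarrow> test_fun p a z = 0"
  using someI_ex[OF test_fun_exists[OF assms, of p]] unfolding test_fun_def[symmetric] by auto

lemma test_fun_holomorphic:
  assumes "norm a < 1"
  shows "test_fun p a holomorphic_on ball 0 1"
  unfolding holomorphic_on_open[OF open_ball] using test_fun(1)[OF assms] by (metis dist_0_norm mem_ball)

lemma deriv_test_fun: "norm a < 1 \<Longrightarrow> norm z < 1 \<Longrightarrow> deriv (test_fun p a) z = test_deriv p a z"
  by (intro DERIV_imp_deriv test_fun)

lemma hp_le_deriv_test_fun:
  "norm a < 1 \<Longrightarrow> p > 0 \<Longrightarrow> hp_le p (deriv (test_fun p a)) 2"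
  by (rule hp_le_cong[OF hp_le_test_deriv]) (use deriv_test_fun in auto)

lemma test_bound:
  assumes a: "norm a < 1" and p: "p > 0" and z: "norm z < 1" and m: "m > 0"
    and far: "\<And>t. 0 \<le> t \<Longrightarrow> t \<le> 1 \<Longrightarrow> m \<le> norm (1 - cnj a * (of_real t * z))"
  shows "norm (test_deriv p a z) powr p \<le> (1 - (norm a)\<^sup>2) / m\<^sup>2"
    "norm (test_fun p a z) powr p \<le> (1 - (norm a)\<^sup>2) / m\<^sup>2"
proof -
  define D where "D = ((1 - (norm a)\<^sup>2) / m\<^sup>2) powr (1 / p)"
  have pos: "1 - (norm a)\<^sup>2 > 0" using a by (simp add: power_less_one_iff)
  have Dp: "D powr p = (1 - (norm a)\<^sup>2) / m\<^sup>2" using p pos m by (simp add: D_def powr_powr)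
  have tz: "norm (of_real t * z) < 1" if "0 \<le> t" "t \<le> 1" for t
    using that z mult_left_le_one_le[of "norm z" t] by (simp add: norm_mult)
  have bd: "norm (test_deriv p a (of_real t * z)) powr p \<le> (1 - (norm a)\<^sup>2) / m\<^sup>2" if t: "0 \<le> t" "t \<le> 1" for t
    unfolding norm_test_deriv[OF a tz[OF t] p] kap_def using far[OF t] pos m
    by (intro divide_left_mono power_mono mult_pos_pos zero_less_power) auto
  show "norm (test_deriv p a z) powr p \<le> (1 - (norm a)\<^sup>2) / m\<^sup>2" using bd[of 1] by simp
  have "norm (test_fun p a z - test_fun p a 0) \<le> D * norm (z - 0)"
  proof (rule field_differentiable_bound[where S = "closed_segment 0 z"])
    fix w assume "w \<in> closed_segment 0 z"
    then obtain t where t: "0 \<le> t" "t \<le> 1" "w = of_real t * z" by (auto simp: in_segment scaleR_conv_of_real)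
    show "(test_fun p a has_field_derivative test_deriv p a w) (at w within closed_segment 0 z)"
      using tz[OF t(1,2)] by (intro has_field_derivative_at_within[OF test_fun(1)[OF a]]) (simp add: t(3))
    have "norm (test_deriv p a w) = (norm (test_deriv p a w) powr p) powr (1 / p)" using p by (simp add: powr_powr)
    also have "\<dots> \<le> D" unfolding D_def using bd[OF t(1,2)] p by (intro powr_mono2) (auto simp: t(3))
    finally show "norm (test_deriv p a w) \<le> D" .
  qed auto
  hence "norm (test_fun p a z) \<le> D * norm z" using test_fun(2)[OF a, of p] by simp
  also have "\<dots> \<le> D" using z by (intro mult_left_le) (auto simp: D_def)
  finally have "norm (test_fun p a z) powr p \<le> D powr p" using p by (intro powr_mono2) auto
  thus "norm (test_fun p a z) powr p \<le> (1 - (norm a)\<^sup>2) / m\<^sup>2" unfolding Dp .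
qed

lemma test_fun_uniform_limit:
  assumes a: "\<And>n. norm (a n) < 1" and lim: "(\<lambda>n. norm (a n)) \<longlonglongrightarrow> 1" and p: "p > 0" and s: "s < 1"
  shows "uniform_limit (cball 0 s) (\<lambda>n. test_fun p (a n)) (\<lambda>_. 0) sequentially"
proof (rule uniform_limitI)
  fix e :: real assume e: "e > 0"
  define m where "m = 1 - s"
  have m: "m > 0" using s by (simp add: m_def)
  have "(\<lambda>n. (1 - (norm (a n))\<^sup>2) / m\<^sup>2) \<longlonglongrightarrow> (1 - 1\<^sup>2) / m\<^sup>2" using m by (intro tendsto_intros lim) auto
  hence "eventually (\<lambda>n. (1 - (norm (a n))\<^sup>2) / m\<^sup>2 < e powr p) sequentially"
    by (rule order_tendstoD(2)) (use e in simp)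
  thus "eventually (\<lambda>n. \<forall>z\<in>cball 0 s. dist (test_fun p (a n) z) 0 < e) sequentially"
  proof eventually_elim
    case (elim n)
    show ?case
    proof
      fix z :: complex assume z: "z \<in> cball 0 s"
      have "norm (test_fun p (a n) z) powr p \<le> (1 - (norm (a n))\<^sup>2) / m\<^sup>2"
      proof (rule test_bound(2)[OF a p _ m])
        fix t :: real assume t: "0 \<le> t" "t \<le> 1"
        have "norm (of_real t * z) \<le> norm z" using t by (simp add: norm_mult mult_left_le_one_le)
        thus "m \<le> norm (1 - cnj (a n) * (of_real t * z))"
          using norm_one_minus_ge[of "cnj (a n)" "of_real t * z"] a[of n] z by (simp add: m_def)
      qed (use z s in auto)
      hence "norm (test_fun p (a n) z) powr p < e powr p" using elim by simp
      hence "norm (test_fun p (a n) z) < e" using e p powr_mono2[of p e "norm (test_fun p (a n) z)"] by linarith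
      thus "dist (test_fun p (a n) z) 0 < e" by simp
    qed
  qed
qed

context weighted_composition
begin

lemma test_functions_not_vanishing:
  assumes nc: "\<not> compact_op p W"
  obtains \<xi> a c where "norm \<xi> = 1" "\<And>n. norm (a n) < 1" "a \<longlonglongrightarrow> \<xi>" "c > 0"
    "\<And>n::nat. \<exists>r. 0 \<le> r \<and> r < 1 \<and> c \<le> cmean (\<lambda>z. norm (deriv (W (test_fun p (a n))) z) powr p) r"
proof -
  obtain e where e: "e > 0" and ne: "\<And>R. R < 1 \<Longrightarrow> \<exists>a r. R \<le> norm a \<and> norm a < 1 \<and> 0 \<le> r \<and> r < 1 \<and>
        e < cmean (\<lambda>z. norm (u z) powr p * kap a (\<psi> z)) r"
  proof -
    have "\<not> (\<forall>e>0. \<exists>R<1. \<forall>a. R \<le> norm a \<longrightarrow> norm a < 1 \<longrightarrow>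
         (\<forall>r. 0 \<le> r \<longrightarrow> r < 1 \<longrightarrow> cmean (\<lambda>z. norm (u z) powr p * kap a (\<psi> z)) r \<le> e))"
      using nc compact_if_vanishing by blast
    thus ?thesis using that by (meson not_le)
  qed
  have "\<forall>n. \<exists>a r. 1 - 1 / real (n + 2) \<le> norm a \<and> norm a < 1 \<and> 0 \<le> r \<and> r < 1 \<and>
        e < cmean (\<lambda>z. norm (u z) powr p * kap a (\<psi> z)) r"
    by (intro allI ne) simp
  from choice[OF this] obtain b where "\<forall>n. \<exists>r. 1 - 1 / real (n + 2) \<le> norm (b n) \<and> norm (b n) < 1 \<and> 0 \<le> r \<and> r < 1 \<and>
        e < cmean (\<lambda>z. norm (u z) powr p * kap (b n) (\<psi> z)) r" ..
  from choice[OF this] obtain q where "\<forall>n. 1 - 1 / real (n + 2) \<le> norm (b n) \<and> norm (b n) < 1 \<and> 0 \<le> q n \<and> q n < 1 \<and>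
        e < cmean (\<lambda>z. norm (u z) powr p * kap (b n) (\<psi> z)) (q n)" ..
  hence b: "\<And>n. 1 - 1 / real (n + 2) \<le> norm (b n)" "\<And>n. norm (b n) < 1" "\<And>n. 0 \<le> q n" "\<And>n. q n < 1"
    "\<And>n. e < cmean (\<lambda>z. norm (u z) powr p * kap (b n) (\<psi> z)) (q n)" by blast+
  have blim: "(\<lambda>n. norm (b n)) \<longlonglongrightarrow> 1"
  proof (rule tendsto_sandwich[of "\<lambda>k. 1 - 1 / real (k + 2)" _ _ "\<lambda>_. 1"])
    show "(\<lambda>k. 1 - 1 / real (k + 2)) \<longlonglongrightarrow> 1" by real_asymp
  qed (use b(1,2) in \<open>auto intro!: always_eventually less_imp_le\<close>)
  have "\<forall>n. b n \<in> cball 0 1" using b(2) by (auto simp: less_imp_le)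
  then obtain \<xi> s where \<xi>: "strict_mono (s :: nat \<Rightarrow> nat)" "(b \<circ> s) \<longlonglongrightarrow> \<xi>"
    using compact_cball[of "0::complex" 1] unfolding compact_def by metis
  have n\<xi>: "norm \<xi> = 1"
    using LIMSEQ_unique[OF tendsto_norm[OF \<xi>(2)]] LIMSEQ_subseq_LIMSEQ[OF blim \<xi>(1)] by (simp add: o_def)
  define c where "c = e / (2 * 2 powr p)"
  have c: "c > 0" using e by (simp add: c_def)
  define d where "d n = test_fun p (b (s n))" for n
  have hd: "d n holomorphic_on ball 0 1" for n unfolding d_def by (intro test_fun_holomorphic b)
  have hp: "hp_le p (deriv (d n)) 2" for n unfolding d_def by (intro hp_le_deriv_test_fun b p0)
  have dlim: "uniform_limit (cball 0 t) d (\<lambda>_. 0) sequentially" if "t < 1" for t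
    unfolding d_def by (rule test_fun_uniform_limit[OF b(2) _ p0 that])
      (use LIMSEQ_subseq_LIMSEQ[OF blim \<xi>(1)] in \<open>simp add: o_def\<close>)
  have "norm (d n z) \<le> 37" if "norm z < 1" for n z
    using bounded_of_deriv_hp[OF hd hp p1 that, of n] test_fun(2)[OF b(2), of p "s n"] by (simp add: d_def)
  from first_part_tendsto[OF hd hp this dlim c]
  obtain N where N: "\<And>n r. n \<ge> N \<Longrightarrow> 0 \<le> r \<Longrightarrow> r < 1 \<Longrightarrow> cmean (\<lambda>z. norm (deriv \<phi> z * d n (\<psi> z)) powr p) r \<le> c"
    unfolding eventually_sequentially by blast
  show ?thesis
  proof (rule that[of \<xi> "\<lambda>n. b (s (n + N))" c])
    show "(\<lambda>n. b (s (n + N))) \<longlonglongrightarrow> \<xi>" using LIMSEQ_ignore_initial_segment[OF \<xi>(2), of N] by (simp add: o_def)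
    fix n
    define k where "k = n + N"
    define r where "r = q (s k)"
    have r: "0 \<le> r" "r < 1" using b by (auto simp: r_def)
    note cont = continuous_deriv_parts[OF hd r(2), of k]
    have cW: "continuous_on (sphere 0 r) (deriv (W (d k)))"
      by (intro continuous_on_sphere_subset holomorphic_on_imp_continuous_on holomorphic_deriv W_holomorphic hd r) auto
    have "e < cmean (\<lambda>z. norm (u z) powr p * kap (b (s k)) (\<psi> z)) r" unfolding r_def by (rule b)
    also have "\<dots> = cmean (\<lambda>z. norm (deriv (W (d k)) z + - (deriv \<phi> z * d k (\<psi> z))) powr p) r"
    proof (rule cmean_cong[OF _ r(1)])
      fix z :: complex assume "norm z = r"
      hence z: "norm z < 1" using r by simp
      have "deriv (W (d k)) z + - (deriv \<phi> z * d k (\<psi> z)) = u z * test_deriv p (b (s k)) (\<psi> z)"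
        unfolding deriv_W[OF hd z] using deriv_test_fun[OF b(2) npsi[OF z], of p "s k"] by (simp add: d_def)
      thus "norm (u z) powr p * kap (b (s k)) (\<psi> z) = norm (deriv (W (d k)) z + - (deriv \<phi> z * d k (\<psi> z))) powr p"
        using norm_test_deriv[OF b(2) npsi[OF z] p0] by (simp add: norm_mult powr_mult)
    qed
    also have "\<dots> \<le> 2 powr p * (cmean (\<lambda>z. norm (deriv (W (d k)) z) powr p) r + cmean (\<lambda>z. norm (- (deriv \<phi> z * d k (\<psi> z))) powr p) r)"
      by (intro cmean_add_powr_le cW continuous_intros cont p0 r)
    also have "cmean (\<lambda>z. norm (- (deriv \<phi> z * d k (\<psi> z))) powr p) r \<le> c"
      using N[of k r] r by (simp add: k_def)
    finally have "2 powr p * (2 * c) < 2 powr p * (cmean (\<lambda>z. norm (deriv (W (d k)) z) powr p) r + c)"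
      by (simp add: c_def)
    hence "c \<le> cmean (\<lambda>z. norm (deriv (W (d k)) z) powr p) r" by simp
    thus "\<exists>r. 0 \<le> r \<and> r < 1 \<and> c \<le> cmean (\<lambda>z. norm (deriv (W (test_fun p (b (s (n + N))))) z) powr p) r"
      using r unfolding d_def k_def by blast
  qed (use n\<xi> b c in auto)
qed

end

subsection \<open>Localisation near a boundary point\<close>

definition lin_bump :: "real \<Rightarrow> real \<Rightarrow> real" where
  "lin_bump h s = max 0 (min 1 (2 - s / h))"

text \<open>Supported in the ring $2 h' < |w| < 2 h$, and equal to 1 for $4 h' \le |w| \le h$.\<close>

definition ring_bump :: "real \<Rightarrow> real \<Rightarrow> complex \<Rightarrow> real" where
  "ring_bump h h' w = lin_bump h (norm w) * (1 - lin_bump (2 * h') (norm w))"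

lemma lin_bump_bounds: "0 \<le> lin_bump h s" "lin_bump h s \<le> 1"
  by (auto simp: lin_bump_def)

lemma lin_bump_eq_1: "h > 0 \<Longrightarrow> s \<le> h \<Longrightarrow> lin_bump h s = 1"
  by (simp add: lin_bump_def field_simps)

lemma lin_bump_eq_0: "h > 0 \<Longrightarrow> 2 * h \<le> s \<Longrightarrow> lin_bump h s = 0"
  by (simp add: lin_bump_def field_simps)

lemma continuous_on_lin_bump: "h > 0 \<Longrightarrow> continuous_on S f \<Longrightarrow> continuous_on S (\<lambda>z. lin_bump h (f z))"
  unfolding lin_bump_def by (intro continuous_intros) auto

lemma ring_bump_bounds: "0 \<le> ring_bump h h' w" "ring_bump h h' w \<le> 1"
  using lin_bump_bounds unfolding ring_bump_def by (auto intro!: mult_le_one)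

lemma continuous_on_ring_bump:
  "h > 0 \<Longrightarrow> h' > 0 \<Longrightarrow> continuous_on S f \<Longrightarrow> continuous_on S (\<lambda>z. ring_bump h h' (f z))"
  unfolding ring_bump_def by (intro continuous_intros continuous_on_lin_bump) auto

lemma one_minus_ring_bump_le:
  "1 - ring_bump h h' w \<le> (1 - lin_bump h (norm w)) + lin_bump (2 * h') (norm w)"
proof -
  have "lin_bump h (norm w) * lin_bump (2 * h') (norm w) \<le> lin_bump (2 * h') (norm w)"
    using lin_bump_bounds by (intro mult_left_le_one_le) auto
  thus ?thesis by (simp add: ring_bump_def algebra_simps)
qed

lemma ring_bump_disjoint:
  assumes "h' > 0" "k > 0" "k \<le> h'"
  shows "ring_bump h h' w = 0 \<or> ring_bump k k' w = 0"
proof (cases "norm w \<le> 2 * h'")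
  case True
  thus ?thesis using assms by (simp add: ring_bump_def lin_bump_eq_1)
next
  case False
  thus ?thesis using assms by (simp add: ring_bump_def lin_bump_eq_0)
qed

text \<open>Small sets $\{|\sigma - \xi| < h\}$ have small measure, since $\ln |\sigma - \xi|$ is harmonic.\<close>

lemma cmean_lin_bump_le:
  assumes \<sigma>: "\<sigma> holomorphic_on ball 0 1" "\<sigma> ` ball 0 1 \<subseteq> ball 0 1" and \<xi>: "norm \<xi> = 1"
    and h: "0 < h" "h < 1" and r: "0 \<le> r" "r < 1"
  shows "cmean (\<lambda>z. lin_bump h (norm (\<sigma> z - \<xi>))) r * ln (1 / h) \<le> ln (2 / (1 - norm (\<sigma> 0)))"
proof -
  have n: "norm (\<sigma> z) < 1" if "norm z < 1" for z using \<sigma>(2) that by (auto simp: image_subset_iff)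
  have eq: "norm (\<sigma> z - \<xi>) = norm (1 - cnj \<xi> * \<sigma> z)" for z
  proof -
    have "norm (1 - cnj \<xi> * \<sigma> z) = norm (\<xi> * (1 - cnj \<xi> * \<sigma> z))" using \<xi> by (simp add: norm_mult)
    also have "\<xi> * (1 - cnj \<xi> * \<sigma> z) = \<xi> - (\<xi> * cnj \<xi>) * \<sigma> z" by (simp add: algebra_simps)
    also have "\<xi> * cnj \<xi> = 1" using \<xi> by (simp add: complex_norm_square[symmetric])
    finally show ?thesis by (simp add: norm_minus_commute)
  qed
  have npos: "1 - cnj \<xi> * \<sigma> z \<notin> \<real>\<^sub>\<le>\<^sub>0" "1 - cnj \<xi> * \<sigma> z \<noteq> 0" if "norm z < 1" for z
  proof -
    have "Re (cnj \<xi> * \<sigma> z) < 1"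
      using complex_Re_le_cmod[of "cnj \<xi> * \<sigma> z"] n[OF that] \<xi> by (simp add: norm_mult)
    thus "1 - cnj \<xi> * \<sigma> z \<notin> \<real>\<^sub>\<le>\<^sub>0" by (auto simp: complex_nonpos_Reals_iff)
    thus "1 - cnj \<xi> * \<sigma> z \<noteq> 0" by auto
  qed
  define g where "g z = Ln (1 - cnj \<xi> * \<sigma> z)" for z
  have g: "g holomorphic_on ball 0 1" unfolding g_def by (intro holomorphic_intros \<sigma>) (use npos in auto)
  have Reg: "Re (g z) = ln (norm (\<sigma> z - \<xi>))" if "norm z < 1" for z
    unfolding g_def eq using npos(2)[OF that] by simp
  have cg: "continuous_on (sphere 0 r) g" by (intro continuous_on_sphere_subset holomorphic_on_imp_continuous_on g r)
  have cb: "continuous_on (sphere 0 r) (\<lambda>z. lin_bump h (norm (\<sigma> z - \<xi>)))"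
    by (intro continuous_on_lin_bump continuous_intros continuous_on_sphere_subset holomorphic_on_imp_continuous_on \<sigma> h r)
  have "cmean (\<lambda>z. lin_bump h (norm (\<sigma> z - \<xi>))) r * ln (1 / h) = cmean (\<lambda>z. ln (1 / h) * lin_bump h (norm (\<sigma> z - \<xi>))) r"
    by (subst cmean_cmult[OF cb r(1)]) simp
  also have "\<dots> \<le> cmean (\<lambda>z. ln 2 - Re (g z)) r"
  proof (rule cmean_mono)
    fix z :: complex assume "norm z = r"
    hence z: "norm z < 1" using r by simp
    define s where "s = norm (\<sigma> z - \<xi>)"
    have s: "0 < s" unfolding s_def eq using npos(2)[OF z] by simp
    have "s \<le> norm (\<sigma> z) + norm \<xi>" unfolding s_def by (rule norm_triangle_ineq4)
    hence s2: "s \<le> 2" using n[OF z] \<xi> by simp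
    have "ln (1 / h) * lin_bump h s \<le> ln 2 - ln s"
    proof (cases "2 * h \<le> s")
      case True
      thus ?thesis using h s s2 by (simp add: lin_bump_eq_0)
    next
      case False
      have "ln (1 / h) * lin_bump h s \<le> ln (1 / h)" using h lin_bump_bounds by (intro mult_left_le) (auto simp: ln_div)
      also have "\<dots> \<le> ln (2 / s)" using False h s by (subst ln_le_cancel_iff) (auto simp: field_simps)
      also have "\<dots> = ln 2 - ln s" using s by (simp add: ln_div)
      finally show ?thesis .
    qed
    thus "ln (1 / h) * lin_bump h (norm (\<sigma> z - \<xi>)) \<le> ln 2 - Re (g z)" by (simp add: Reg[OF z] s_def)
  qed (intro continuous_intros cb cg r)+
  also have "\<dots> = ln 2 - cmean (\<lambda>z. Re (g z)) r" by (subst cmean_diff) (auto intro!: continuous_intros cg r)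
  also have "cmean (\<lambda>z. Re (g z)) r = Re (g 0)"
    using cmean_bounded_linear[OF bounded_linear_Re cg r(1)] cmean_holomorphic[OF g r] by simp
  also have "Re (g 0) = ln (norm (\<sigma> 0 - \<xi>))" by (rule Reg) simp
  also have "ln 2 - ln (norm (\<sigma> 0 - \<xi>)) \<le> ln 2 - ln (1 - norm (\<sigma> 0))"
  proof -
    have "1 - norm (\<sigma> 0) \<le> norm (\<sigma> 0 - \<xi>)"
      using norm_triangle_ineq2[of \<xi> "\<sigma> 0"] \<xi> by (simp add: norm_minus_commute)
    thus ?thesis using n[of 0] by (intro diff_left_mono ln_mono) auto
  qed
  also have "\<dots> = ln (2 / (1 - norm (\<sigma> 0)))" using n[of 0] by (simp add: ln_div)
  finally show ?thesis .
qed

lemma mass_near_point_small: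
  assumes p: "p > 0" and V: "hp_le p V B" and \<sigma>: "\<sigma> holomorphic_on ball 0 1" "\<sigma> ` ball 0 1 \<subseteq> ball 0 1"
    and \<xi>: "norm \<xi> = 1" and e: "e > 0"
  shows "\<exists>h0>0. \<forall>h r. 0 < h \<longrightarrow> h \<le> h0 \<longrightarrow> 0 \<le> r \<longrightarrow> r < 1 \<longrightarrow>
     cmean (\<lambda>z. norm (V z) powr p * lin_bump h (norm (\<sigma> z - \<xi>))) r \<le> e"
proof -
  obtain M where M: "M \<ge> 0"
    "\<forall>\<kappa> r. continuous_on (sphere 0 r) \<kappa> \<longrightarrow> 0 \<le> r \<longrightarrow> r < 1 \<longrightarrow> (\<forall>z. norm z = r \<longrightarrow> 0 \<le> \<kappa> z \<and> \<kappa> z \<le> 1)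
       \<longrightarrow> cmean (\<lambda>z. norm (V z) powr p * \<kappa> z) r \<le> M * cmean \<kappa> r + e / 2"
    using hp_uniform_integrable[OF V p, of "e / 2"] e by auto
  define A where "A = ln (2 / (1 - norm (\<sigma> 0)))"
  have "norm (\<sigma> 0) < 1" using \<sigma>(2) by (auto simp: image_subset_iff)
  hence A: "A \<ge> 0" unfolding A_def by (intro ln_ge_zero) (auto simp: field_simps)
  define T where "T = 2 * M * A / e + 1"
  have T: "T \<ge> 1" using M A e by (simp add: T_def)
  show ?thesis
  proof (intro exI[of _ "exp (- T)"] conjI allI impI)
    fix h r :: real assume h: "0 < h" "h \<le> exp (- T)" and r: "0 \<le> r" "r < 1"
    have "exp (- T) < 1" using T by simp
    hence h1: "h < 1" using h by linarith
    have "ln h \<le> - T" using h ln_le_cancel_iff[of h "exp (- T)"] by simp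
    hence lnh: "T \<le> ln (1 / h)" using h by (simp add: ln_div)
    define b where "b = cmean (\<lambda>z. lin_bump h (norm (\<sigma> z - \<xi>))) r"
    have cb: "continuous_on (sphere 0 r) (\<lambda>z. lin_bump h (norm (\<sigma> z - \<xi>)))"
      by (intro continuous_on_lin_bump continuous_intros continuous_on_sphere_subset holomorphic_on_imp_continuous_on \<sigma> h r)
    have b0: "b \<ge> 0" unfolding b_def by (intro cmean_nonneg cb r lin_bump_bounds)
    have "b * T \<le> b * ln (1 / h)" by (intro mult_left_mono lnh b0)
    also have "\<dots> \<le> A" unfolding b_def A_def by (rule cmean_lin_bump_le[OF \<sigma> \<xi> h(1) h1 r])
    finally have "M * (b * T) \<le> M * A" by (intro mult_left_mono M)
    also have "M * A \<le> (e / 2) * T" using e by (simp add: T_def field_simps)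
    finally have "M * b \<le> e / 2" using T by (simp add: mult.assoc[symmetric])
    moreover have "cmean (\<lambda>z. norm (V z) powr p * lin_bump h (norm (\<sigma> z - \<xi>))) r \<le> M * b + e / 2"
      unfolding b_def by (rule M(2)[rule_format, OF cb r]) (use lin_bump_bounds in auto)
    ultimately show "cmean (\<lambda>z. norm (V z) powr p * lin_bump h (norm (\<sigma> z - \<xi>))) r \<le> e" by simp
  qed simp
qed

lemma mass_far_from_point_small:
  assumes p: "p > 0" and \<alpha>: "hp_le p \<alpha> B1" and \<beta>: "hp_le p \<beta> B2"
    and \<sigma>: "\<sigma> holomorphic_on ball 0 1" "\<sigma> ` ball 0 1 \<subseteq> ball 0 1"
    and \<xi>: "norm \<xi> = 1" and a: "\<And>n. norm (a n) < 1" "a \<longlonglongrightarrow> \<xi>" and h: "h > 0" and e: "e > 0"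
  shows "eventually (\<lambda>n. \<forall>r. 0 \<le> r \<longrightarrow> r < 1 \<longrightarrow>
     cmean (\<lambda>z. norm (\<alpha> z * test_fun p (a n) (\<sigma> z) + \<beta> z * test_deriv p (a n) (\<sigma> z)) powr p *
        (1 - lin_bump h (norm (\<sigma> z - \<xi>)))) r \<le> e) sequentially"
proof -
  have n: "norm (\<sigma> z) < 1" if "norm z < 1" for z using \<sigma>(2) that by (auto simp: image_subset_iff)
  define D where "D n = (1 - (norm (a n))\<^sup>2) / (h / 4)\<^sup>2" for n
  have D0: "D n \<ge> 0" for n using a(1)[of n] by (auto simp: D_def power_le_one less_imp_le)
  define B where "B = 2 powr p * (B1 + B2)"
  have "(\<lambda>n. D n * B) \<longlonglongrightarrow> (1 - (norm \<xi>)\<^sup>2) / (h / 4)\<^sup>2 * B" unfolding D_def using h by (intro tendsto_intros a) auto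
  hence "(\<lambda>n. D n * B) \<longlonglongrightarrow> 0" using \<xi> by simp
  hence "eventually (\<lambda>n. D n * B < e) sequentially" using e by (rule order_tendstoD(2))
  moreover have "eventually (\<lambda>n. dist (a n) \<xi> < h / 4) sequentially" using tendstoD[OF a(2), of "h / 4"] h by simp
  ultimately show ?thesis
  proof eventually_elim
    case (elim n)
    have far: "h / 4 \<le> norm (1 - cnj (a n) * (of_real t * w))" if w: "norm w < 1" "h \<le> norm (w - \<xi>)" and t: "0 \<le> t" "t \<le> 1" for w t
    proof -
      have tw: "norm (of_real t * w) \<le> 1" using w t by (simp add: norm_mult mult_le_one)
      have "norm (w - of_real t * w) \<le> 1 - t"
      proof -
        have "w - of_real t * w = of_real (1 - t) * w" by (simp add: algebra_simps)
        hence "norm (w - of_real t * w) = (1 - t) * norm w" using t by (metis abs_of_nonneg diff_ge_0_iff_ge norm_mult norm_of_real)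
        thus ?thesis using t w by (simp add: mult_left_le)
      qed
      moreover have "1 - t \<le> norm (of_real t * w - \<xi>)"
      proof -
        have "norm (of_real t * w) \<le> t" using w t by (simp add: norm_mult mult_left_le)
        thus ?thesis using norm_triangle_ineq2[of \<xi> "of_real t * w"] \<xi> by (simp add: norm_minus_commute)
      qed
      moreover have "norm (w - \<xi>) \<le> norm (w - of_real t * w) + norm (of_real t * w - \<xi>)"
        using norm_triangle_ineq[of "w - of_real t * w" "of_real t * w - \<xi>"] by simp
      ultimately have half: "h / 2 \<le> norm (of_real t * w - \<xi>)" using w by linarith
      have xx: "cnj \<xi> * \<xi> = 1" using \<xi> complex_norm_square[of \<xi>] by (simp add: mult.commute)
      have "cnj \<xi> * (\<xi> - of_real t * w) = (1 - cnj (a n) * (of_real t * w)) - cnj (\<xi> - a n) * (of_real t * w)"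
        using xx by (simp add: algebra_simps)
      hence "norm (cnj \<xi> * (\<xi> - of_real t * w)) \<le> norm (1 - cnj (a n) * (of_real t * w)) + norm (cnj (\<xi> - a n) * (of_real t * w))"
        by (simp only: norm_triangle_ineq4)
      hence "norm (of_real t * w - \<xi>) \<le> norm (1 - cnj (a n) * (of_real t * w)) + norm (\<xi> - a n) * norm (of_real t * w)"
        using \<xi> by (simp add: norm_mult norm_minus_commute del: complex_cnj_diff)
      moreover have "norm (\<xi> - a n) * norm (of_real t * w) \<le> h / 4"
        using mult_mono[of "norm (\<xi> - a n)" "h / 4" "norm (of_real t * w)" 1] tw elim(2) h
        by (simp add: dist_norm norm_minus_commute)
      ultimately show ?thesis using half by linarith
    qed
    show ?case
    proof (intro allI impI)
      fix r :: real assume r: "0 \<le> r" "r < 1"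
      have h4: "h / 4 > 0" using h by simp
      note hol = hp_leD(1)[OF \<alpha>] hp_leD(1)[OF \<beta>]
      have cV: "continuous_on (sphere 0 r) (\<lambda>z. \<alpha> z * test_fun p (a n) (\<sigma> z) + \<beta> z * test_deriv p (a n) (\<sigma> z))"
        by (intro continuous_on_sphere_subset holomorphic_on_imp_continuous_on r holomorphic_intros hol
           holomorphic_on_compose_gen[OF \<sigma>(1) test_fun_holomorphic[OF a(1)] \<sigma>(2), unfolded o_def]
           holomorphic_on_compose_gen[OF \<sigma>(1) test_deriv_holomorphic[OF a(1)] \<sigma>(2), unfolded o_def])
      have c\<alpha>: "continuous_on (sphere 0 r) (\<lambda>z. norm (\<alpha> z) powr p)" "continuous_on (sphere 0 r) (\<lambda>z. norm (\<beta> z) powr p)"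
        by (intro continuous_on_sphere_subset continuous_on_norm_powr_disc hol p r)+
      have "cmean (\<lambda>z. norm (\<alpha> z * test_fun p (a n) (\<sigma> z) + \<beta> z * test_deriv p (a n) (\<sigma> z)) powr p * (1 - lin_bump h (norm (\<sigma> z - \<xi>)))) r
         \<le> cmean (\<lambda>z. (D n * 2 powr p) * (norm (\<alpha> z) powr p + norm (\<beta> z) powr p)) r"
      proof (rule cmean_mono)
        fix z :: complex assume "norm z = r"
        hence z: "norm z < 1" using r by simp
        define X where "X = norm (\<alpha> z * test_fun p (a n) (\<sigma> z) + \<beta> z * test_deriv p (a n) (\<sigma> z)) powr p"
        show "X * (1 - lin_bump h (norm (\<sigma> z - \<xi>))) \<le> (D n * 2 powr p) * (norm (\<alpha> z) powr p + norm (\<beta> z) powr p)"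
        proof (cases "norm (\<sigma> z - \<xi>) \<le> h")
          case True
          thus ?thesis using D0[of n] h by (simp add: lin_bump_eq_1)
        next
          case False
          have tb: "norm (test_deriv p (a n) (\<sigma> z)) powr p \<le> D n" "norm (test_fun p (a n) (\<sigma> z)) powr p \<le> D n"
            unfolding D_def by (rule test_bound[OF a(1) p n[OF z] h4 far[OF n[OF z]]]; use False in simp)+
          have "X * (1 - lin_bump h (norm (\<sigma> z - \<xi>))) \<le> X"
            using lin_bump_bounds by (intro mult_left_le) (auto simp: X_def)
          also have "X \<le> 2 powr p * (norm (\<alpha> z * test_fun p (a n) (\<sigma> z)) powr p + norm (\<beta> z * test_deriv p (a n) (\<sigma> z)) powr p)"
            unfolding X_def by (rule norm_add_powr_le[OF p])
          also have "\<dots> \<le> 2 powr p * (norm (\<alpha> z) powr p * D n + norm (\<beta> z) powr p * D n)"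
            unfolding norm_mult powr_mult by (intro mult_left_mono add_mono tb) auto
          also have "\<dots> = (D n * 2 powr p) * (norm (\<alpha> z) powr p + norm (\<beta> z) powr p)" by (simp add: algebra_simps)
          finally show ?thesis .
        qed
      next
        show "continuous_on (sphere 0 r) (\<lambda>z. norm (\<alpha> z * test_fun p (a n) (\<sigma> z) + \<beta> z * test_deriv p (a n) (\<sigma> z)) powr p * (1 - lin_bump h (norm (\<sigma> z - \<xi>))))"
          by (intro continuous_intros continuous_on_sphere_norm_powr cV p continuous_on_lin_bump h
               continuous_on_sphere_subset[OF holomorphic_on_imp_continuous_on[OF \<sigma>(1)]] r)
      qed (intro continuous_intros c\<alpha> r)+
      also have "\<dots> = (D n * 2 powr p) * (cmean (\<lambda>z. norm (\<alpha> z) powr p) r + cmean (\<lambda>z. norm (\<beta> z) powr p) r)"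
        using c\<alpha> r by (simp add: cmean_cmult cmean_add continuous_on_add)
      also have "\<dots> \<le> (D n * 2 powr p) * (B1 + B2)"
        using D0[of n] by (intro mult_left_mono add_mono hp_leD(2)[OF \<alpha>] hp_leD(2)[OF \<beta>] r) auto
      also have "\<dots> \<le> e" using elim(1) by (simp add: B_def mult_ac)
      finally show "cmean (\<lambda>z. norm (\<alpha> z * test_fun p (a n) (\<sigma> z) + \<beta> z * test_deriv p (a n) (\<sigma> z)) powr p * (1 - lin_bump h (norm (\<sigma> z - \<xi>)))) r \<le> e" .
    qed
  qed
qed

lemma cmean_ring_bump_le:
  assumes V: "continuous_on (sphere 0 r) V" and p: "p > 0" and \<sigma>: "continuous_on (sphere 0 r) \<sigma>" and r: "0 \<le> r" and h: "h > 0" "h' > 0"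
    and far: "cmean (\<lambda>z. norm (V z) powr p * (1 - lin_bump h (norm (\<sigma> z - \<xi>)))) r \<le> e1"
    and near: "cmean (\<lambda>z. norm (V z) powr p * lin_bump (2 * h') (norm (\<sigma> z - \<xi>))) r \<le> e2"
  shows "cmean (\<lambda>z. norm (V z :: complex) powr p * (1 - ring_bump h h' (\<sigma> z - \<xi>))) r \<le> e1 + e2"
proof -
  note c = continuous_on_sphere_norm_powr[OF V p]
  have cb: "continuous_on (sphere 0 r) (\<lambda>z. lin_bump k (norm (\<sigma> z - \<xi>)))" if "k > 0" for k
    by (intro continuous_on_lin_bump continuous_intros \<sigma> that)
  have c1: "continuous_on (sphere 0 r) (\<lambda>z. norm (V z) powr p * (1 - lin_bump h (norm (\<sigma> z - \<xi>))))"
    "continuous_on (sphere 0 r) (\<lambda>z. norm (V z) powr p * lin_bump (2 * h') (norm (\<sigma> z - \<xi>)))"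
    by (intro continuous_intros c cb; use h in simp)+
  have "cmean (\<lambda>z. norm (V z) powr p * (1 - ring_bump h h' (\<sigma> z - \<xi>))) r
      \<le> cmean (\<lambda>z. norm (V z) powr p * (1 - lin_bump h (norm (\<sigma> z - \<xi>))) + norm (V z) powr p * lin_bump (2 * h') (norm (\<sigma> z - \<xi>))) r"
  proof (rule cmean_mono)
    show "continuous_on (sphere 0 r) (\<lambda>z. norm (V z) powr p * (1 - ring_bump h h' (\<sigma> z - \<xi>)))"
      by (intro continuous_intros c continuous_on_ring_bump \<sigma> h)
    fix z
    show "norm (V z) powr p * (1 - ring_bump h h' (\<sigma> z - \<xi>))
      \<le> norm (V z) powr p * (1 - lin_bump h (norm (\<sigma> z - \<xi>))) + norm (V z) powr p * lin_bump (2 * h') (norm (\<sigma> z - \<xi>))"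
      unfolding distrib_left[symmetric] by (intro mult_left_mono one_minus_ring_bump_le) auto
  qed (intro continuous_intros c1 r)+
  also have "\<dots> = cmean (\<lambda>z. norm (V z) powr p * (1 - lin_bump h (norm (\<sigma> z - \<xi>)))) r
      + cmean (\<lambda>z. norm (V z) powr p * lin_bump (2 * h') (norm (\<sigma> z - \<xi>))) r"
    by (rule cmean_add[OF c1 r])
  finally show ?thesis using far near by linarith
qed

subsection \<open>Almost disjoint sequences\<close>

lemma sum_powr_le:
  assumes A: "finite (A :: nat set)" and y: "\<And>n. n \<in> A \<Longrightarrow> y n \<ge> (0::real)" and p: "p > 0"
  shows "(\<Sum>n\<in>A. y n) powr p \<le> (\<Sum>n\<in>A. (2 ^ Suc n) powr p * y n powr p)"
proof (cases "A = {}")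
  case False
  define T where "T = Max ((\<lambda>n. 2 ^ Suc n * y n) ` A)"
  have "T \<in> (\<lambda>n. 2 ^ Suc n * y n) ` A" unfolding T_def using A False by (intro Max_in) auto
  then obtain m where m: "m \<in> A" "T = 2 ^ Suc m * y m" by blast
  have T0: "T \<ge> 0" unfolding m(2) using y[OF m(1)] by simp
  have "(\<Sum>n\<in>A. y n) \<le> (\<Sum>n\<in>A. (1/2) ^ Suc n * T)"
  proof (rule sum_mono)
    fix n assume n: "n \<in> A"
    have "2 ^ Suc n * y n \<le> T" unfolding T_def using A n by (intro Max_ge) auto
    hence "(1/2) ^ Suc n * (2 ^ Suc n * y n) \<le> (1/2) ^ Suc n * T" by (intro mult_left_mono) auto
    moreover have "(1/2) ^ Suc n * (2::real) ^ Suc n = 1" by (simp only: power_mult_distrib[symmetric]) simp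
    hence "(1/2) ^ Suc n * (2 ^ Suc n * y n) = y n" by (simp only: mult.assoc[symmetric] mult_1)
    ultimately show "y n \<le> (1/2) ^ Suc n * T" by (simp only:)
  qed
  also have "\<dots> = (\<Sum>n\<in>A. (1/2) ^ Suc n) * T" by (simp add: sum_distrib_right)
  also have "(\<Sum>n\<in>A. (1/2) ^ Suc n) \<le> (1::real)"
  proof -
    have "(\<Sum>n\<in>A. (1/2) ^ Suc n) \<le> (\<Sum>n. (1/2::real) ^ Suc n)"
      using power_half_series by (intro sum_le_suminf A) (auto simp: sums_iff)
    thus ?thesis using power_half_series by (simp add: sums_iff)
  qed
  hence "(\<Sum>n\<in>A. (1/2) ^ Suc n) * T \<le> 1 * T" using T0 by (intro mult_right_mono)
  finally have "(\<Sum>n\<in>A. y n) powr p \<le> T powr p" using p y by (intro powr_mono2 sum_nonneg) auto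
  also have "\<dots> = (2 ^ Suc m) powr p * y m powr p" unfolding m(2) using y[OF m(1)] by (simp only: powr_mult)
  also have "\<dots> \<le> (\<Sum>n\<in>A. (2 ^ Suc n) powr p * y n powr p)"
    using A m(1) by (intro member_le_sum[of m A "\<lambda>n. (2 ^ Suc n) powr p * y n powr p"]) auto
  finally show ?thesis .
qed auto

text \<open>At each point at most one bump is non-zero. The factors $2^{n+1}$ replace Minkowski's inequality
  for the remaining terms.\<close>

lemma disjoint_bumps_pointwise:
  fixes y :: "nat \<Rightarrow> complex" and \<kappa> :: "nat \<Rightarrow> real" and N :: nat
  assumes k: "\<And>n. 0 \<le> \<kappa> n \<and> \<kappa> n \<le> 1" and dis: "\<And>m n. m \<noteq> n \<Longrightarrow> \<kappa> m = 0 \<or> \<kappa> n = 0" and p: "p > 0"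
  defines "R \<equiv> \<Sum>n<N. (2 ^ Suc n) powr p * (norm (y n) powr p * (1 - \<kappa> n))"
  shows "norm (\<Sum>n<N. y n) powr p \<le> 2 powr p * ((\<Sum>n<N. norm (y n) powr p) + R)"
    and "(\<Sum>n<N. norm (y n) powr p) \<le> 2 powr p * norm (\<Sum>n<N. y n) powr p + (2 powr p + 1) * R"
proof -
  define q where "q n = (2 ^ Suc n) powr p" for n :: nat
  have q1: "q n \<ge> 1" for n unfolding q_def using p one_le_power[of "2::real" "Suc n"] by (intro ge_one_powr_ge_zero) auto
  have two1: "2 powr p \<ge> 1" using p by (intro ge_one_powr_ge_zero) auto
  have terms: "0 \<le> q n * (norm (y n) powr p * (1 - \<kappa> n))" for n
    using k[of n] q1[of n] by (intro mult_nonneg_nonneg) auto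
  have R0: "R \<ge> 0" unfolding R_def q_def[symmetric] by (intro sum_nonneg terms)
  have off: "(\<Sum>n\<in>A. q n * norm (y n) powr p) \<le> R" if A: "A \<subseteq> {..<N}" "\<And>n. n \<in> A \<Longrightarrow> \<kappa> n = 0" for A
  proof -
    have "(\<Sum>n\<in>A. q n * norm (y n) powr p) = (\<Sum>n\<in>A. q n * (norm (y n) powr p * (1 - \<kappa> n)))"
      by (intro sum.cong) (use A in auto)
    also have "\<dots> \<le> R" unfolding R_def q_def[symmetric] by (intro sum_mono2 A terms) auto
    finally show ?thesis .
  qed
  have offsum: "(\<Sum>n\<in>A. norm (y n)) powr p \<le> R" "(\<Sum>n\<in>A. norm (y n) powr p) \<le> R"
    if A: "A \<subseteq> {..<N}" "\<And>n. n \<in> A \<Longrightarrow> \<kappa> n = 0" for A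
  proof -
    have fA: "finite A" using A(1) finite_subset by blast
    have "(\<Sum>n\<in>A. norm (y n)) powr p \<le> (\<Sum>n\<in>A. q n * norm (y n) powr p)"
      unfolding q_def by (rule sum_powr_le[OF fA _ p]) auto
    thus "(\<Sum>n\<in>A. norm (y n)) powr p \<le> R" using off[OF A] by simp
    have "(\<Sum>n\<in>A. norm (y n) powr p) \<le> (\<Sum>n\<in>A. q n * norm (y n) powr p)"
      by (intro sum_mono) (use q1 mult_right_mono[OF q1, of "norm (y _) powr p"] in auto)
    thus "(\<Sum>n\<in>A. norm (y n) powr p) \<le> R" using off[OF A] by simp
  qed
  define S where "S = norm (\<Sum>n<N. y n) powr p"
  define P where "P = (\<Sum>n<N. norm (y n) powr p)"
  have P0: "P \<ge> 0" "S \<ge> 0" unfolding P_def S_def by (auto intro: sum_nonneg)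
  have "S \<le> 2 powr p * (P + R) \<and> P \<le> 2 powr p * S + (2 powr p + 1) * R"
  proof (cases "\<exists>m<N. \<kappa> m \<noteq> 0")
    case True
    then obtain m where m: "m < N" "\<kappa> m \<noteq> 0" by blast
    define A where "A = {..<N} - {m}"
    have A: "A \<subseteq> {..<N}" "\<And>n. n \<in> A \<Longrightarrow> \<kappa> n = 0" using dis[of m] m by (auto simp: A_def)
    have split: "(\<Sum>n<N. f n) = f m + (\<Sum>n\<in>A. f n)" for f :: "nat \<Rightarrow> 'z::comm_monoid_add"
      unfolding A_def using m by (intro sum.remove) auto
    have nA: "norm (\<Sum>n\<in>A. y n) powr p \<le> R"
      by (rule order_trans[OF powr_mono2 offsum(1)[OF A]]) (use p norm_sum[of y A] in auto)
    have yP: "norm (y m) powr p \<le> P" unfolding P_def using m by (intro member_le_sum[of m "{..<N}" "\<lambda>n. norm (y n) powr p"]) auto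
    have "S \<le> 2 powr p * (norm (y m) powr p + norm (\<Sum>n\<in>A. y n) powr p)"
      unfolding S_def split by (rule norm_add_powr_le[OF p])
    also have "\<dots> \<le> 2 powr p * (P + R)" by (intro mult_left_mono add_mono yP nA) auto
    finally have 1: "S \<le> 2 powr p * (P + R)" .
    have "y m = (\<Sum>n<N. y n) + - (\<Sum>n\<in>A. y n)" unfolding split by simp
    hence "norm (y m) powr p \<le> 2 powr p * (S + norm (- (\<Sum>n\<in>A. y n)) powr p)"
      unfolding S_def by (metis norm_add_powr_le[OF p])
    also have "\<dots> \<le> 2 powr p * (S + R)" using nA by (intro mult_left_mono add_mono) auto
    finally have "P \<le> 2 powr p * (S + R) + R"
      unfolding P_def split using offsum(2)[OF A] by simp
    with 1 show ?thesis by (simp add: algebra_simps)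
  next
    case False
    hence z: "\<And>n. n \<in> {..<N} \<Longrightarrow> \<kappa> n = 0" by auto
    have "S \<le> R" unfolding S_def
      by (rule order_trans[OF powr_mono2 offsum(1)[OF order_refl z]]) (use p norm_sum[of y "{..<N}"] in auto)
    moreover have "P \<le> R" unfolding P_def by (rule offsum(2)[OF order_refl z])
    moreover have "P + R \<le> 2 powr p * (P + R)" using mult_right_mono[OF two1, of "P + R"] P0 R0 by simp
    moreover have "1 * R \<le> (2 powr p + 1) * R" by (intro mult_right_mono R0) auto
    moreover have "0 \<le> 2 powr p * S" using P0 by simp
    ultimately show ?thesis using P0 R0 by (auto; linarith)
  qed
  thus "norm (\<Sum>n<N. y n) powr p \<le> 2 powr p * ((\<Sum>n<N. norm (y n) powr p) + R)"
    "(\<Sum>n<N. norm (y n) powr p) \<le> 2 powr p * norm (\<Sum>n<N. y n) powr p + (2 powr p + 1) * R"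
    unfolding S_def P_def by auto
qed

lemma almost_disjoint_means:
  fixes V :: "nat \<Rightarrow> complex \<Rightarrow> complex" and \<kappa> :: "nat \<Rightarrow> complex \<Rightarrow> real" and x :: "nat \<Rightarrow> complex"
  assumes r: "0 \<le> r" and p: "p > 0" and V: "\<And>n. continuous_on (sphere 0 r) (V n)"
    and \<kappa>: "\<And>n. continuous_on (sphere 0 r) (\<kappa> n)" "\<And>n z. 0 \<le> \<kappa> n z \<and> \<kappa> n z \<le> 1"
      "\<And>m n z. m \<noteq> n \<Longrightarrow> \<kappa> m z = 0 \<or> \<kappa> n z = 0"
    and small: "\<And>n. cmean (\<lambda>z. norm (V n z) powr p * (1 - \<kappa> n z)) r \<le> e / (2 ^ Suc n) powr p"
  shows "cmean (\<lambda>z. norm (\<Sum>n<N. x n * V n z) powr p) r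
        \<le> 2 powr p * (\<Sum>n<N. norm (x n) powr p * (cmean (\<lambda>z. norm (V n z) powr p) r + e))"
    and "(\<Sum>n<N. norm (x n) powr p * cmean (\<lambda>z. norm (V n z) powr p) r)
        \<le> 2 powr p * cmean (\<lambda>z. norm (\<Sum>n<N. x n * V n z) powr p) r + (2 powr p + 1) * (e * (\<Sum>n<N. norm (x n) powr p))"
proof -
  define R where "R z = (\<Sum>n<N. (2 ^ Suc n) powr p * (norm (x n * V n z) powr p * (1 - \<kappa> n z)))" for z
  define P where "P z = (\<Sum>n<N. norm (x n * V n z) powr p)" for z
  define S where "S z = norm (\<Sum>n<N. x n * V n z) powr p" for z
  have cV: "continuous_on (sphere 0 r) (\<lambda>z. norm (V n z) powr p)" for n by (rule continuous_on_sphere_norm_powr[OF V p])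
  have cV\<kappa>: "continuous_on (sphere 0 r) (\<lambda>z. norm (V n z) powr p * (1 - \<kappa> n z))" for n by (intro continuous_intros cV \<kappa>)
  have cxV: "continuous_on (sphere 0 r) (\<lambda>z. norm (x n * V n z) powr p)" for n
    by (intro continuous_on_sphere_norm_powr continuous_intros V p)
  have cR: "continuous_on (sphere 0 r) R" unfolding R_def by (intro continuous_intros cxV \<kappa>)
  have cP: "continuous_on (sphere 0 r) P" unfolding P_def by (intro continuous_intros cxV)
  have cS: "continuous_on (sphere 0 r) S" unfolding S_def by (intro continuous_on_sphere_norm_powr continuous_intros V p)
  have mP: "cmean P r = (\<Sum>n<N. norm (x n) powr p * cmean (\<lambda>z. norm (V n z) powr p) r)"
  proof -
    have "cmean P r = (\<Sum>n<N. cmean (\<lambda>z. norm (x n * V n z) powr p) r)"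
      unfolding P_def by (rule cmean_sum) (use r cxV in auto)
    also have "\<dots> = (\<Sum>n<N. cmean (\<lambda>z. norm (x n) powr p * norm (V n z) powr p) r)" by (simp add: norm_mult powr_mult)
    also have "\<dots> = (\<Sum>n<N. norm (x n) powr p * cmean (\<lambda>z. norm (V n z) powr p) r)"
      by (intro sum.cong refl cmean_cmult cV r)
    finally show ?thesis .
  qed
  have mR: "cmean R r \<le> e * (\<Sum>n<N. norm (x n) powr p)"
  proof -
    have "cmean R r = (\<Sum>n<N. cmean (\<lambda>z. ((2 ^ Suc n) powr p * norm (x n) powr p) * (norm (V n z) powr p * (1 - \<kappa> n z))) r)"
      unfolding R_def norm_mult powr_mult mult.assoc
      by (rule cmean_sum) (use r in \<open>auto intro!: continuous_intros cV \<kappa>\<close>)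
    also have "\<dots> = (\<Sum>n<N. ((2 ^ Suc n) powr p * norm (x n) powr p) * cmean (\<lambda>z. norm (V n z) powr p * (1 - \<kappa> n z)) r)"
      by (intro sum.cong refl cmean_cmult cV\<kappa> r)
    also have "\<dots> \<le> (\<Sum>n<N. ((2 ^ Suc n) powr p * norm (x n) powr p) * (e / (2 ^ Suc n) powr p))"
      by (intro sum_mono mult_left_mono small) auto
    also have "\<dots> = e * (\<Sum>n<N. norm (x n) powr p)" by (simp add: sum_distrib_left mult_ac)
    finally show ?thesis .
  qed
  note pw = disjoint_bumps_pointwise[where N = N and y = "\<lambda>n. x n * V n _" and \<kappa> = "\<lambda>n. \<kappa> n _", OF \<kappa>(2,3) p]
  have "cmean S r \<le> cmean (\<lambda>z. 2 powr p * (P z + R z)) r"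
    by (intro cmean_mono cS continuous_intros cP cR r) (unfold S_def P_def R_def, rule pw(1))
  also have "\<dots> = 2 powr p * (cmean P r + cmean R r)"
    using cP cR r by (simp add: cmean_cmult cmean_add continuous_on_add)
  also have "\<dots> \<le> 2 powr p * (cmean P r + e * (\<Sum>n<N. norm (x n) powr p))" using mR by (intro mult_left_mono add_left_mono) auto
  also have "\<dots> = 2 powr p * (\<Sum>n<N. norm (x n) powr p * (cmean (\<lambda>z. norm (V n z) powr p) r + e))"
    unfolding mP by (simp add: sum_distrib_left sum.distrib algebra_simps)
  finally show "cmean (\<lambda>z. norm (\<Sum>n<N. x n * V n z) powr p) r
        \<le> 2 powr p * (\<Sum>n<N. norm (x n) powr p * (cmean (\<lambda>z. norm (V n z) powr p) r + e))" unfolding S_def .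
  have "cmean P r \<le> cmean (\<lambda>z. 2 powr p * S z + (2 powr p + 1) * R z) r"
    by (intro cmean_mono cP continuous_intros cS cR r) (unfold S_def P_def R_def, rule pw(2))
  also have "\<dots> = 2 powr p * cmean S r + (2 powr p + 1) * cmean R r"
    using cS cR r by (simp add: cmean_cmult cmean_add continuous_on_mult_left)
  also have "\<dots> \<le> 2 powr p * cmean S r + (2 powr p + 1) * (e * (\<Sum>n<N. norm (x n) powr p))"
    using mR by (intro add_left_mono mult_left_mono) auto
  finally show "(\<Sum>n<N. norm (x n) powr p * cmean (\<lambda>z. norm (V n z) powr p) r)
        \<le> 2 powr p * cmean (\<lambda>z. norm (\<Sum>n<N. x n * V n z) powr p) r + (2 powr p + 1) * (e * (\<Sum>n<N. norm (x n) powr p))"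
    unfolding mP S_def .
qed

subsection \<open>Elementary properties of the norms\<close>

lemma deriv_cmult_disc:
  assumes "f holomorphic_on ball 0 1" "norm z < 1"
  shows "deriv (\<lambda>z. c * f z) z = c * deriv f z"
  using assms by (intro DERIV_imp_deriv DERIV_cmult holomorphic_derivI[OF assms(1) open_ball]) auto

lemma sp_space_cmult:
  assumes f: "f \<in> sp_space p" and p: "p > 0"
  shows "(\<lambda>z. c * f z) \<in> sp_space p" "sp_norm p (\<lambda>z. c * f z) \<le> norm c * sp_norm p f"
proof -
  note D = sp_spaceD[OF f p]
  have hp: "hp_le p (deriv (\<lambda>z. c * f z)) (norm c powr p * hardy_norm p (deriv f) powr p)"
    by (rule hp_le_cong[OF hp_le_cmult[OF D(3) p]]) (rule deriv_cmult_disc[OF D(1)])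
  show "(\<lambda>z. c * f z) \<in> sp_space p"
    by (rule sp_spaceI[OF _ _ hp]) (use D in \<open>auto intro!: holomorphic_intros\<close>)
  have "hardy_norm p (deriv (\<lambda>z. c * f z)) \<le> (norm c powr p * hardy_norm p (deriv f) powr p) powr (1 / p)"
    by (rule hardy_norm_le[OF hp p])
  also have "\<dots> = norm c * hardy_norm p (deriv f)" using p by (simp add: powr_mult powr_powr)
  finally show "sp_norm p (\<lambda>z. c * f z) \<le> norm c * sp_norm p f"
    by (simp add: sp_norm_def norm_mult algebra_simps)
qed

lemma sp_space_diff:
  assumes f: "f \<in> sp_space p" and g: "g \<in> sp_space p" and p: "p \<ge> 1"
  shows "(\<lambda>z. f z - g z) \<in> sp_space p" "sp_norm p (\<lambda>z. f z - g z) \<le> 4 * (sp_norm p f + sp_norm p g)"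
proof -
  have p0: "p > 0" using p by simp
  note D = sp_spaceD[OF f p0] and E = sp_spaceD[OF g p0]
  define A where "A = max (hardy_norm p (deriv f)) (hardy_norm p (deriv g))"
  have A: "hardy_norm p (deriv f) \<le> A" "hardy_norm p (deriv g) \<le> A" "A \<ge> 0"
    using hardy_norm_nonneg[of p "deriv f"] by (auto simp: A_def simp del: hardy_norm_nonneg)
  have "hp_le p (\<lambda>z. deriv f z + - deriv g z) (2 powr p * (A powr p + A powr p))"
    by (intro hp_le_add hp_le_uminus hp_le_mono[OF D(3)] hp_le_mono[OF E(3)] p0 powr_mono2 A) (use p0 in auto)
  hence hp: "hp_le p (deriv (\<lambda>z. f z - g z)) (2 powr p * (A powr p + A powr p))"
    by (rule hp_le_cong) (use deriv_diff_disc[OF D(1) E(1)] in simp)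
  show "(\<lambda>z. f z - g z) \<in> sp_space p"
    by (rule sp_spaceI[OF _ _ hp]) (use D E in \<open>auto intro!: holomorphic_intros\<close>)
  have "hardy_norm p (deriv (\<lambda>z. f z - g z)) \<le> (2 powr p * (A powr p + A powr p)) powr (1 / p)"
    by (rule hardy_norm_le[OF hp p0])
  also have "\<dots> \<le> ((4 * A) powr p) powr (1 / p)"
  proof (rule powr_mono2)
    have "(2::real) powr 1 \<le> 2 powr p" by (rule powr_mono) (use p in auto)
    hence "2 powr p * (2 * A powr p) \<le> 2 powr p * (2 powr p * A powr p)" by (intro mult_left_mono mult_right_mono) auto
    also have "\<dots> = (2 powr p * 2 powr p) * A powr p" by simp
    also have "2 powr p * 2 powr p = (4::real) powr p" by (simp flip: powr_mult)
    also have "4 powr p * A powr p = (4 * A) powr p" by (simp add: powr_mult)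
    finally show "2 powr p * (A powr p + A powr p) \<le> (4 * A) powr p" by simp
  qed (use p in auto)
  also have "\<dots> = 4 * A" using A p0 by (simp add: powr_powr)
  also have "\<dots> \<le> 4 * (hardy_norm p (deriv f) + hardy_norm p (deriv g))"
    using hardy_norm_nonneg[of p "deriv f"] hardy_norm_nonneg[of p "deriv g"] by (auto simp: A_def max_def)
  finally have "hardy_norm p (deriv (\<lambda>z. f z - g z)) \<le> 4 * (hardy_norm p (deriv f) + hardy_norm p (deriv g))" .
  moreover have "norm (f 0 - g 0) \<le> 4 * (norm (f 0) + norm (g 0))"
  proof -
    have imp: "x \<le> 4 * (a + b)" if "x \<le> a + b" "0 \<le> a" "0 \<le> b" for x a b :: real using that by simp
    show ?thesis by (rule imp[OF norm_triangle_ineq4]) auto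
  qed
  ultimately show "sp_norm p (\<lambda>z. f z - g z) \<le> 4 * (sp_norm p f + sp_norm p g)" by (simp add: sp_norm_def)
qed

lemma sp_pointwise:
  assumes f: "f \<in> sp_space p" and p: "p \<ge> 1"
  shows "norm (f z) \<le> 20 * sp_norm p f"
proof (cases "norm z < 1")
  case False
  thus ?thesis using sp_spaceD(2)[OF f] p sp_norm_nonneg[of p f] by simp
next
  case True
  have p0: "p > 0" using p by simp
  have "norm (f z) \<le> 20 * t" if t: "t > sp_norm p f" for t
  proof -
    have t0: "t > 0" using t sp_norm_nonneg[of p f] by linarith
    have "sp_norm p (\<lambda>z. of_real (1 / t) * f z) \<le> norm (complex_of_real (1 / t)) * sp_norm p f"
      by (rule sp_space_cmult(2)[OF f p0])
    also have "norm (complex_of_real (1 / t)) = 1 / t" using t0 by (simp add: norm_divide)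
    also have "1 / t * sp_norm p f \<le> 1" using t t0 by (simp add: field_simps)
    finally have "norm (of_real (1 / t) * f z) \<le> 1 + 1 + 18 * 1 powr p"
      by (intro sp_normD(3)[OF sp_space_cmult(1)[OF f p0] p _ True])
    thus ?thesis using t0 by (simp add: norm_mult norm_divide field_simps)
  qed
  hence "norm (f z) / 20 \<le> t" if "t > sp_norm p f" for t using that by (simp add: mult.commute)
  hence "norm (f z) / 20 \<le> sp_norm p f" by (rule dense_ge)
  thus ?thesis by simp
qed

lemma lp_space_cmult: "x \<in> lp_space p \<Longrightarrow> (\<lambda>n. c * x n) \<in> lp_space p"
  unfolding lp_space_def by (auto simp: norm_mult powr_mult intro: summable_mult)

lemma lp_space_add:
  assumes "x \<in> lp_space p" "y \<in> lp_space p" "p > 0"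
  shows "(\<lambda>n. x n + y n) \<in> lp_space p"
  unfolding lp_space_def
proof (rule CollectI, rule summable_comparison_test'[where N = 0])
  show "summable (\<lambda>n. 2 powr p * (norm (x n) powr p + norm (y n) powr p))"
    using assms by (intro summable_mult summable_add) (auto simp: lp_space_def)
  show "norm (norm (x n + y n) powr p) \<le> 2 powr p * (norm (x n) powr p + norm (y n) powr p)" for n
    using norm_add_powr_le[OF assms(3), of "x n" "y n"] by simp
qed

lemma lp_space_diff:
  assumes "x \<in> lp_space p" "y \<in> lp_space p" "p > 0"
  shows "(\<lambda>n. x n - y n) \<in> lp_space p"
  using lp_space_add[OF assms(1) lp_space_cmult[OF assms(2), of "-1"] assms(3)] by simp

lemma lp_norm_powr: "x \<in> lp_space p \<Longrightarrow> p > 0 \<Longrightarrow> lp_norm p x powr p = (\<Sum>n. norm (x n) powr p)"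
  by (simp add: lp_norm_def powr_powr lp_space_def suminf_nonneg)

lemma lp_norm_nonneg: "0 \<le> lp_norm p x"
  by (simp add: lp_norm_def)

lemma lp_norm_le:
  assumes "x \<in> lp_space p" "p > 0" "B \<ge> 0" "(\<Sum>n. norm (x n) powr p) \<le> B powr p"
  shows "lp_norm p x \<le> B"
proof -
  have "lp_norm p x \<le> (B powr p) powr (1 / p)" unfolding lp_norm_def
    using assms by (intro powr_mono2) (auto simp: lp_space_def suminf_nonneg)
  thus ?thesis using assms by (simp add: powr_powr)
qed

lemma sum_le_lp_norm:
  assumes "x \<in> lp_space p" "p > 0"
  shows "(\<Sum>n<N. norm (x n) powr p) \<le> lp_norm p x powr p"
  unfolding lp_norm_powr[OF assms] using assms by (intro sum_le_suminf) (auto simp: lp_space_def)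

lemma norm_le_lp_norm:
  assumes "x \<in> lp_space p" "p > 0"
  shows "norm (x n) \<le> lp_norm p x"
proof -
  have "norm (x n) powr p \<le> (\<Sum>k<Suc n. norm (x k) powr p)"
    by (intro member_le_sum[of n "{..<Suc n}" "\<lambda>k. norm (x k) powr p"]) auto
  also have "\<dots> \<le> lp_norm p x powr p" by (rule sum_le_lp_norm[OF assms])
  finally show ?thesis using assms(2) powr_less_mono2[of p "lp_norm p x" "norm (x n)"] lp_norm_nonneg[of p x] by force
qed

lemma lp_space_finite: "(\<And>k. k \<ge> n \<Longrightarrow> x k = 0) \<Longrightarrow> x \<in> lp_space p"
  unfolding lp_space_def by (intro CollectI summable_finite[of "{..<n}"]) (auto simp: not_less)

lemma isomorphic_to_lp_infinite_dim:
  assumes "isomorphic_to_lp p M" "p > 0"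
  shows "infinite_dim M"
proof -
  obtain J where J: "bij_betw J (lp_space p) M"
     "\<And>x y. x \<in> lp_space p \<Longrightarrow> y \<in> lp_space p \<Longrightarrow> J (\<lambda>n. x n + y n) = (\<lambda>z. J x z + J y z)"
     "\<And>c x. x \<in> lp_space p \<Longrightarrow> J (\<lambda>n. c * x n) = (\<lambda>z. c * J x z)"
    using assms(1) unfolding isomorphic_to_lp_def by blast
  define E where "E i k = (if k = i then 1 else 0 :: complex)" for i k :: nat
  have E: "E i \<in> lp_space p" for i by (rule lp_space_finite[of "Suc i"]) (simp add: E_def)
  define X where "X c n k = (if k < n then c k else 0 :: complex)" for c :: "nat \<Rightarrow> complex" and n k :: nat
  have X: "X c n \<in> lp_space p" for c n by (rule lp_space_finite[of n]) (simp add: X_def)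
  have zero: "J (\<lambda>_. 0) = (\<lambda>z. 0)" using J(3)[OF E[of 0], of 0] by simp
  have JX: "J (X c n) = (\<lambda>z. \<Sum>i<n. c i * J (E i) z)" for c n
  proof (induction n)
    case 0
    have "X c 0 = (\<lambda>_. 0)" by (auto simp: X_def)
    thus ?case using zero by simp
  next
    case (Suc n)
    have "X c (Suc n) = (\<lambda>k. X c n k + c n * E n k)" by (auto simp: X_def E_def less_Suc_eq)
    hence "J (X c (Suc n)) = (\<lambda>z. J (X c n) z + c n * J (E n) z)"
      using J(2)[OF X lp_space_cmult[OF E]] J(3)[OF E] by simp
    thus ?case using Suc.IH by simp
  qed
  show ?thesis unfolding infinite_dim_def
  proof (intro allI exI[of _ "\<lambda>i. J (E i)"] conjI impI)
    show "J (E i) \<in> M" for i using J(1) E bij_betwE by blast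
    fix n c i assume "\<forall>z. (\<Sum>i<n. c i * J (E i) z) = 0" "i < n"
    hence "J (X c n) = J (\<lambda>_. 0)" unfolding JX zero by simp
    moreover have "(\<lambda>_. 0) \<in> lp_space p" by (rule lp_space_finite[of 0]) simp
    ultimately have "X c n = (\<lambda>_. 0)" using J(1) X unfolding bij_betw_def inj_on_def by blast
    from fun_cong[OF this, of i] show "c i = 0" using \<open>i < n\<close> by (simp add: X_def)
  qed
qed

lemma fixes_copy_not_strictly_singular:
  "fixes_copy_lp p T \<Longrightarrow> p > 0 \<Longrightarrow> \<not> strictly_singular p T"
  unfolding fixes_copy_lp_def strictly_singular_def using isomorphic_to_lp_infinite_dim by blast

subsection \<open>Compact operators are strictly singular\<close>

lemma homogeneous_system_nontrivial:
  fixes A :: "'i \<Rightarrow> 'k \<Rightarrow> complex"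
  assumes "finite K" "finite I" "card K < card I"
  shows "\<exists>c. (\<exists>i\<in>I. c i \<noteq> 0) \<and> (\<forall>k\<in>K. (\<Sum>i\<in>I. c i * A i k) = 0)"
  using assms
proof (induction K arbitrary: A I rule: finite_induct)
  case empty
  hence "I \<noteq> {}" by auto
  thus ?case by (intro exI[of _ "\<lambda>_. 1"]) auto
next
  case (insert k K A I)
  show ?case
  proof (cases "\<forall>i\<in>I. A i k = 0")
    case True
    obtain c where c: "\<exists>i\<in>I. c i \<noteq> 0" "\<forall>k\<in>K. (\<Sum>i\<in>I. c i * A i k) = 0"
      using insert.IH[of I A] insert.prems insert.hyps by auto
    thus ?thesis using True by (intro exI[of _ c]) auto
  next
    case False
    then obtain j where j: "j \<in> I" "A j k \<noteq> 0" by blast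
    define I' where "I' = I - {j}"
    have I': "finite I'" "card K < card I'" using insert.prems insert.hyps j by (auto simp: I'_def)
    define A' where "A' i l = A i l - A i k / A j k * A j l" for i l
    obtain c where c: "\<exists>i\<in>I'. c i \<noteq> 0" "\<forall>l\<in>K. (\<Sum>i\<in>I'. c i * A' i l) = 0"
      using insert.IH[OF I', of A'] by blast
    define s where "s = (\<Sum>i\<in>I'. c i * A i k) / A j k"
    define d where "d i = (if i = j then - s else c i)" for i
    have sum: "(\<Sum>i\<in>I. d i * f i) = (\<Sum>i\<in>I'. c i * f i) - s * f j" for f
    proof -
      have "(\<Sum>i\<in>I. d i * f i) = d j * f j + (\<Sum>i\<in>I'. d i * f i)"
        unfolding I'_def using insert.prems(1) j by (intro sum.remove)
      moreover have "(\<Sum>i\<in>I'. d i * f i) = (\<Sum>i\<in>I'. c i * f i)"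
        by (intro sum.cong) (auto simp: d_def I'_def)
      ultimately show ?thesis by (simp add: d_def)
    qed
    have "(\<Sum>i\<in>I. d i * A i l) = 0" if "l \<in> insert k K" for l
    proof (cases "l = k")
      case True
      thus ?thesis unfolding sum using j by (simp add: s_def)
    next
      case False
      hence "(\<Sum>i\<in>I'. c i * A' i l) = 0" using c(2) that by auto
      moreover have "(\<Sum>i\<in>I'. c i * A' i l) = (\<Sum>i\<in>I'. c i * A i l) - s * A j l"
        by (simp add: A'_def s_def algebra_simps sum_subtractf sum_distrib_left sum_divide_distrib)
      ultimately show ?thesis unfolding sum by simp
    qed
    moreover have "\<exists>i\<in>I. d i \<noteq> 0" using c(1) by (auto simp: d_def I'_def)
    ultimately show ?thesis by blast
  qed
qed

lemma linear_subspace_sum: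
  assumes "linear_subspace M" "\<And>i. i < (n::nat) \<Longrightarrow> g i \<in> M"
  shows "(\<lambda>z. \<Sum>i<n. c i * g i z) \<in> M"
  using assms(2)
proof (induction n)
  case 0
  thus ?case using assms(1) by (simp add: linear_subspace_def)
next
  case (Suc n)
  have "(\<lambda>z. \<Sum>i<n. c i * g i z) \<in> M" "(\<lambda>z. c n * g n z) \<in> M"
    using Suc assms(1) by (auto simp: linear_subspace_def)
  thus ?case using assms(1) by (simp add: linear_subspace_def)
qed

lemma taylor_coeff_sum:
  assumes "\<And>i. i < (n::nat) \<Longrightarrow> g i holomorphic_on ball 0 1"
  shows "taylor_coeff (\<lambda>z. \<Sum>i<n. c i * g i z) = (\<lambda>k. \<Sum>i<n. c i * taylor_coeff (g i) k)"
proof (rule taylor_coeff_unique)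
  show "(\<lambda>z. \<Sum>i<n. c i * g i z) holomorphic_on ball 0 1" by (intro holomorphic_intros assms) auto
  fix z :: complex assume z: "norm z < 1"
  have "(\<lambda>k. \<Sum>i<n. c i * (taylor_coeff (g i) k * z ^ k)) sums (\<Sum>i<n. c i * g i z)"
    by (intro sums_sum sums_mult taylor_coeff_sums assms z) auto
  thus "(\<lambda>k. (\<Sum>i<n. c i * taylor_coeff (g i) k) * z ^ k) sums (\<Sum>i<n. c i * g i z)"
    by (simp add: sum_distrib_right mult.assoc)
qed

lemma infinite_dim_vanishing_coeffs:
  assumes M: "closed_subspace p M" "infinite_dim M" and p: "p \<ge> 1"
  obtains f where "f \<in> M" "sp_norm p f = 1" "\<And>k. k < n \<Longrightarrow> taylor_coeff f k = 0"
proof -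
  have p0: "p > 0" using p by simp
  have sub: "M \<subseteq> sp_space p" "linear_subspace M" using M(1) by (auto simp: closed_subspace_def)
  obtain g :: "nat \<Rightarrow> complex \<Rightarrow> complex" where g: "\<forall>i<Suc n. g i \<in> M"
    "\<forall>c. (\<forall>z. (\<Sum>i<Suc n. c i * g i z) = 0) \<longrightarrow> (\<forall>i<Suc n. c i = 0)"
    using M(2) unfolding infinite_dim_def by blast
  obtain c where c: "\<exists>i\<in>{..<Suc n}. c i \<noteq> 0" "\<forall>k\<in>{..<n}. (\<Sum>i<Suc n. c i * taylor_coeff (g i) k) = 0"
    using homogeneous_system_nontrivial[of "{..<n}" "{..<Suc n}" "\<lambda>i. taylor_coeff (g i)"] by auto
  define f where "f = (\<lambda>z. \<Sum>i<Suc n. c i * g i z)"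
  have fM: "f \<in> M" unfolding f_def by (rule linear_subspace_sum[OF sub(2)]) (use g in blast)
  hence f: "f \<in> sp_space p" using sub by blast
  have gh: "g i holomorphic_on ball 0 1" if "i < Suc n" for i using g(1) that sub sp_spaceD(1)[OF _ p0] by blast
  have "taylor_coeff f = (\<lambda>k. \<Sum>i<Suc n. c i * taylor_coeff (g i) k)" unfolding f_def by (rule taylor_coeff_sum) (rule gh)
  hence tcf: "taylor_coeff f k = 0" if "k < n" for k using c(2) that by (simp del: sum.lessThan_Suc)
  have "\<not> (\<forall>z. f z = 0)" using g(2) c(1) unfolding f_def by blast
  then obtain w where "f w \<noteq> 0" by blast
  hence "0 < norm (f w)" by simp
  also have "\<dots> \<le> 20 * sp_norm p f" by (rule sp_pointwise[OF f p])
  finally have t: "sp_norm p f > 0" by simp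
  define t where "t = sp_norm p f"
  define F where "F = (\<lambda>z. of_real (1 / t) * f z)"
  have FM: "F \<in> M" unfolding F_def using sub(2)[unfolded linear_subspace_def] fM by blast
  have nt: "norm (complex_of_real (1 / t)) = 1 / t" "norm (complex_of_real t) = t" "t > 0"
    using t by (auto simp: t_def norm_divide)
  have "sp_norm p F \<le> 1"
    unfolding F_def using sp_space_cmult(2)[OF f p0, of "of_real (1 / t)"] nt by (simp add: t_def)
  moreover have "t \<le> t * sp_norm p F"
  proof -
    have "(\<lambda>z. of_real t * F z) = f" using nt by (auto simp: F_def)
    thus ?thesis using sp_space_cmult(2)[of F p "of_real t"] FM sub(1) p0 nt by (auto simp: t_def)
  qed
  ultimately have "sp_norm p F = 1" using nt by simp
  moreover have "taylor_coeff F k = 0" if "k < n" for k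
  proof -
    have "F = (\<lambda>z. \<Sum>i<Suc 0. of_real (1 / t) * f z)" by (simp add: F_def)
    hence "taylor_coeff F k = (\<Sum>i<Suc 0. of_real (1 / t) * taylor_coeff f k)"
      using taylor_coeff_sum[of "Suc 0" "\<lambda>_. f" "\<lambda>_. of_real (1 / t)"] sp_spaceD(1)[OF f p0] by metis
    thus ?thesis using tcf[OF that] by simp
  qed
  ultimately show ?thesis using FM by (intro that)
qed

context weighted_composition
begin

lemma compact_imp_strictly_singular:
  assumes comp: "compact_op p W"
  shows "strictly_singular p W"
  unfolding strictly_singular_def
proof (intro allI impI notI)
  fix M assume M: "closed_subspace p M" "infinite_dim M" and "iso_on p W M"
  then obtain c where c: "c > 0" "\<And>f. f \<in> M \<Longrightarrow> c * sp_norm p f \<le> sp_norm p (W f)" by (auto simp: iso_on_def)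
  have "\<forall>n. \<exists>f. f \<in> M \<and> sp_norm p f = 1 \<and> (\<forall>k<n. taylor_coeff f k = 0)"
    using infinite_dim_vanishing_coeffs[OF M p1] by metis
  from choice[OF this] obtain f where f: "\<And>n. f n \<in> M" "\<And>n. sp_norm p (f n) = 1" "\<And>n k. k < n \<Longrightarrow> taylor_coeff (f n) k = 0" by blast
  have fsp: "f n \<in> sp_space p" for n using f(1) M(1) by (auto simp: closed_subspace_def)
  have hf: "f n holomorphic_on ball 0 1" for n by (rule sp_spaceD(1)[OF fsp p0])
  have hp: "hp_le p (deriv (f n)) 1" for n using sp_normD(2)[OF fsp p1, of n 1] f(2) by simp
  have tcb: "norm (taylor_coeff (f n) k) \<le> 2" if "n > 0" for n k
  proof (cases k)
    case 0
    thus ?thesis using f(3)[of 0 n] that by simp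
  next
    case (Suc j)
    have "norm (taylor_coeff (f n) (Suc j)) \<le> (1 + 1) / real (Suc j)" by (rule taylor_coeff_deriv_bound[OF hp p1])
    also have "\<dots> \<le> 2" by (simp add: field_simps)
    finally show ?thesis using Suc by simp
  qed
  have fz: "(\<lambda>n. f n z) \<longlonglongrightarrow> 0" if z: "norm z < 1" for z
  proof (rule Lim_null_comparison)
    have s: "summable (\<lambda>k. 2 * norm z ^ k)" using z by (intro summable_mult summable_geometric) auto
    show "eventually (\<lambda>n. norm (f n z) \<le> norm z ^ n * (\<Sum>k. 2 * norm z ^ k)) sequentially"
      using eventually_gt_at_top[of 0]
    proof eventually_elim
      case (elim n)
      have "(\<lambda>k. taylor_coeff (f n) (k + n) * z ^ (k + n)) sums (f n z - (\<Sum>k<n. taylor_coeff (f n) k * z ^ k))"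
        by (rule sums_split_initial_segment[OF taylor_coeff_sums[OF hf z]])
      hence "(\<lambda>k. taylor_coeff (f n) (k + n) * z ^ (k + n)) sums f n z" using f(3) by simp
      hence "f n z = (\<Sum>k. taylor_coeff (f n) (k + n) * z ^ (k + n))" by (simp add: sums_iff)
      also have "norm \<dots> \<le> (\<Sum>k. norm z ^ n * (2 * norm z ^ k))"
      proof (rule norm_suminf_le)
        show "norm (taylor_coeff (f n) (k + n) * z ^ (k + n)) \<le> norm z ^ n * (2 * norm z ^ k)" for k
          using mult_right_mono[OF tcb[OF elim, of "k + n"], of "norm z ^ (k + n)"]
          by (simp add: norm_mult norm_power power_add mult_ac)
      qed (intro summable_mult s)
      also have "\<dots> = norm z ^ n * (\<Sum>k. 2 * norm z ^ k)" by (rule suminf_mult[OF s])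
      finally show ?case .
    qed
    have "(\<lambda>n. norm z ^ n * (\<Sum>k. 2 * norm z ^ k)) \<longlonglongrightarrow> 0 * (\<Sum>k. 2 * norm z ^ k)"
      by (intro tendsto_intros LIMSEQ_realpow_zero) (use z in auto)
    thus "(\<lambda>n. norm z ^ n * (\<Sum>k. 2 * norm z ^ k)) \<longlonglongrightarrow> 0" by simp
  qed
  have "\<exists>B. \<forall>n. sp_norm p (f n) \<le> B" using f(2) by (intro exI[of _ 1]) simp
  then obtain g r where g: "g \<in> sp_space p" "strict_mono (r :: nat \<Rightarrow> nat)"
      "(\<lambda>n. sp_norm p (\<lambda>z. W (f (r n)) z - g z)) \<longlonglongrightarrow> 0"
    using comp fsp unfolding compact_op_def by blast
  have "g z = 0" for z
  proof (cases "norm z < 1")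
    case False
    thus ?thesis using sp_spaceD(2)[OF g(1) p0] by simp
  next
    case True
    have "(\<lambda>n. W (f (r n)) z - g z) \<longlonglongrightarrow> 0"
    proof (rule Lim_null_comparison)
      show "eventually (\<lambda>n. norm (W (f (r n)) z - g z) \<le> 20 * sp_norm p (\<lambda>z. W (f (r n)) z - g z)) sequentially"
        by (intro always_eventually allI sp_pointwise[where f = "\<lambda>z. W (f (r _)) z - g z"] sp_space_diff W_in_sp fsp g p1)
      show "(\<lambda>n. 20 * sp_norm p (\<lambda>z. W (f (r n)) z - g z)) \<longlonglongrightarrow> 0" using tendsto_mult_left[OF g(3), of 20] by simp
    qed
    moreover have "(\<lambda>n. f (r n) (\<psi> z)) \<longlonglongrightarrow> 0"
      using LIMSEQ_subseq_LIMSEQ[OF fz[OF npsi[OF True]] g(2)] by (simp add: o_def)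
    hence "(\<lambda>n. \<phi> z * f (r n) (\<psi> z) - g z) \<longlonglongrightarrow> \<phi> z * 0 - g z" by (intro tendsto_intros)
    hence "(\<lambda>n. W (f (r n)) z - g z) \<longlonglongrightarrow> \<phi> z * 0 - g z" using True by (simp add: wcomp_def)
    ultimately show ?thesis using LIMSEQ_unique by fastforce
  qed
  hence "(\<lambda>n. sp_norm p (W (f (r n)))) \<longlonglongrightarrow> 0" using g(3) by simp
  moreover have "c \<le> sp_norm p (W (f (r n)))" for n using c(2)[OF f(1)[of "r n"]] f(2) by simp
  ultimately have "c \<le> 0" by (intro LIMSEQ_le_const) auto
  thus False using c by simp
qed

end

subsection \<open>Copies of $\ell^p$\<close>

context weighted_composition
begin

lemma almost_disjoint_step:
  assumes \<xi>: "norm \<xi> = 1" and a: "\<And>n. norm (a n) < 1" "a \<longlonglongrightarrow> \<xi>" and h: "h > 0" and e: "e > 0" and m: "m > 0"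
  shows "\<exists>k h'. 0 < h' \<and> h' \<le> h \<and> 1 - (norm (a k))\<^sup>2 \<le> m \<and> (\<forall>r. 0 \<le> r \<longrightarrow> r < 1 \<longrightarrow>
     cmean (\<lambda>z. norm (deriv (W (test_fun p (a k))) z) powr p * (1 - ring_bump h h' (\<psi> z - \<xi>))) r \<le> e \<and>
     cmean (\<lambda>z. norm (test_deriv p (a k) z) powr p * (1 - ring_bump h h' (z - \<xi>))) r \<le> e)"
proof -
  obtain B1 where B1: "hp_le p (deriv \<phi>) B1" by (rule hp_deriv_phi)
  obtain B2 where B2: "hp_le p u B2" by (rule hp_u)
  have c0: "hp_le p (\<lambda>z. 0) (0 powr p)" "hp_le p (\<lambda>z. 1) (1 powr p)" by (rule hp_le_const_mean; use p0 in auto)+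
  have e2: "e / 2 > 0" using e by simp
  note far1 = mass_far_from_point_small[OF p0 B1 B2 psi \<xi> a h e2]
  note far2 = mass_far_from_point_small[where \<sigma> = "\<lambda>z. z", OF p0 c0 _ _ \<xi> a h e2]
  have "(\<lambda>n. 1 - (norm (a n))\<^sup>2) \<longlonglongrightarrow> 1 - (norm \<xi>)\<^sup>2" by (intro tendsto_intros a)
  hence "(\<lambda>n. 1 - (norm (a n))\<^sup>2) \<longlonglongrightarrow> 0" using \<xi> by simp
  hence "eventually (\<lambda>n. 1 - (norm (a n))\<^sup>2 < m) sequentially" using m by (rule order_tendstoD(2))
  with far1 far2 have "eventually (\<lambda>n. (\<forall>r. 0 \<le> r \<longrightarrow> r < 1 \<longrightarrow>
     cmean (\<lambda>z. norm (deriv \<phi> z * test_fun p (a n) (\<psi> z) + u z * test_deriv p (a n) (\<psi> z)) powr p *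
        (1 - lin_bump h (norm (\<psi> z - \<xi>)))) r \<le> e / 2) \<and> (\<forall>r. 0 \<le> r \<longrightarrow> r < 1 \<longrightarrow>
     cmean (\<lambda>z. norm (0 * test_fun p (a n) z + 1 * test_deriv p (a n) z) powr p *
        (1 - lin_bump h (norm (z - \<xi>)))) r \<le> e / 2) \<and> 1 - (norm (a n))\<^sup>2 < m) sequentially"
    by (intro eventually_conj) (auto intro: holomorphic_on_ident)
  from eventually_happens'[OF sequentially_bot this] obtain k where k: "\<And>r. 0 \<le> r \<Longrightarrow> r < 1 \<Longrightarrow>
     cmean (\<lambda>z. norm (deriv \<phi> z * test_fun p (a k) (\<psi> z) + u z * test_deriv p (a k) (\<psi> z)) powr p *
        (1 - lin_bump h (norm (\<psi> z - \<xi>)))) r \<le> e / 2"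
     "\<And>r. 0 \<le> r \<Longrightarrow> r < 1 \<Longrightarrow> cmean (\<lambda>z. norm (test_deriv p (a k) z) powr p * (1 - lin_bump h (norm (z - \<xi>)))) r \<le> e / 2"
     "1 - (norm (a k))\<^sup>2 < m"
    by auto
  define V where "V = deriv (W (test_fun p (a k)))"
  obtain BV where BV: "hp_le p V BV"
    using hp_le_deriv_W[OF test_fun_holomorphic[OF a(1)] hp_le_deriv_test_fun[OF a(1) p0]] unfolding V_def by blast
  obtain h1 where h1: "h1 > 0" "\<forall>h r. 0 < h \<longrightarrow> h \<le> h1 \<longrightarrow> 0 \<le> r \<longrightarrow> r < 1 \<longrightarrow>
     cmean (\<lambda>z. norm (V z) powr p * lin_bump h (norm (\<psi> z - \<xi>))) r \<le> e / 2"
    using mass_near_point_small[OF p0 BV psi \<xi> e2] by blast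
  have id_sub: "(\<lambda>z. z) ` ball 0 1 \<subseteq> ball (0::complex) 1" by simp
  obtain h2 where h2: "h2 > 0" "\<forall>h r. 0 < h \<longrightarrow> h \<le> h2 \<longrightarrow> 0 \<le> r \<longrightarrow> r < 1 \<longrightarrow>
     cmean (\<lambda>z. norm (test_deriv p (a k) z) powr p * lin_bump h (norm (z - \<xi>))) r \<le> e / 2"
    using mass_near_point_small[OF p0 hp_le_test_deriv[OF a(1)[of k] p0] holomorphic_on_ident id_sub \<xi> e2] by blast
  define h' where "h' = min h (min h1 h2) / 2"
  have h': "0 < h'" "h' \<le> h" "2 * h' \<le> h1" "2 * h' \<le> h2" using h h1(1) h2(1) by (auto simp: h'_def)
  have V: "V z = deriv \<phi> z * test_fun p (a k) (\<psi> z) + u z * test_deriv p (a k) (\<psi> z)" if "norm z < 1" for z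
    unfolding V_def using deriv_W[OF test_fun_holomorphic[OF a(1)] that] deriv_test_fun[OF a(1) npsi[OF that]] by simp
  show ?thesis
  proof (intro exI conjI allI impI)
    fix r :: real assume r: "0 \<le> r" "r < 1"
    show "cmean (\<lambda>z. norm (deriv (W (test_fun p (a k))) z) powr p * (1 - ring_bump h h' (\<psi> z - \<xi>))) r \<le> e"
    proof -
      have "cmean (\<lambda>z. norm (V z) powr p * (1 - ring_bump h h' (\<psi> z - \<xi>))) r \<le> e / 2 + e / 2"
      proof (rule cmean_ring_bump_le)
        have "cmean (\<lambda>z. norm (V z) powr p * (1 - lin_bump h (norm (\<psi> z - \<xi>)))) r
           = cmean (\<lambda>z. norm (deriv \<phi> z * test_fun p (a k) (\<psi> z) + u z * test_deriv p (a k) (\<psi> z)) powr p *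
                (1 - lin_bump h (norm (\<psi> z - \<xi>)))) r"
          by (rule cmean_cong) (use V r in auto)
        thus "cmean (\<lambda>z. norm (V z) powr p * (1 - lin_bump h (norm (\<psi> z - \<xi>)))) r \<le> e / 2" using k(1)[OF r] by simp
        show "cmean (\<lambda>z. norm (V z) powr p * lin_bump (2 * h') (norm (\<psi> z - \<xi>))) r \<le> e / 2"
          using h1(2) h' r by simp
      qed (intro continuous_on_sphere_subset holomorphic_on_imp_continuous_on hp_leD(1)[OF BV] psi r p0 h h')+
      thus ?thesis by (simp add: V_def)
    qed
    show "cmean (\<lambda>z. norm (test_deriv p (a k) z) powr p * (1 - ring_bump h h' (z - \<xi>))) r \<le> e"
    proof -
      have "cmean (\<lambda>z. norm (test_deriv p (a k) z) powr p * (1 - ring_bump h h' (z - \<xi>))) r \<le> e / 2 + e / 2"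
      proof (rule cmean_ring_bump_le)
        show "cmean (\<lambda>z. norm (test_deriv p (a k) z) powr p * lin_bump (2 * h') (norm (z - \<xi>))) r \<le> e / 2"
          using h2(2) h' r by simp
      qed (intro continuous_on_sphere_subset holomorphic_on_imp_continuous_on test_deriv_holomorphic a r p0 h h' k continuous_on_id)+
      thus ?thesis by simp
    qed
  qed (use h' k(3) in auto)
qed

lemma almost_disjoint_selection:
  assumes \<xi>: "norm \<xi> = 1" and a: "\<And>n. norm (a n) < 1" "a \<longlonglongrightarrow> \<xi>" and e: "e > 0"
  shows "\<exists>(k :: nat \<Rightarrow> nat) (h :: nat \<Rightarrow> real). \<forall>n. 0 < h n \<and> h (Suc n) \<le> h n \<and> 1 - (norm (a (k n)))\<^sup>2 \<le> ((1/2) ^ n) powr p \<and>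
     (\<forall>r. 0 \<le> r \<longrightarrow> r < 1 \<longrightarrow>
       cmean (\<lambda>z. norm (deriv (W (test_fun p (a (k n)))) z) powr p * (1 - ring_bump (h n) (h (Suc n)) (\<psi> z - \<xi>))) r \<le> e / (2 ^ Suc n) powr p \<and>
       cmean (\<lambda>z. norm (test_deriv p (a (k n)) z) powr p * (1 - ring_bump (h n) (h (Suc n)) (z - \<xi>))) r \<le> e / (2 ^ Suc n) powr p)"
proof -
  define Q where "Q n h k h' \<longleftrightarrow> 0 < h' \<and> h' \<le> h \<and> 1 - (norm (a k))\<^sup>2 \<le> ((1/2) ^ n) powr p \<and> (\<forall>r. 0 \<le> r \<longrightarrow> r < 1 \<longrightarrow>
     cmean (\<lambda>z. norm (deriv (W (test_fun p (a k))) z) powr p * (1 - ring_bump h h' (\<psi> z - \<xi>))) r \<le> e / (2 ^ Suc n) powr p \<and>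
     cmean (\<lambda>z. norm (test_deriv p (a k) z) powr p * (1 - ring_bump h h' (z - \<xi>))) r \<le> e / (2 ^ Suc n) powr p)"
    for n k :: nat and h h' :: real
  have step: "\<exists>k h'. Q n h k h'" if "h > 0" for n h
    unfolding Q_def by (rule almost_disjoint_step[OF \<xi> a that]) (use e in auto)
  define kk where "kk n h = (SOME k. \<exists>h'. Q n h k h')" for n h
  define hh where "hh n h = (SOME h'. Q n h (kk n h) h')" for n h
  have Q: "Q n h (kk n h) (hh n h)" if "h > 0" for n h
    unfolding hh_def by (rule someI_ex) (unfold kk_def, rule someI_ex, rule step[OF that])
  define h where "h = rec_nat 1 hh"
  have h0: "h 0 = 1" and hS: "h (Suc n) = hh n (h n)" for n by (simp_all add: h_def)
  have pos: "h n > 0" for n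
  proof (induction n)
    case (Suc n)
    show ?case using Q[OF Suc, of n] by (simp add: hS Q_def)
  qed (simp add: h0)
  have "Q n (h n) (kk n (h n)) (h (Suc n))" for n unfolding hS by (rule Q[OF pos])
  thus ?thesis unfolding Q_def using pos by (intro exI[of _ "\<lambda>n. kk n (h n)"] exI[of _ h]) blast
qed

lemma noncompact_fixes_lp:
  assumes nc: "\<not> compact_op p W"
  shows "fixes_copy_lp p W"
proof -
  obtain \<xi> a c where \<xi>: "norm \<xi> = 1" and a: "\<And>n. norm (a n) < 1" "a \<longlonglongrightarrow> \<xi>" and c: "c > 0"
    and big: "\<And>n::nat. \<exists>r. 0 \<le> r \<and> r < 1 \<and> c \<le> cmean (\<lambda>z. norm (deriv (W (test_fun p (a n))) z) powr p) r"
    using test_functions_not_vanishing[OF nc] by blast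
  define e where "e = c / (2 * (2 powr p + 1))"
  have half: "q * (c / (2 * q)) = c / 2" if "q > 0" for q :: real using that by simp
  have e: "e > 0" "(2 powr p + 1) * e = c / 2"
    unfolding e_def by (intro divide_pos_pos mult_pos_pos c, simp, simp add: add_pos_pos) (rule half, simp add: add_pos_pos)
  obtain k h where sel: "\<forall>n. 0 < h n \<and> h (Suc n) \<le> h n \<and> 1 - (norm (a (k n)))\<^sup>2 \<le> ((1/2) ^ n) powr p \<and>
     (\<forall>r. 0 \<le> r \<longrightarrow> r < 1 \<longrightarrow>
       cmean (\<lambda>z. norm (deriv (W (test_fun p (a (k n)))) z) powr p * (1 - ring_bump (h n) (h (Suc n)) (\<psi> z - \<xi>))) r \<le> e / (2 ^ Suc n) powr p \<and>
       cmean (\<lambda>z. norm (test_deriv p (a (k n)) z) powr p * (1 - ring_bump (h n) (h (Suc n)) (z - \<xi>))) r \<le> e / (2 ^ Suc n) powr p)"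
    using almost_disjoint_selection[OF \<xi> a e(1)] by (elim exE)
  have h: "\<And>n. 0 < h n" "\<And>n. h (Suc n) \<le> h n" and kd: "\<And>n. 1 - (norm (a (k n)))\<^sup>2 \<le> ((1/2) ^ n) powr p"
    and smallW: "\<And>n r. 0 \<le> r \<Longrightarrow> r < 1 \<Longrightarrow>
       cmean (\<lambda>z. norm (deriv (W (test_fun p (a (k n)))) z) powr p * (1 - ring_bump (h n) (h (Suc n)) (\<psi> z - \<xi>))) r \<le> e / (2 ^ Suc n) powr p"
    and smallG: "\<And>n r. 0 \<le> r \<Longrightarrow> r < 1 \<Longrightarrow>
       cmean (\<lambda>z. norm (test_deriv p (a (k n)) z) powr p * (1 - ring_bump (h n) (h (Suc n)) (z - \<xi>))) r \<le> e / (2 ^ Suc n) powr p"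
    using sel by blast+
  define K where "K n = test_fun p (a (k n))" for n
  define G where "G n = test_deriv p (a (k n))" for n
  define v where "v n = deriv (W (K n))" for n
  have hK: "K n holomorphic_on ball 0 1" for n unfolding K_def by (rule test_fun_holomorphic[OF a(1)])
  have hG: "G n holomorphic_on ball 0 1" for n unfolding G_def by (rule test_deriv_holomorphic[OF a(1)])
  have hv: "v n holomorphic_on ball 0 1" for n unfolding v_def by (intro holomorphic_deriv W_holomorphic hK) auto
  have dK: "(K n has_field_derivative G n z) (at z)" if "norm z < 1" for n z
    unfolding K_def G_def by (rule test_fun(1)[OF a(1) that])
  have K0: "K n 0 = 0" and Kout: "\<not> norm z < 1 \<Longrightarrow> K n z = 0" for n z
    unfolding K_def using test_fun[OF a(1)] by auto
  have dis: "ring_bump (h m) (h (Suc m)) w = 0 \<or> ring_bump (h n) (h (Suc n)) w = 0" if "m \<noteq> n" for m n w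
  proof -
    have dec: "h j \<le> h i" if "i \<le> j" for i j by (rule lift_Suc_antimono_le[of h, OF h(2) that])
    show ?thesis
    proof (cases "m < n")
      case True
      thus ?thesis by (intro ring_bump_disjoint h dec) auto
    next
      case False
      hence "ring_bump (h n) (h (Suc n)) w = 0 \<or> ring_bump (h m) (h (Suc m)) w = 0"
        using that by (intro ring_bump_disjoint h dec) auto
      thus ?thesis by blast
    qed
  qed
  have Kbound: "\<exists>C\<ge>0. \<forall>n. \<forall>z\<in>cball 0 s. norm (K n z) \<le> C * (1/2) ^ n" if s: "s < 1" for s
  proof -
    define m where "m = 1 - s"
    have m: "m > 0" using s by (simp add: m_def)
    define C where "C = (1 / m\<^sup>2) powr (1 / p)"
    have "norm (K n z) \<le> C * (1/2) ^ n" if z: "z \<in> cball 0 s" for n z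
    proof -
      have "norm (K n z) powr p \<le> (1 - (norm (a (k n)))\<^sup>2) / m\<^sup>2"
        unfolding K_def
      proof (rule test_bound(2)[OF a(1) p0 _ m])
        fix t :: real assume t: "0 \<le> t" "t \<le> 1"
        have "norm (of_real t * z) \<le> norm z" using t by (simp add: norm_mult mult_left_le_one_le)
        thus "m \<le> norm (1 - cnj (a (k n)) * (of_real t * z))"
          using norm_one_minus_ge[of "cnj (a (k n))" "of_real t * z"] a(1)[of "k n"] z by (simp add: m_def)
      qed (use z s in auto)
      also have "\<dots> \<le> ((1/2) ^ n) powr p / m\<^sup>2" by (intro divide_right_mono kd) auto
      also have "\<dots> = (C * (1/2) ^ n) powr p" using p0 m by (simp add: C_def powr_mult powr_powr)
      finally have le: "norm (K n z) powr p \<le> (C * (1/2) ^ n) powr p" .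
      show ?thesis
      proof (rule ccontr)
        assume "\<not> ?thesis"
        hence "(C * (1/2) ^ n) powr p < norm (K n z) powr p" by (intro powr_less_mono2 p0) (auto simp: C_def)
        with le show False by simp
      qed
    qed
    thus ?thesis by (intro exI[of _ C]) (auto simp: C_def)
  qed
  define J where "J x z = (\<Sum>n. x n * K n z)" for x z
  define SN where "SN x N z = (\<Sum>n<N. x n * K n z)" for x z and N :: nat
  have U: "uniform_limit (cball 0 s) (SN x) (J x) sequentially" if x: "x \<in> lp_space p" and s: "s < 1" for x s
  proof -
    obtain C where C: "C \<ge> 0" "\<And>n z. z \<in> cball 0 s \<Longrightarrow> norm (K n z) \<le> C * (1/2) ^ n" using Kbound[OF s] by blast
    show ?thesis unfolding SN_def[abs_def] J_def[abs_def]
    proof (rule Weierstrass_m_test)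
      show "norm (x n * K n z) \<le> lp_norm p x * (C * (1/2) ^ n)" if "z \<in> cball 0 s" for n z
        unfolding norm_mult by (intro mult_mono norm_le_lp_norm[OF x p0] C(2) that lp_norm_nonneg) auto
      show "summable (\<lambda>n. lp_norm p x * (C * (1/2) ^ n))" by (intro summable_mult summable_geometric) simp
    qed
  qed
  have sumK: "summable (\<lambda>n. x n * K n z)" if x: "x \<in> lp_space p" for x z
  proof (cases "norm z < 1")
    case True
    have "(\<lambda>N. SN x N z) \<longlonglongrightarrow> J x z" by (rule tendsto_uniform_limitI[OF U[OF x True]]) simp
    thus ?thesis unfolding SN_def by (auto simp: summable_def sums_def)
  next
    case False
    thus ?thesis using Kout by simp
  qed
  have hSN: "SN x N holomorphic_on ball 0 1" for x N unfolding SN_def[abs_def] by (intro holomorphic_intros hK)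
  have hJ: "J x holomorphic_on ball 0 1" if x: "x \<in> lp_space p" for x
  proof (rule holomorphic_uniform_sequence[OF open_ball hSN])
    fix w :: complex assume "w \<in> ball 0 1"
    hence w: "norm w < 1" by simp
    define s where "s = (1 + norm w) / 2"
    have s: "s < 1" using w by (simp add: s_def)
    have sub: "cball w ((1 - norm w) / 2) \<subseteq> cball 0 s"
    proof
      fix z assume "z \<in> cball w ((1 - norm w) / 2)"
      thus "z \<in> cball 0 s" using norm_triangle_sub[of z w] by (simp add: s_def dist_norm norm_minus_commute field_simps)
    qed
    have "cball 0 s \<subseteq> ball (0::complex) 1" using s by auto
    with sub uniform_limit_on_subset[OF U[OF x s] sub] w
    show "\<exists>d>0. cball w d \<subseteq> ball 0 1 \<and> uniform_limit (cball w d) (SN x) (J x) sequentially"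
      by (intro exI[of _ "(1 - norm w) / 2"]) auto
  qed
  have lim0: "uniform_limit (cball 0 s) (\<lambda>N z. SN x N z - J x z) (\<lambda>_. 0) sequentially" if "x \<in> lp_space p" "s < 1" for x s
    using U[OF that] by (simp add: uniform_limit_iff dist_norm)
  have dSN: "deriv (SN x N) z = (\<Sum>n<N. x n * G n z)" if "norm z < 1" for x N z
    unfolding SN_def[abs_def] by (intro DERIV_imp_deriv DERIV_sum DERIV_cmult dK that)
  have dWSN: "deriv (W (SN x N)) z = (\<Sum>n<N. x n * v n z)" if z: "norm z < 1" for x N z
    unfolding v_def deriv_W[OF hSN z] deriv_W[OF hK z] dSN[OF npsi[OF z]] SN_def
    using DERIV_imp_deriv[OF dK[OF npsi[OF z]]] by (simp add: sum_distrib_left sum.distrib algebra_simps)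
  have cG: "continuous_on (sphere 0 r) (G n)" "continuous_on (sphere 0 r) (v n)" if "r < 1" for r n
    by (intro continuous_on_sphere_subset holomorphic_on_imp_continuous_on hG hv that)+
  have bump: "continuous_on (sphere 0 r) (\<lambda>z. ring_bump (h n) (h (Suc n)) (z - \<xi>))"
     "continuous_on (sphere 0 r) (\<lambda>z. ring_bump (h n) (h (Suc n)) (\<psi> z - \<xi>))" if "r < 1" for r n
    by (intro continuous_on_ring_bump h continuous_intros continuous_on_sphere_subset holomorphic_on_imp_continuous_on psi that)+
  have upper: "hp_le p (deriv (J x)) (2 powr p * (2 + e) * lp_norm p x powr p)" if x: "x \<in> lp_space p" for x
  proof (rule hp_le_limit[OF _ p0 holomorphic_deriv[OF hJ[OF x] open_ball] deriv_uniform_limit[OF hSN hJ[OF x] lim0[OF x]]])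
    fix N
    show "hp_le p (deriv (SN x N)) (2 powr p * (2 + e) * lp_norm p x powr p)"
      unfolding hp_le_def
    proof (intro conjI allI impI holomorphic_deriv hSN open_ball)
      fix r :: real assume r: "0 \<le> r" "r < 1"
      have "cmean (\<lambda>z. norm (deriv (SN x N) z) powr p) r = cmean (\<lambda>z. norm (\<Sum>n<N. x n * G n z) powr p) r"
        by (rule cmean_cong) (use dSN r in auto)
      also have "\<dots> \<le> 2 powr p * (\<Sum>n<N. norm (x n) powr p * (cmean (\<lambda>z. norm (G n z) powr p) r + e))"
        by (rule almost_disjoint_means(1)[OF r(1) p0 cG(1)[OF r(2)] bump(1)[OF r(2)] _ dis])
           (use smallG[OF r] ring_bump_bounds in \<open>auto simp: G_def\<close>)
      also have "\<dots> \<le> 2 powr p * (\<Sum>n<N. norm (x n) powr p * (2 + e))"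
        unfolding G_def by (intro mult_left_mono sum_mono add_mono hp_leD(2)[OF hp_le_test_deriv[OF a(1) p0]] r) auto
      also have "\<dots> = 2 powr p * (2 + e) * (\<Sum>n<N. norm (x n) powr p)" by (simp add: sum_distrib_right[symmetric])
      also have "\<dots> \<le> 2 powr p * (2 + e) * lp_norm p x powr p"
        using e by (intro mult_left_mono sum_le_lp_norm[OF x p0]) auto
      finally show "cmean (\<lambda>z. norm (deriv (SN x N) z) powr p) r \<le> 2 powr p * (2 + e) * lp_norm p x powr p" .
    qed
  qed
  define b where "b = 2 * (2 + e) powr (1 / p)"
  have b: "b > 0" using e by (simp add: b_def)
  have J0: "J x 0 = 0" and Jout: "\<not> norm z < 1 \<Longrightarrow> J x z = 0" for x z unfolding J_def using K0 Kout by simp_all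
  have Jsp: "J x \<in> sp_space p" if "x \<in> lp_space p" for x by (rule sp_spaceI[OF hJ[OF that] Jout upper[OF that]])
  have Jb: "sp_norm p (J x) \<le> b * lp_norm p x" if x: "x \<in> lp_space p" for x
  proof -
    have "sp_norm p (J x) \<le> (2 powr p * (2 + e) * lp_norm p x powr p) powr (1 / p)"
      using hardy_norm_le[OF upper[OF x] p0] J0 by (simp add: sp_norm_def)
    also have "\<dots> = b * lp_norm p x" using p0 lp_norm_nonneg[of p x] by (simp add: b_def powr_mult powr_powr)
    finally show ?thesis .
  qed
  define A where "A = (2 * 2 powr p / c) powr (1 / p)"
  have A: "A > 0" using c by (simp add: A_def)
  have lower: "lp_norm p x \<le> A * sp_norm p (W (J x))" if x: "x \<in> lp_space p" for x
  proof -
    define H where "H = hardy_norm p (deriv (W (J x)))"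
    have Wsp: "W (J x) \<in> sp_space p" by (rule W_in_sp[OF Jsp[OF x]])
    have hpH: "hp_le p (deriv (W (J x))) (H powr p)" unfolding H_def by (rule sp_spaceD(3)[OF Wsp p0])
    have Wlim: "uniform_limit (cball 0 s) (\<lambda>N z. W (SN x N) z - W (J x) z) (\<lambda>_. 0) sequentially" if s: "s < 1" for s
    proof -
      have c\<psi>: "compact (\<psi> ` cball 0 s)"
        by (intro compact_continuous_image compact_cball holomorphic_on_imp_continuous_on holomorphic_on_subset[OF psi(1)]) (use s in auto)
      have cK: "compact (norm ` (\<psi> ` cball 0 s))" by (rule compact_continuous_image[OF _ c\<psi>]) (intro continuous_intros)
      obtain t where t: "t < 1" "\<And>z. z \<in> cball 0 s \<Longrightarrow> norm (\<psi> z) \<le> t"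
      proof (cases "cball 0 s = ({} :: complex set)")
        case True
        show ?thesis by (rule that[of 0]) (use True in auto)
      next
        case False
        then obtain y where y: "y \<in> norm ` (\<psi> ` cball 0 s)" "\<forall>x\<in>norm ` (\<psi> ` cball 0 s). x \<le> y"
          using compact_attains_sup[OF cK] by blast
        show ?thesis by (rule that[of y]) (use y npsi s in auto)
      qed
      have "bounded (\<phi> ` cball 0 s)"
        by (intro compact_imp_bounded compact_continuous_image compact_cball holomorphic_on_imp_continuous_on holomorphic_on_subset[OF phi])
           (use s in auto)
      moreover have "uniform_limit (cball 0 s) (\<lambda>N z. SN x N (\<psi> z) - J x (\<psi> z)) (\<lambda>_. 0) sequentially"
        by (rule uniform_limit_compose'[OF lim0[OF x t(1)]]) (use t in auto)
      ultimately have "uniform_limit (cball 0 s) (\<lambda>N z. \<phi> z * (SN x N (\<psi> z) - J x (\<psi> z))) (\<lambda>z. \<phi> z * 0) sequentially"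
        by (intro uniform_lim_mult uniform_limit_const) (auto simp: bounded_iff)
      thus ?thesis
        by (rule uniform_limit_cong'[THEN iffD1, rotated -1]) (use s in \<open>auto simp: wcomp_def algebra_simps\<close>)
    qed
    have fin: "c * (\<Sum>n<N. norm (x n) powr p) \<le> 2 powr p * H powr p + c / 2 * lp_norm p x powr p" for N
    proof -
      have "\<forall>n. \<exists>r. 0 \<le> r \<and> r < 1 \<and> c \<le> cmean (\<lambda>z. norm (v n z) powr p) r"
        using big unfolding v_def K_def by blast
      from choice[OF this] obtain q where "\<forall>n. 0 \<le> q n \<and> q n < 1 \<and> c \<le> cmean (\<lambda>z. norm (v n z) powr p) (q n)" ..
      hence q: "\<And>n. 0 \<le> q n \<and> q n < 1 \<and> c \<le> cmean (\<lambda>z. norm (v n z) powr p) (q n)" by blast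
      define r where "r = Max (insert 0 (q ` {..<N}))"
      have fi: "finite (insert 0 (q ` {..<N}))" by simp
      have "r \<in> insert 0 (q ` {..<N})" unfolding r_def using Max_in[OF fi] by blast
      hence r: "0 \<le> r" "r < 1" using q by auto
      have qr: "q n \<le> r" if "n < N" for n unfolding r_def using that by (intro Max_ge fi) auto
      have cv: "c \<le> cmean (\<lambda>z. norm (v n z) powr p) r" if "n < N" for n
        using hp_mean_mono[OF hv p0, of "q n" r n] q[of n] qr[OF that] r by force
      have "c * (\<Sum>n<N. norm (x n) powr p) \<le> 2 powr p * cmean (\<lambda>z. norm (deriv (W (SN x M)) z) powr p) r + c / 2 * lp_norm p x powr p"
        if MN: "M \<ge> N" for M
      proof -
        have "c * (\<Sum>n<N. norm (x n) powr p) \<le> (\<Sum>n<N. norm (x n) powr p * cmean (\<lambda>z. norm (v n z) powr p) r)"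
          unfolding sum_distrib_left unfolding mult.commute[of c] by (intro sum_mono mult_left_mono cv) auto
        also have "\<dots> \<le> (\<Sum>n<M. norm (x n) powr p * cmean (\<lambda>z. norm (v n z) powr p) r)"
          by (intro sum_mono2 mult_nonneg_nonneg cmean_nonneg continuous_on_sphere_norm_powr cG r p0) (use MN in auto)
        also have "\<dots> \<le> 2 powr p * cmean (\<lambda>z. norm (\<Sum>n<M. x n * v n z) powr p) r + (2 powr p + 1) * (e * (\<Sum>n<M. norm (x n) powr p))"
          by (rule almost_disjoint_means(2)[OF r(1) p0 cG(2)[OF r(2)] bump(2)[OF r(2)] _ dis])
             (use smallW[OF r] ring_bump_bounds in \<open>auto simp: v_def K_def\<close>)
        also have "(2 powr p + 1) * (e * (\<Sum>n<M. norm (x n) powr p)) = c / 2 * (\<Sum>n<M. norm (x n) powr p)"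
          unfolding e(2)[symmetric] by simp
        also have "\<dots> \<le> c / 2 * lp_norm p x powr p" using c by (intro mult_left_mono sum_le_lp_norm[OF x p0]) auto
        also have "cmean (\<lambda>z. norm (\<Sum>n<M. x n * v n z) powr p) r = cmean (\<lambda>z. norm (deriv (W (SN x M)) z) powr p) r"
          by (rule cmean_cong) (use dWSN r in auto)
        finally show ?thesis by simp
      qed
      moreover have "(\<lambda>M. 2 powr p * cmean (\<lambda>z. norm (deriv (W (SN x M)) z) powr p) r + c / 2 * lp_norm p x powr p)
          \<longlonglongrightarrow> 2 powr p * cmean (\<lambda>z. norm (deriv (W (J x)) z) powr p) r + c / 2 * lp_norm p x powr p"
      proof -
        have "uniform_limit (cball 0 r) (\<lambda>M. deriv (W (SN x M))) (deriv (W (J x))) sequentially"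
          by (rule deriv_uniform_limit[OF W_holomorphic[OF hSN] W_holomorphic[OF hJ[OF x]] Wlim r(2)])
        hence "uniform_limit (sphere 0 r) (\<lambda>M. deriv (W (SN x M))) (deriv (W (J x))) sequentially"
          by (rule uniform_limit_on_subset) auto
        hence "(\<lambda>M. cmean (\<lambda>z. norm (deriv (W (SN x M)) z) powr p) r) \<longlonglongrightarrow> cmean (\<lambda>z. norm (deriv (W (J x)) z) powr p) r"
          by (rule cmean_powr_tendsto[OF _ _ p0 r(1)])
             (intro continuous_on_sphere_subset holomorphic_on_imp_continuous_on holomorphic_deriv W_holomorphic hSN open_ball r)
        thus ?thesis by (intro tendsto_intros)
      qed
      ultimately have "c * (\<Sum>n<N. norm (x n) powr p) \<le> 2 powr p * cmean (\<lambda>z. norm (deriv (W (J x)) z) powr p) r + c / 2 * lp_norm p x powr p"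
        by (intro LIMSEQ_le_const) auto
      moreover have "2 powr p * cmean (\<lambda>z. norm (deriv (W (J x)) z) powr p) r \<le> 2 powr p * H powr p"
        by (intro mult_left_mono hp_leD(2)[OF hpH] r) auto
      ultimately show ?thesis by linarith
    qed
    have "(\<lambda>N. c * (\<Sum>n<N. norm (x n) powr p)) \<longlonglongrightarrow> c * lp_norm p x powr p"
      unfolding lp_norm_powr[OF x p0] using x by (intro tendsto_intros summable_LIMSEQ) (auto simp: lp_space_def)
    hence "c * lp_norm p x powr p \<le> 2 powr p * H powr p + c / 2 * lp_norm p x powr p"
      by (rule LIMSEQ_le_const2) (use fin in auto)
    hence le: "lp_norm p x powr p \<le> 2 * 2 powr p / c * H powr p" using c by (simp add: field_simps)
    have H0: "H \<ge> 0" by (simp add: H_def)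
    have "lp_norm p x = (lp_norm p x powr p) powr (1 / p)" using p0 lp_norm_nonneg[of p x] by (simp add: powr_powr)
    also have "\<dots> \<le> (2 * 2 powr p / c * H powr p) powr (1 / p)" using le p0 by (intro powr_mono2) auto
    also have "\<dots> = A * H" unfolding A_def powr_mult[of "2 * 2 powr p / c"] using H0 p0 by (simp add: powr_powr)
    also have "\<dots> \<le> A * sp_norm p (W (J x))" using A by (intro mult_left_mono) (auto simp: sp_norm_def H_def)
    finally show ?thesis .
  qed
  obtain CW where CW: "CW > 0" "\<And>f. f \<in> sp_space p \<Longrightarrow> sp_norm p (W f) \<le> CW * sp_norm p f" using W_bound by blast
  have lower': "lp_norm p x \<le> A * CW * sp_norm p (J x)" if x: "x \<in> lp_space p" for x
    unfolding mult.assoc by (rule order_trans[OF lower[OF x] mult_left_mono[OF CW(2)[OF Jsp[OF x]]]]) (use A in simp)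
  define M where "M = J ` lp_space p"
  have Jadd: "J (\<lambda>n. x n + y n) = (\<lambda>z. J x z + J y z)" if "x \<in> lp_space p" "y \<in> lp_space p" for x y
    unfolding J_def using suminf_add[OF sumK[OF that(1)] sumK[OF that(2)]] by (auto simp: algebra_simps)
  have Jmult: "J (\<lambda>n. d * x n) = (\<lambda>z. d * J x z)" if "x \<in> lp_space p" for d x
    unfolding J_def using suminf_mult[OF sumK[OF that], of d] by (auto simp: mult.assoc)
  have Jdiff: "J (\<lambda>n. x n - y n) = (\<lambda>z. J x z - J y z)" if "x \<in> lp_space p" "y \<in> lp_space p" for x y
    using Jadd[OF that(1) lp_space_cmult[OF that(2), of "-1"]] Jmult[OF that(2), of "-1"] by simp
  have inj: "inj_on J (lp_space p)"
  proof (rule inj_onI)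
    fix x y assume xy: "x \<in> lp_space p" "y \<in> lp_space p" "J x = J y"
    have d: "(\<lambda>n. x n - y n) \<in> lp_space p" by (rule lp_space_diff[OF xy(1,2) p0])
    have z: "(\<lambda>_. 0) \<in> lp_space p" by (rule lp_space_finite[of 0]) simp
    have "J (\<lambda>n. x n - y n) = (\<lambda>z. 0 * J (\<lambda>_. 0) z)" using Jdiff[OF xy(1,2)] xy(3) by simp
    moreover have "sp_norm p (\<lambda>z. 0 * J (\<lambda>_. 0) z) \<le> norm (0::complex) * sp_norm p (J (\<lambda>_. 0))"
      by (rule sp_space_cmult(2)[OF Jsp[OF z] p0])
    ultimately have "sp_norm p (J (\<lambda>n. x n - y n)) \<le> 0" by simp
    hence "lp_norm p (\<lambda>n. x n - y n) \<le> 0"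
      using lower'[OF d] mult_left_mono[of "sp_norm p (J (\<lambda>n. x n - y n))" 0 "A * CW"] A CW(1) by simp
    hence "norm (x n - y n) \<le> 0" for n by (rule order_trans[OF norm_le_lp_norm[OF d p0]])
    thus "x = y" by (intro ext) simp
  qed
  have "isomorphic_to_lp p M"
    unfolding isomorphic_to_lp_def
  proof (intro exI[of _ J] conjI ballI allI)
    show "bij_betw J (lp_space p) M" using inj by (simp add: bij_betw_def M_def)
    show "\<exists>a>0. \<exists>b. \<forall>x\<in>lp_space p. a * lp_norm p x \<le> sp_norm p (J x) \<and> sp_norm p (J x) \<le> b * lp_norm p x"
      using lower' Jb A CW(1) by (intro exI[of _ "1 / (A * CW)"] conjI exI[of _ b]) (auto simp: field_simps)
  qed (use Jadd Jmult in auto)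
  moreover have "iso_on p W M"
    unfolding iso_on_def
  proof (intro exI[of _ "1 / (b * A)"] conjI ballI)
    show "1 / (b * A) > 0" using b A by simp
    fix f assume "f \<in> M"
    then obtain x where x: "x \<in> lp_space p" "f = J x" by (auto simp: M_def)
    have "sp_norm p f \<le> b * (A * sp_norm p (W f))"
      unfolding x(2) by (rule order_trans[OF Jb[OF x(1)] mult_left_mono[OF lower[OF x(1)]]]) (use b in auto)
    thus "1 / (b * A) * sp_norm p f \<le> sp_norm p (W f)" using b A by (simp add: field_simps)
  qed
  moreover have "closed_subspace p M"
    unfolding closed_subspace_def
  proof (intro conjI allI impI)
    show "M \<subseteq> sp_space p" using Jsp by (auto simp: M_def)
    show "linear_subspace M"
      unfolding linear_subspace_def
    proof (intro conjI ballI allI)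
      have z: "(\<lambda>_. 0) \<in> lp_space p" by (rule lp_space_finite[of 0]) simp
      have "J (\<lambda>_. 0) = (\<lambda>z. 0)" by (simp add: J_def[abs_def])
      thus "(\<lambda>z. 0) \<in> M" unfolding M_def using z by (metis image_eqI)
      show "(\<lambda>z. f z + g z) \<in> M" if "f \<in> M" "g \<in> M" for f g
      proof -
        from that obtain x y where xy: "x \<in> lp_space p" "y \<in> lp_space p" "f = J x" "g = J y" by (auto simp: M_def)
        show ?thesis unfolding M_def xy(3,4) Jadd[OF xy(1,2), symmetric] by (intro imageI lp_space_add xy p0)
      qed
      show "(\<lambda>z. d * f z) \<in> M" if "f \<in> M" for d f
      proof -
        from that obtain x where x: "x \<in> lp_space p" "f = J x" by (auto simp: M_def)
        show ?thesis unfolding M_def x(2) Jmult[OF x(1), symmetric] by (intro imageI lp_space_cmult x)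
      qed
    qed
    fix f g assume f: "\<forall>n::nat. f n \<in> M" and g: "g \<in> sp_space p" and lim: "(\<lambda>n. sp_norm p (\<lambda>z. f n z - g z)) \<longlonglongrightarrow> 0"
    define d where "d n = sp_norm p (\<lambda>z. f n z - g z)" for n
    have "\<forall>n. \<exists>x. x \<in> lp_space p \<and> f n = J x" using f by (auto simp: M_def)
    from choice[OF this] obtain X where X: "\<And>n. X n \<in> lp_space p" "\<And>n. f n = J (X n)" by blast
    have fsp: "f n \<in> sp_space p" for n unfolding X(2) by (rule Jsp[OF X(1)])
    define E where "E = A * CW * 4"
    have E: "E > 0" using A CW by (simp add: E_def)
    have dX: "(\<lambda>i. X m i - X n i) \<in> lp_space p" for m n by (rule lp_space_diff[OF X(1) X(1) p0])
    have XE: "lp_norm p (\<lambda>i. X m i - X n i) \<le> E * (d m + d n)" for m n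
    proof -
      have "J (\<lambda>i. X m i - X n i) = (\<lambda>z. (f m z - g z) - (f n z - g z))"
        unfolding Jdiff[OF X(1) X(1)] X(2) by simp
      hence "sp_norm p (J (\<lambda>i. X m i - X n i)) \<le> 4 * (d m + d n)"
        unfolding d_def using sp_space_diff(2)[OF sp_space_diff(1)[OF fsp g p1] sp_space_diff(1)[OF fsp g p1] p1] by simp
      hence "A * CW * sp_norm p (J (\<lambda>i. X m i - X n i)) \<le> A * CW * (4 * (d m + d n))"
        using A CW by (intro mult_left_mono) auto
      thus ?thesis using lower'[OF dX[of m n]] by (simp add: E_def mult.assoc)
    qed
    have dlim: "d \<longlonglongrightarrow> 0" using lim by (simp add: d_def[abs_def])
    have dnn: "d n \<ge> 0" for n by (simp add: d_def sp_norm_nonneg)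
    have "convergent (\<lambda>n. X n i)" for i
    proof (rule Cauchy_convergent, rule CauchyI)
      fix t :: real assume t: "t > 0"
      have "eventually (\<lambda>n. d n < t / (2 * E)) sequentially" using t E by (intro order_tendstoD(2)[OF dlim]) auto
      then obtain N where N: "\<And>n. n \<ge> N \<Longrightarrow> d n < t / (2 * E)" unfolding eventually_sequentially by blast
      have "norm (X m i - X n i) < t" if "m \<ge> N" "n \<ge> N" for m n
      proof -
        have "norm (X m i - X n i) \<le> E * (d m + d n)" by (rule order_trans[OF norm_le_lp_norm[OF dX p0] XE])
        also have "\<dots> < E * (t / (2 * E) + t / (2 * E))" using N that E by (intro mult_strict_left_mono add_strict_mono) auto
        also have "\<dots> = t" using E by (simp add: field_simps)
        finally show ?thesis .
      qed
      thus "\<exists>N. \<forall>m\<ge>N. \<forall>n\<ge>N. norm (X m i - X n i) < t" by blast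
    qed
    hence "\<forall>i. \<exists>y. (\<lambda>n. X n i) \<longlonglongrightarrow> y" by (simp add: convergent_def)
    from choice[OF this] obtain x where x: "\<And>i. (\<lambda>n. X n i) \<longlonglongrightarrow> x i" by blast
    have part: "(\<Sum>i<N. norm (X m i - x i) powr p) \<le> (E * d m) powr p" for m N
    proof -
      have "(\<lambda>n. \<Sum>i<N. norm (X m i - X n i) powr p) \<longlonglongrightarrow> (\<Sum>i<N. norm (X m i - x i) powr p)"
        by (intro tendsto_sum tendsto_powr' tendsto_intros x) (use p0 in auto)
      moreover have "(\<lambda>n. (E * (d m + d n)) powr p) \<longlonglongrightarrow> (E * (d m + 0)) powr p"
        by (intro tendsto_powr' tendsto_intros dlim) (use p0 E dnn in auto)
      moreover have "(\<Sum>i<N. norm (X m i - X n i) powr p) \<le> (E * (d m + d n)) powr p" for n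
        by (rule order_trans[OF sum_le_lp_norm[OF dX p0] powr_mono2]) (use p0 XE lp_norm_nonneg in auto)
      ultimately show ?thesis by (auto intro: LIMSEQ_le)
    qed
    have sm: "summable (\<lambda>i. norm (X m i - x i) powr p)" for m by (rule summableI_nonneg_bounded[OF _ part]) auto
    have xd: "(\<lambda>i. X m i - x i) \<in> lp_space p" for m using sm by (simp add: lp_space_def)
    have xl: "x \<in> lp_space p" using lp_space_diff[OF X(1)[of 0] xd[of 0] p0] by simp
    have le1: "norm (f m z - J x z) \<le> 20 * (b * (E * d m))" for m z
    proof -
      have "(\<Sum>i. norm (X m i - x i) powr p) \<le> (E * d m) powr p" by (rule suminf_le_const[OF sm part])
      hence "lp_norm p (\<lambda>i. X m i - x i) \<le> E * d m" using E dnn by (intro lp_norm_le[OF xd p0]) auto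
      hence "b * lp_norm p (\<lambda>i. X m i - x i) \<le> b * (E * d m)" using b by (intro mult_left_mono) auto
      moreover have "norm (f m z - J x z) \<le> 20 * sp_norm p (J (\<lambda>i. X m i - x i))"
        using sp_pointwise[OF Jsp[OF xd[of m]] p1, of z] unfolding Jdiff[OF X(1) xl] X(2) .
      ultimately show ?thesis using Jb[OF xd[of m]] by linarith
    qed
    have le2: "norm (f m z - g z) \<le> 20 * d m" for m z
      unfolding d_def by (rule sp_pointwise[OF sp_space_diff(1)[OF fsp g p1] p1])
    have le: "norm (J x z - g z) \<le> 20 * (b * (E * d m)) + 20 * d m" for m z
    proof -
      have "J x z - g z = (f m z - g z) - (f m z - J x z)" by simp
      hence "norm (J x z - g z) \<le> norm (f m z - g z) + norm (f m z - J x z)" by (simp only: norm_triangle_ineq4)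
      thus ?thesis using le1[of m z] le2[of m z] by linarith
    qed
    have "J x z = g z" for z
    proof -
      have "(\<lambda>m. 20 * (b * (E * d m)) + 20 * d m) \<longlonglongrightarrow> 20 * (b * (E * 0)) + 20 * 0" by (intro tendsto_intros dlim)
      hence "norm (J x z - g z) \<le> 20 * (b * (E * 0)) + 20 * 0" by (rule LIMSEQ_le_const) (use le in auto)
      thus ?thesis by simp
    qed
    hence "g = J x" by auto
    thus "g \<in> M" using xl by (simp add: M_def)
  qed
  ultimately show ?thesis unfolding fixes_copy_lp_def by blast
qed

end

theorem theorem1:
  fixes p :: real and \<phi> \<psi> :: "complex \<Rightarrow> complex"
  assumes "1 \<le> p"
    and "\<phi> holomorphic_on ball 0 1"
    and "\<psi> holomorphic_on ball 0 1" and "\<psi> ` ball 0 1 \<subseteq> ball 0 1"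
    and "bounded_op p (wcomp \<phi> \<psi>)"
  shows "(\<not> compact_op p (wcomp \<phi> \<psi>) \<longrightarrow>
            fixes_copy_lp p (wcomp \<phi> \<psi>) \<and> \<not> strictly_singular p (wcomp \<phi> \<psi>))
       \<and> (strictly_singular p (wcomp \<phi> \<psi>) \<longleftrightarrow> compact_op p (wcomp \<phi> \<psi>))"
proof -
  interpret weighted_composition p \<phi> \<psi> by unfold_locales fact+
  have "fixes_copy_lp p W \<and> \<not> strictly_singular p W" if "\<not> compact_op p W"
    using noncompact_fixes_lp[OF that] fixes_copy_not_strictly_singular p0 by blast
  thus ?thesis using compact_imp_strictly_singular by blast
qed

end
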